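(* Let $\Omega=\{x_0,\dots,x_m\}$ be a finite set, let $C,F:\Omega\to\mathbb{R}$ with $F$ non-constant, and let $\mathcal{E}=\mathcal{E}_{C,F}$ be the corresponding $1$-dimensional exponential family. Let $\Omega_{red}=\{0,1,\dots,p\}$ denote the sample space on which the reduced exponential family $\mathcal{E}_{red}$ is defined. Suppose that $\mathcal{E}$ is toric and that the space $\mathscr{K}(N)$ of Kähler functions on the regular torification $N$ of $\mathcal{E}$ separates the points of $N$. Then: (1) $\mathcal{E}_{red}\sim\mathcal{B}(p)$ (equivalence of exponential families). (2) $\mathcal{E}\cong M_{1/p}$ (isomorphism of dually flat manifolds). (3) The action $\mathbb{T}\times\mathbb{P}_1(\tfrac1p)\to\mathbb{P}_1(\tfrac1p)$, $([t],[z_0,z_1])\mapsto[e^{2i\pi t}z_0,z_1]$, where $\mathbb{T}=\mathbb{R}/\mathbb{Z}$, is a regular torification of $\mathcal{E}$.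
   Context: Exponential families. For a finite set $\Omega=\{x_0,\dots,x_m\}$ and $C,F:\Omega\to\mathbb{R}$ with $F$ and the constant function $1$ linearly independent, $\mathcal{E}_{C,F}$ is the set of probability functions $p_{C,F}(x;\theta)=\exp\{C(x)+\theta F(x)-\psi_{C,F}(\theta)\}$, $x\in\Omega$, $\theta\in\mathbb{R}$, where $\psi_{C,F}(\theta)=\ln\big(\sum_{k=0}^m\exp(C(x_k)+\theta F(x_k))\big)$. The map $\theta\mapsto p_{C,F}(\cdot;\theta)$ is a bijection $\mathbb{R}\to\mathcal{E}_{C,F}$, so $\theta$ is a global coordinate. $\mathcal{E}_{C,F}$ is regarded as a dually flat manifold with the Fisher metric $h_F$, given by $h_F(\partial_\theta,\partial_\theta)=\psi_{C,F}''(\theta)$, and the exponential connection, i.e. the flat connection for which $\theta$ is an affine coordinate. Two such families $\mathcal{E}_{C,F}$, $\mathcal{E}_{C',F'}$ on the same set $\Omega$ are equivalent, written $\mathcal{E}_{C,F}\sim\mathcal{E}_{C',F'}$, if the families of functions $\{p_{C,F}(\cdot;\theta)\}_{\theta\in\mathbb{R}}$ and $\{p_{C',F'}(\cdot;\theta)\}_{\theta\in\mathbb{R}}$ on $\Omega$ coincide. Reduced family: write $F(\Omega)=\{\alpha_0<\dots<\alpha_p\}$ and let $\omega_i\in\mathbb{R}$ be given by $e^{\omega_i}=\sum_{x\in F^{-1}(\alpha_i)}e^{C(x)}$. Put $\Omega_{red}=\{0,1,\dots,p\}$, $F_{red}(k)=\alpha_k$, $C_{red}(k)=\omega_k$, and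 $\mathcal{E}_{red}=\mathcal{E}_{C_{red},F_{red}}$ (a family over $\Omega_{red}$). $\mathcal{B}(p)$ is the family of binomial distributions $k\mapsto\binom{p}{k}q^k(1-q)^{p-k}$, $q\in(0,1)$, over $\{0,\dots,p\}$, i.e. $\mathcal{B}(p)=\mathcal{E}_{C,F}$ with $C(k)=\ln\binom pk$, $F(k)=k$. Models. For $c>0$, $M_c=\mathbb{R}$ with linear coordinate $\theta$, metric $h_c(\partial_\theta,\partial_\theta)=\frac{1}{c\cosh^2(\theta)}$ and the standard flat connection. $\mathbb{P}_1(c)$ is the complex projective line with the Fubini–Study metric normalized to have holomorphic sectional curvature $c>0$. Dually flat manifolds. A dually flat manifold is a triple $(M,h,\nabla)$ where $h$ is a Riemannian metric on the manifold $M$ and $\nabla$ is an affine connection such that both $\nabla$ and its dual connection $\nabla^*$, defined by $X(h(Y,Z))=h(\nabla_XY,Z)+h(Y,\nabla^*_XZ)$, are flat (zero curvature and torsion). Coordinates $(x_1,\dots,x_n)$ are affine if $\nabla_{\partial_i}\partial_j=0$ for all $i,j$. An isomorphism of dually flat manifolds $(M,h,\nabla)\to(M',h',\nabla')$ is a diffeomorphism $f$ that is affine with respect to $\nabla,\nabla'$ (locally $x\mapsto Ax+b$ in affine coordinates) and satisfies $f^*h'=h$. Dombrowski's construction. If $(x_1,\dots,x_n)$ are affine coordinates on $U\subseteq M$, let $(q,r)$ be the coordinates on $\pi^{-1}(U)\subseteq TM$ ($\pi:TM\to M$ the projection) given by $(q,r)(\sum_j a_j\frac{\partial}{\partial x_j}|_p)=(x_1(p),\dots,x_n(p),a_1,\dots,a_n)$.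 The functions $z_j=q_j+ir_j$ form holomorphic charts making $TM$ a complex manifold, and the metric with matrix $\begin{bmatrix} h(x)&0\\0&h(x)\end{bmatrix}$ in the coordinates $(q,r)$, where $h(x)$ is the matrix of $h$ in the coordinates $x$, is a Kähler metric on $TM$. $TM$ is always given this Kähler structure. Torification. Let $(M,h,\nabla)$ be connected, $n=\dim M$, $\mathbb{T}^n=\mathbb{R}^n/\mathbb{Z}^n$. A parallel lattice is a set $L=\{k_1X_1(p)+\dots+k_nX_n(p)\mid k_i\in\mathbb{Z},p\in M\}\subset TM$, where $X=(X_1,\dots,X_n)$ is a frame of $\nabla$-parallel vector fields on $M$ (a basis of $T_pM$ at every $p$); $X$ is called a generator of $L$. Let $\Gamma(L)\cong\mathbb{Z}^n$ be the group of transformations $u\mapsto u+k_1X_1+\dots+k_nX_n$ of $TM$, $k_i\in\mathbb{Z}$; it acts freely, properly, and by holomorphic isometries, so $M_L=TM/\Gamma(L)$ is a Kähler manifold, with quotient map $q_L:TM\to M_L$ and torus action $\Phi_X([t],q_L(u))=q_L(u+t_1X_1+\dots+t_nX_n)$. Let $N$ be a connected Kähler manifold of complex dimension $n$ with an effective, holomorphic and isometric action $\Phi:\mathbb{T}^n\times N\to N$, and let $N^\circ$ be the set of points where $\Phi$ is free. $N$ (or $\Phi$) is a torification of $M$ if there exist a parallel lattice $L\subset TM$, a generator $X$ of $L$, and a holomorphic isometric diffeomorphism $G:M_L\to N^\circ$ with $G\circ(\Phi_X)_a=\Phi_a\circ G$ for all $a\in\mathbb{T}^n$. A torification is regular if $N$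 is connected, simply connected, complete and its Kähler metric is real analytic. $(M,h,\nabla)$ is toric if it has a regular torification (which is then unique up to equivariant Kähler isomorphism and reparametrization of the torus by a Lie group automorphism). Kähler functions. On a Kähler manifold $N$ with structure $(g,J,\omega)$, a smooth function $f:N\to\mathbb{R}$ is Kähler if $\mathscr{L}_{X_f}g=0$, where $X_f$ is defined by $\omega(X_f,\cdot)=df$. $\mathscr{K}(N)$ is the space of Kähler functions; it separates the points of $N$ if $f(p)=f(q)$ for all $f\in\mathscr{K}(N)$ implies $p=q$. *)

theory Defs
  imports "HOL-Analysis.Analysis"
begin

section \<open>Smooth and real analytic functions on open sets\<close>

text \<open>Only used on open subsets of finite-dimensional spaces, where continuity of all iterated
  directional derivatives is continuity of the iterated Frechet derivatives.\<close>

primrec Ck_on :: "nat \<Rightarrow> ('a::real_normed_vector \<Rightarrow> 'b::real_normed_vector) \<Rightarrow> 'a set \<Rightarrow> bool" where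
  "Ck_on 0 f S \<longleftrightarrow> continuous_on S f"
| "Ck_on (Suc k) f S \<longleftrightarrow>
     (\<forall>x\<in>S. f differentiable (at x)) \<and> (\<forall>v. Ck_on k (\<lambda>x. frechet_derivative f (at x) v) S)"

definition smooth_on :: "('a::real_normed_vector \<Rightarrow> 'b::real_normed_vector) \<Rightarrow> 'a set \<Rightarrow> bool" where
  "smooth_on f S \<longleftrightarrow> (\<forall>k. Ck_on k f S)"

definition real_analytic_on :: "(complex \<Rightarrow> real) \<Rightarrow> complex set \<Rightarrow> bool" where
  "real_analytic_on f S \<longleftrightarrow>
     (\<forall>w\<in>S. \<exists>r>0. \<exists>a :: nat \<Rightarrow> nat \<Rightarrow> real. \<forall>z\<in>ball w r.
        ((\<lambda>(m, n). a m n * (Re (z - w)) ^ m * (Im (z - w)) ^ n) has_sum f z) UNIV)"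


section \<open>Topological preliminaries\<close>

definition quotient_topology :: "'a topology \<Rightarrow> ('a \<Rightarrow> 'b) \<Rightarrow> 'b topology" where
  "quotient_topology X q =
     topology (\<lambda>W. W \<subseteq> q ` topspace X \<and> openin X {x \<in> topspace X. q x \<in> W})"

lemma openin_quotient_topology:
  "openin (quotient_topology X q) W \<longleftrightarrow>
     W \<subseteq> q ` topspace X \<and> openin X {x \<in> topspace X. q x \<in> W}"
proof -
  have "istopology (\<lambda>W. W \<subseteq> q ` topspace X \<and> openin X {x \<in> topspace X. q x \<in> W})"
    unfolding istopology_def
  proof (intro conjI allI impI)
    fix S T
    assume S: "S \<subseteq> q ` topspace X \<and> openin X {x \<in> topspace X. q x \<in> S}"
      and T: "T \<subseteq> q ` topspace X \<and> openin X {x \<in> topspace X. q x \<in> T}"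
    show "S \<inter> T \<subseteq> q ` topspace X"
      using S by blast
    have "{x \<in> topspace X. q x \<in> S \<inter> T} = {x \<in> topspace X. q x \<in> S} \<inter> {x \<in> topspace X. q x \<in> T}"
      by blast
    then show "openin X {x \<in> topspace X. q x \<in> S \<inter> T}"
      using S T by auto
  next
    fix K
    assume K: "\<forall>W\<in>K. W \<subseteq> q ` topspace X \<and> openin X {x \<in> topspace X. q x \<in> W}"
    show "\<Union> K \<subseteq> q ` topspace X"
      using K by blast
    have "{x \<in> topspace X. q x \<in> \<Union> K} = \<Union> ((\<lambda>W. {x \<in> topspace X. q x \<in> W}) ` K)"
      by blast
    then show "openin X {x \<in> topspace X. q x \<in> \<Union> K}"
      using K by auto
  qed
  then show ?thesis
    by (simp add: quotient_topology_def)
qed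

text \<open>The library constant \<^const>\<open>simply_connected\<close> is for subsets of a type with a topology; this
  is the same definition (any two loops are freely homotopic) for an abstract topology.\<close>

definition simply_connected_space :: "'a topology \<Rightarrow> bool" where
  "simply_connected_space X \<longleftrightarrow>
     (\<forall>p q. pathin X p \<and> p 1 = p 0 \<and> pathin X q \<and> q 1 = q 0 \<longrightarrow>
        homotopic_with (\<lambda>r. r 1 = r 0) (top_of_set {0..1}) X p q)"


section \<open>Kaehler manifolds of complex dimension one\<close>

text \<open>A chart is a pair of a domain \<open>U\<close> and a map \<open>\<phi>\<close> from \<open>U\<close> to the complex numbers. The metric is
  given in charts: \<open>met M \<phi> p u v\<close> is the inner product of the two tangent vectors at \<open>p\<close> whose
  coordinates with respect to the chart \<open>(U, \<phi>)\<close> are \<open>u\<close> and \<open>v\<close>. In a chart, the complex structure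
  \<open>J\<close> is multiplication by \<open>\<i>\<close>.\<close>

record 'a hermitian =
  tops :: "'a topology"
  atlas :: "('a set \<times> ('a \<Rightarrow> complex)) set"
  met :: "('a \<Rightarrow> complex) \<Rightarrow> 'a \<Rightarrow> complex \<Rightarrow> complex \<Rightarrow> real"

abbreviation pts :: "'a hermitian \<Rightarrow> 'a set" where
  "pts M \<equiv> topspace (tops M)"

text \<open>Local representatives: of the metric and of the Kaehler form \<open>\<omega> = g(J\<cdot>, \<cdot>)\<close> in the chart
  \<open>(U, \<phi>)\<close>, as functions on \<open>\<phi> ` U\<close>, and of a map \<open>f\<close> with respect to the charts \<open>(U, \<phi>)\<close> and
  \<open>(V, \<psi>)\<close>.\<close>

definition loc_met ::
  "'a hermitian \<Rightarrow> 'a set \<Rightarrow> ('a \<Rightarrow> complex) \<Rightarrow> complex \<Rightarrow> complex \<Rightarrow> complex \<Rightarrow> real" where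
  "loc_met M U \<phi> z u v = met M \<phi> (inv_into U \<phi> z) u v"

definition loc_form ::
  "'a hermitian \<Rightarrow> 'a set \<Rightarrow> ('a \<Rightarrow> complex) \<Rightarrow> complex \<Rightarrow> complex \<Rightarrow> complex \<Rightarrow> real" where
  "loc_form M U \<phi> z u v = loc_met M U \<phi> z (\<i> * u) v"

definition loc_map ::
  "'a set \<Rightarrow> ('a \<Rightarrow> complex) \<Rightarrow> ('b \<Rightarrow> complex) \<Rightarrow> ('a \<Rightarrow> 'b) \<Rightarrow> complex \<Rightarrow> complex" where
  "loc_map U \<phi> \<psi> f z = \<psi> (f (inv_into U \<phi> z))"

definition holomorphic_map :: "'a hermitian \<Rightarrow> 'b hermitian \<Rightarrow> ('a \<Rightarrow> 'b) \<Rightarrow> bool" where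
  "holomorphic_map M N f \<longleftrightarrow>
     continuous_map (tops M) (tops N) f \<and>
     (\<forall>(U, \<phi>)\<in>atlas M. \<forall>(V, \<psi>)\<in>atlas N.
        loc_map U \<phi> \<psi> f holomorphic_on \<phi> ` {p \<in> U. f p \<in> V})"

definition isometric_map :: "'a hermitian \<Rightarrow> 'b hermitian \<Rightarrow> ('a \<Rightarrow> 'b) \<Rightarrow> bool" where
  "isometric_map M N f \<longleftrightarrow>
     (\<forall>(U, \<phi>)\<in>atlas M. \<forall>(V, \<psi>)\<in>atlas N. \<forall>p\<in>U. f p \<in> V \<longrightarrow>
        (\<forall>u v. met N \<psi> (f p) (deriv (loc_map U \<phi> \<psi> f) (\<phi> p) * u) (deriv (loc_map U \<phi> \<psi> f) (\<phi> p) * v)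
             = met M \<phi> p u v))"

definition kahler_iso :: "'a hermitian \<Rightarrow> 'b hermitian \<Rightarrow> ('a \<Rightarrow> 'b) \<Rightarrow> bool" where
  "kahler_iso M N f \<longleftrightarrow>
     (\<exists>f'. homeomorphic_maps (tops M) (tops N) f f' \<and>
           holomorphic_map M N f \<and> holomorphic_map N M f') \<and>
     isometric_map M N f"

text \<open>In \<open>closed\<close>, the left-hand side is \<open>d\<omega>(u, v, w)\<close> for the constant vector fields \<open>u, v, w\<close>.\<close>

locale kahler_manifold =
  fixes M :: "'a hermitian"
  assumes Hausdorff: "Hausdorff_space (tops M)"
    and second_countable: "second_countable (tops M)"
    and cover: "pts M = (\<Union>(U, \<phi>)\<in>atlas M. U)"
    and chart: "(U, \<phi>) \<in> atlas M \<Longrightarrow>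
       openin (tops M) U \<and> open (\<phi> ` U) \<and>
       homeomorphic_map (subtopology (tops M) U) (top_of_set (\<phi> ` U)) \<phi>"
    and transition: "\<lbrakk>(U, \<phi>) \<in> atlas M; (V, \<psi>) \<in> atlas M\<rbrakk> \<Longrightarrow>
       loc_map U \<phi> \<psi> id holomorphic_on \<phi> ` (U \<inter> V)"
    and met_transition: "\<lbrakk>(U, \<phi>) \<in> atlas M; (V, \<psi>) \<in> atlas M; p \<in> U \<inter> V\<rbrakk> \<Longrightarrow>
       met M \<psi> p (deriv (loc_map U \<phi> \<psi> id) (\<phi> p) * u) (deriv (loc_map U \<phi> \<psi> id) (\<phi> p) * v)
         = met M \<phi> p u v"
    and met_bilinear: "\<lbrakk>(U, \<phi>) \<in> atlas M; p \<in> U\<rbrakk> \<Longrightarrow> bilinear (met M \<phi> p)"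
    and met_sym: "\<lbrakk>(U, \<phi>) \<in> atlas M; p \<in> U\<rbrakk> \<Longrightarrow> met M \<phi> p u v = met M \<phi> p v u"
    and met_pos: "\<lbrakk>(U, \<phi>) \<in> atlas M; p \<in> U; u \<noteq> 0\<rbrakk> \<Longrightarrow> met M \<phi> p u u > 0"
    and met_hermitian: "\<lbrakk>(U, \<phi>) \<in> atlas M; p \<in> U\<rbrakk> \<Longrightarrow> met M \<phi> p (\<i> * u) (\<i> * v) = met M \<phi> p u v"
    and met_smooth: "(U, \<phi>) \<in> atlas M \<Longrightarrow> smooth_on (\<lambda>z. loc_met M U \<phi> z u v) (\<phi> ` U)"
    and closed: "\<lbrakk>(U, \<phi>) \<in> atlas M; z \<in> \<phi> ` U\<rbrakk> \<Longrightarrow>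
       frechet_derivative (\<lambda>z. loc_form M U \<phi> z v w) (at z) u
       + frechet_derivative (\<lambda>z. loc_form M U \<phi> z w u) (at z) v
       + frechet_derivative (\<lambda>z. loc_form M U \<phi> z u v) (at z) w = 0"

definition open_submanifold :: "'a hermitian \<Rightarrow> 'a set \<Rightarrow> 'a hermitian" where
  "open_submanifold M S =
     \<lparr>tops = subtopology (tops M) S, atlas = (\<lambda>(U, \<phi>). (U \<inter> S, \<phi>)) ` atlas M, met = met M\<rparr>"

subsection \<open>Completeness\<close>

text \<open>Curves are piecewise \<open>C\<^sup>1\<close>. The library notion \<^const>\<open>piecewise_C1_differentiable_on\<close> allows the
  derivative to be unbounded near the finitely many exceptional parameters, hence the requirement
  that the speed be integrable, i.e.\ that the curve have finite length. The speed does not depend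
  on the chart chosen in its definition.\<close>

definition speed :: "'a hermitian \<Rightarrow> (real \<Rightarrow> 'a) \<Rightarrow> real \<Rightarrow> real" where
  "speed M \<gamma> t =
     (let (U, \<phi>) = (SOME (U, \<phi>). (U, \<phi>) \<in> atlas M \<and> \<gamma> t \<in> U);
          v = vector_derivative (\<phi> \<circ> \<gamma>) (at t)
      in sqrt (met M \<phi> (\<gamma> t) v v))"

definition curve_between :: "'a hermitian \<Rightarrow> 'a \<Rightarrow> 'a \<Rightarrow> (real \<Rightarrow> 'a) \<Rightarrow> bool" where
  "curve_between M p q \<gamma> \<longleftrightarrow>
     pathin (tops M) \<gamma> \<and> \<gamma> 0 = p \<and> \<gamma> 1 = q \<and>
     (\<forall>(U, \<phi>)\<in>atlas M. \<forall>a b. 0 \<le> a \<and> a \<le> b \<and> b \<le> 1 \<and> \<gamma> ` {a..b} \<subseteq> U \<longrightarrow>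
        (\<phi> \<circ> \<gamma>) piecewise_C1_differentiable_on {a..b}) \<and>
     speed M \<gamma> integrable_on {0..1}"

definition riemannian_dist :: "'a hermitian \<Rightarrow> 'a \<Rightarrow> 'a \<Rightarrow> real" where
  "riemannian_dist M p q = (INF \<gamma>\<in>{\<gamma>. curve_between M p q \<gamma>}. integral {0..1} (speed M \<gamma>))"

definition complete_manifold :: "'a hermitian \<Rightarrow> bool" where
  "complete_manifold M \<longleftrightarrow>
     (\<forall>\<sigma> :: nat \<Rightarrow> 'a. range \<sigma> \<subseteq> pts M \<longrightarrow>
        (\<forall>\<epsilon>>0. \<exists>k. \<forall>m\<ge>k. \<forall>n\<ge>k. riemannian_dist M (\<sigma> m) (\<sigma> n) < \<epsilon>) \<longrightarrow>
        (\<exists>l\<in>pts M. (\<lambda>n. riemannian_dist M (\<sigma> n) l) \<longlonglongrightarrow> 0))"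

definition real_analytic_metric :: "'a hermitian \<Rightarrow> bool" where
  "real_analytic_metric M \<longleftrightarrow>
     (\<forall>(U, \<phi>)\<in>atlas M. \<forall>u v. real_analytic_on (\<lambda>z. loc_met M U \<phi> z u v) (\<phi> ` U))"

subsection \<open>Kaehler functions\<close>

definition ham_field ::
  "'a hermitian \<Rightarrow> 'a set \<Rightarrow> ('a \<Rightarrow> complex) \<Rightarrow> ('a \<Rightarrow> real) \<Rightarrow> complex \<Rightarrow> complex" where
  "ham_field M U \<phi> f z =
     (THE w. \<forall>v. loc_form M U \<phi> z w v = frechet_derivative (f \<circ> inv_into U \<phi>) (at z) v)"

definition lie_deriv_met ::
  "'a hermitian \<Rightarrow> 'a set \<Rightarrow> ('a \<Rightarrow> complex) \<Rightarrow> (complex \<Rightarrow> complex) \<Rightarrow>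
     complex \<Rightarrow> complex \<Rightarrow> complex \<Rightarrow> real" where
  "lie_deriv_met M U \<phi> X z u v =
     frechet_derivative (\<lambda>z. loc_met M U \<phi> z u v) (at z) (X z)
     + loc_met M U \<phi> z (frechet_derivative X (at z) u) v
     + loc_met M U \<phi> z u (frechet_derivative X (at z) v)"

definition kahler_functions :: "'a hermitian \<Rightarrow> ('a \<Rightarrow> real) set" where
  "kahler_functions M =
     {f. \<forall>(U, \<phi>)\<in>atlas M.
           smooth_on (f \<circ> inv_into U \<phi>) (\<phi> ` U) \<and>
           (\<forall>z\<in>\<phi> ` U. \<forall>u v. lie_deriv_met M U \<phi> (ham_field M U \<phi> f) z u v = 0)}"

definition separates_points :: "'a set \<Rightarrow> ('a \<Rightarrow> real) set \<Rightarrow> bool" where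
  "separates_points S K \<longleftrightarrow> (\<forall>p\<in>S. \<forall>q\<in>S. (\<forall>f\<in>K. f p = f q) \<longrightarrow> p = q)"


section \<open>Dually flat manifolds of dimension one\<close>

text \<open>A one-dimensional manifold with a Riemannian metric \<open>h\<close> and a connection \<open>\<nabla>\<close> that has a global
  affine coordinate \<open>x\<close>; \<open>\<nabla>\<close> is recorded by \<open>x\<close>, and \<open>h\<close> by the function \<open>h(\<partial>\<^sub>x, \<partial>\<^sub>x)\<close>. In dimension
  one every connection has zero curvature and torsion, so the dual connection \<open>\<nabla>\<^sup>*\<close>
  (\<open>\<nabla>\<^sup>*\<^bsub>\<partial>\<^esub> \<partial> = (h'/h) \<partial>\<close> in the coordinate \<open>x\<close>) is flat without further assumption.\<close>

record 'm dually_flat =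
  dpts :: "'m set"
  coord :: "'m \<Rightarrow> real"
  hmet :: "'m \<Rightarrow> real"

locale dually_flat_manifold =
  fixes M :: "'m dually_flat"
  assumes nonempty: "dpts M \<noteq> {}"
    and inj_coord: "inj_on (coord M) (dpts M)"
    and open_coord: "open (coord M ` dpts M)"
    and connected_coord: "connected (coord M ` dpts M)"
    and hmet_smooth: "smooth_on (hmet M \<circ> inv_into (dpts M) (coord M)) (coord M ` dpts M)"
    and hmet_pos: "p \<in> dpts M \<Longrightarrow> hmet M p > 0"

definition coord_rep :: "'m dually_flat \<Rightarrow> 'k dually_flat \<Rightarrow> ('m \<Rightarrow> 'k) \<Rightarrow> real \<Rightarrow> real" where
  "coord_rep M N f = coord N \<circ> f \<circ> inv_into (dpts M) (coord M)"

definition dually_flat_iso :: "'m dually_flat \<Rightarrow> 'k dually_flat \<Rightarrow> ('m \<Rightarrow> 'k) \<Rightarrow> bool" where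
  "dually_flat_iso M N f \<longleftrightarrow>
     bij_betw f (dpts M) (dpts N) \<and>
     smooth_on (coord_rep M N f) (coord M ` dpts M) \<and>
     smooth_on (coord_rep N M (inv_into (dpts M) f)) (coord N ` dpts N) \<and>
     (\<forall>t\<in>coord M ` dpts M. \<exists>a b. \<forall>\<^sub>F s in nhds t. coord_rep M N f s = a * s + b) \<and>
     (\<forall>p\<in>dpts M. hmet N (f p) * (deriv (coord_rep M N f) (coord M p))\<^sup>2 = hmet M p)"

definition dually_flat_isomorphic :: "'m dually_flat \<Rightarrow> 'k dually_flat \<Rightarrow> bool" where
  "dually_flat_isomorphic M N \<longleftrightarrow>
     dually_flat_manifold M \<and> dually_flat_manifold N \<and> (\<exists>f. dually_flat_iso M N f)"

definition model :: "real \<Rightarrow> real dually_flat" where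
  "model c = \<lparr>dpts = UNIV, coord = (\<lambda>\<theta>. \<theta>), hmet = (\<lambda>\<theta>. 1 / (c * (cosh \<theta>)\<^sup>2))\<rparr>"

subsection \<open>Dombrowski's construction\<close>

text \<open>The pair \<open>(p, a)\<close> is the tangent vector \<open>a \<partial>\<^sub>x\<close> at \<open>p\<close>. On the complex numbers, the scalar
  product \<open>u \<bullet> v\<close> is the one with unit matrix in the coordinates \<open>(q, r) = (Re z, Im z)\<close>.\<close>

definition tcoord :: "'m dually_flat \<Rightarrow> 'm \<times> real \<Rightarrow> complex" where
  "tcoord M = (\<lambda>(p, a). Complex (coord M p) a)"

definition tangent_bundle :: "'m dually_flat \<Rightarrow> ('m \<times> real) hermitian" where
  "tangent_bundle M =
     \<lparr>tops = pullback_topology (dpts M \<times> UNIV) (tcoord M) euclidean,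
      atlas = {(dpts M \<times> UNIV, tcoord M)},
      met = (\<lambda>\<phi> x u v. hmet M (fst x) * (u \<bullet> v))\<rparr>"

subsection \<open>Parallel lattices\<close>

text \<open>A vector field \<open>X p \<partial>\<^sub>x\<close> is given by its coefficient function \<open>X\<close>. It is parallel iff the
  derivative of \<open>X\<close> with respect to the affine coordinate vanishes. In dimension one a frame is a
  single nowhere vanishing vector field.\<close>

definition parallel_frame :: "'m dually_flat \<Rightarrow> ('m \<Rightarrow> real) \<Rightarrow> bool" where
  "parallel_frame M X \<longleftrightarrow>
     (\<forall>t\<in>coord M ` dpts M. (X \<circ> inv_into (dpts M) (coord M) has_real_derivative 0) (at t)) \<and>
     (\<forall>p\<in>dpts M. X p \<noteq> 0)"

text \<open>The points of the quotient of the tangent bundle by \<open>\<Gamma>(L)\<close>, where \<open>L\<close> is the lattice generated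
  by \<open>X\<close>, are the \<open>\<Gamma>(L)\<close>-orbits.\<close>

definition lattice_proj :: "('m \<Rightarrow> real) \<Rightarrow> 'm \<times> real \<Rightarrow> ('m \<times> real) set" where
  "lattice_proj X = (\<lambda>(p, a). {(p, a + of_int k * X p) |k :: int. True})"

text \<open>The Kaehler structure is the one for which the projection is a local holomorphic isometry:
  charts are composed of the coordinate \<open>z\<close> and local inverses of the projection. Since \<open>\<Gamma>(L)\<close> acts by
  translations \<open>z \<mapsto> z + b\<close>, and isometrically, the metric may be computed at any representative.\<close>

definition lattice_quotient :: "'m dually_flat \<Rightarrow> ('m \<Rightarrow> real) \<Rightarrow> ('m \<times> real) set hermitian" where
  "lattice_quotient M X =
     \<lparr>tops = quotient_topology (tops (tangent_bundle M)) (lattice_proj X),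
      atlas = {(lattice_proj X ` U, tcoord M \<circ> inv_into U (lattice_proj X)) |U.
                 openin (tops (tangent_bundle M)) U \<and> inj_on (lattice_proj X) U},
      met = (\<lambda>\<phi> y u v. met (tangent_bundle M) (tcoord M) (SOME x. x \<in> y) u v)\<rparr>"

definition lattice_action :: "('m \<Rightarrow> real) \<Rightarrow> real \<Rightarrow> ('m \<times> real) set \<Rightarrow> ('m \<times> real) set" where
  "lattice_action X t y = (\<lambda>(p, a). (p, a + t * X p)) ` y"

subsection \<open>Torifications\<close>

text \<open>An action of \<open>\<real>/\<int>\<close> is written as an action of \<open>\<real>\<close> for which \<open>1\<close> acts as the identity.\<close>

locale torus_action = kahler_manifold N for N :: "'a hermitian" +
  fixes \<Phi> :: "real \<Rightarrow> 'a \<Rightarrow> 'a"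
  assumes act_0: "p \<in> pts N \<Longrightarrow> \<Phi> 0 p = p"
    and act_1: "p \<in> pts N \<Longrightarrow> \<Phi> 1 p = p"
    and act_add: "p \<in> pts N \<Longrightarrow> \<Phi> (s + t) p = \<Phi> s (\<Phi> t p)"
    and act_continuous:
      "continuous_map (prod_topology euclideanreal (tops N)) (tops N) (\<lambda>(t, p). \<Phi> t p)"
    and act_smooth: "\<lbrakk>(U, \<phi>) \<in> atlas N; (V, \<psi>) \<in> atlas N\<rbrakk> \<Longrightarrow>
      smooth_on (\<lambda>(t, z). loc_map U \<phi> \<psi> (\<Phi> t) z) {(t, \<phi> p) |t p. p \<in> U \<and> \<Phi> t p \<in> V}"
    and act_holomorphic: "holomorphic_map N N (\<Phi> t)"
    and act_isometric: "isometric_map N N (\<Phi> t)"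
    and act_effective: "(\<And>p. p \<in> pts N \<Longrightarrow> \<Phi> t p = p) \<Longrightarrow> t \<in> \<int>"

definition free_points :: "'a hermitian \<Rightarrow> (real \<Rightarrow> 'a \<Rightarrow> 'a) \<Rightarrow> 'a set" where
  "free_points N \<Phi> = {p \<in> pts N. \<forall>t. \<Phi> t p = p \<longrightarrow> t \<in> \<int>}"

definition torification ::
  "'m dually_flat \<Rightarrow> 'a hermitian \<Rightarrow> (real \<Rightarrow> 'a \<Rightarrow> 'a) \<Rightarrow> bool" where
  "torification M N \<Phi> \<longleftrightarrow>
     dually_flat_manifold M \<and> connected_space (tops N) \<and> torus_action N \<Phi> \<and>
     (\<exists>X G. parallel_frame M X \<and>
        kahler_iso (lattice_quotient M X) (open_submanifold N (free_points N \<Phi>)) G \<and>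
        (\<forall>t. \<forall>y\<in>pts (lattice_quotient M X). G (lattice_action X t y) = \<Phi> t (G y)))"

definition regular_torification ::
  "'m dually_flat \<Rightarrow> 'a hermitian \<Rightarrow> (real \<Rightarrow> 'a \<Rightarrow> 'a) \<Rightarrow> bool" where
  "regular_torification M N \<Phi> \<longleftrightarrow>
     torification M N \<Phi> \<and> simply_connected_space (tops N) \<and> complete_manifold N \<and>
     real_analytic_metric N"


section \<open>The complex projective line\<close>

definition proj_point :: "complex \<times> complex \<Rightarrow> (complex \<times> complex) set" where
  "proj_point = (\<lambda>(z0, z1). {(c * z0, c * z1) |c. c \<noteq> 0})"

definition proj_coord0 :: "(complex \<times> complex) set \<Rightarrow> complex" where
  "proj_coord0 l = (THE w. (w, 1) \<in> l)"

definition proj_coord1 :: "(complex \<times> complex) set \<Rightarrow> complex" where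
  "proj_coord1 l = (THE w. (1, w) \<in> l)"

text \<open>The Fubini-Study metric \<open>4 |dw|\<^sup>2 / (c (1 + |w|\<^sup>2)\<^sup>2)\<close> is the round metric of the sphere of
  radius \<open>1 / \<surd>c\<close> in stereographic coordinates. In complex dimension one its holomorphic sectional
  curvature is its Gaussian curvature \<open>c\<close>.\<close>

definition proj_line :: "real \<Rightarrow> (complex \<times> complex) set hermitian" where
  "proj_line c =
     \<lparr>tops = quotient_topology (top_of_set (UNIV - {(0, 0)})) proj_point,
      atlas = {({proj_point (z0, z1) |z0 z1. z1 \<noteq> 0}, proj_coord0),
               ({proj_point (z0, z1) |z0 z1. z0 \<noteq> 0}, proj_coord1)},
      met = (\<lambda>\<phi> l u v. 4 / (c * (1 + (cmod (\<phi> l))\<^sup>2)\<^sup>2) * (u \<bullet> v))\<rparr>"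

definition proj_action :: "real \<Rightarrow> (complex \<times> complex) set \<Rightarrow> (complex \<times> complex) set" where
  "proj_action t l = (\<lambda>(z0, z1). (exp (2 * \<i> * of_real pi * of_real t) * z0, z1)) ` l"

lemma proj_coord_proj_point:
  shows "z1 \<noteq> 0 \<Longrightarrow> proj_coord0 (proj_point (z0, z1)) = z0 / z1"
    and "z0 \<noteq> 0 \<Longrightarrow> proj_coord1 (proj_point (z0, z1)) = z1 / z0"
  unfolding proj_coord0_def proj_coord1_def proj_point_def
  by (rule the_equality; force simp: field_simps intro: exI[of _ "inverse z1"])
     (rule the_equality; force simp: field_simps intro: exI[of _ "inverse z0"])

lemma proj_action_proj_point:
  "proj_action t (proj_point (z0, z1)) = proj_point (exp (2 * \<i> * of_real pi * of_real t) * z0, z1)"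
  unfolding proj_action_def proj_point_def image_def by (force simp: mult.left_commute)


section \<open>Exponential families\<close>

definition log_partition :: "'x set \<Rightarrow> ('x \<Rightarrow> real) \<Rightarrow> ('x \<Rightarrow> real) \<Rightarrow> real \<Rightarrow> real" where
  "log_partition \<Omega> C F \<theta> = ln (\<Sum>x\<in>\<Omega>. exp (C x + \<theta> * F x))"

text \<open>Functions on \<open>\<Omega>\<close> are extensional functions, so that equality is equality on \<open>\<Omega>\<close>.\<close>

definition exp_pdf :: "'x set \<Rightarrow> ('x \<Rightarrow> real) \<Rightarrow> ('x \<Rightarrow> real) \<Rightarrow> real \<Rightarrow> 'x \<Rightarrow> real" where
  "exp_pdf \<Omega> C F \<theta> = (\<lambda>x\<in>\<Omega>. exp (C x + \<theta> * F x - log_partition \<Omega> C F \<theta>))"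

definition exp_family :: "'x set \<Rightarrow> ('x \<Rightarrow> real) \<Rightarrow> ('x \<Rightarrow> real) \<Rightarrow> ('x \<Rightarrow> real) set" where
  "exp_family \<Omega> C F = range (exp_pdf \<Omega> C F)"

definition exp_family_equiv ::
  "'x set \<Rightarrow> ('x \<Rightarrow> real) \<Rightarrow> ('x \<Rightarrow> real) \<Rightarrow> ('x \<Rightarrow> real) \<Rightarrow> ('x \<Rightarrow> real) \<Rightarrow> bool" where
  "exp_family_equiv \<Omega> C F C' F' \<longleftrightarrow> exp_family \<Omega> C F = exp_family \<Omega> C' F'"

text \<open>The metric is the Fisher metric \<open>h(\<partial>\<^sub>\<theta>, \<partial>\<^sub>\<theta>) = \<psi>''(\<theta>)\<close>, and \<open>\<theta>\<close> is the affine coordinate.\<close>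

definition exp_manifold ::
  "'x set \<Rightarrow> ('x \<Rightarrow> real) \<Rightarrow> ('x \<Rightarrow> real) \<Rightarrow> ('x \<Rightarrow> real) dually_flat" where
  "exp_manifold \<Omega> C F =
     \<lparr>dpts = exp_family \<Omega> C F,
      coord = inv (exp_pdf \<Omega> C F),
      hmet = (\<lambda>P. deriv (deriv (log_partition \<Omega> C F)) (inv (exp_pdf \<Omega> C F) P))\<rparr>"

subsection \<open>Reduced family\<close>

definition red_dim :: "'x set \<Rightarrow> ('x \<Rightarrow> real) \<Rightarrow> nat" where
  "red_dim \<Omega> F = card (F ` \<Omega>) - 1"

definition red_F :: "'x set \<Rightarrow> ('x \<Rightarrow> real) \<Rightarrow> nat \<Rightarrow> real" where
  "red_F \<Omega> F k = sorted_list_of_set (F ` \<Omega>) ! k"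

definition red_C :: "'x set \<Rightarrow> ('x \<Rightarrow> real) \<Rightarrow> ('x \<Rightarrow> real) \<Rightarrow> nat \<Rightarrow> real" where
  "red_C \<Omega> C F k = ln (\<Sum>x\<in>{x \<in> \<Omega>. F x = red_F \<Omega> F k}. exp (C x))"

subsection \<open>Binomial family\<close>

definition binom_C :: "nat \<Rightarrow> nat \<Rightarrow> real" where
  "binom_C p k = ln (real (p choose k))"

lemma exp_family_binomial:
  "exp_family {0..p} (binom_C p) real =
     {(\<lambda>k\<in>{0..p}. real (p choose k) * q ^ k * (1 - q) ^ (p - k)) |q. 0 < q \<and> q < 1}"
    (is "_ = ?B")
proof -
  have choose: "exp (binom_C p k) = real (p choose k)" if "k \<le> p" for k
    using that by (simp add: binom_C_def)
  have Z: "exp (log_partition {0..p} (binom_C p) real \<theta>) = (1 + exp \<theta>) ^ p" for \<theta>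
  proof -
    have "(\<Sum>k\<in>{0..p}. exp (binom_C p k + \<theta> * real k)) = (\<Sum>k\<le>p. real (p choose k) * exp \<theta> ^ k)"
      by (intro sum.cong) (auto simp: exp_add choose exp_of_nat2_mult)
    also have "\<dots> = (exp \<theta> + 1) ^ p"
      by (subst binomial_ring) simp
    finally show ?thesis
      by (simp add: log_partition_def add.commute add_pos_pos)
  qed
  have pdf: "exp_pdf {0..p} (binom_C p) real \<theta> =
      (\<lambda>k\<in>{0..p}. real (p choose k) * (exp \<theta> / (1 + exp \<theta>)) ^ k
          * (1 - exp \<theta> / (1 + exp \<theta>)) ^ (p - k))" for \<theta>
  proof (unfold exp_pdf_def, rule restrict_ext)
    fix k
    assume "k \<in> {0..p}"
    then have k: "k \<le> p" by simp
    have pos: "1 + exp \<theta> > (0::real)" by (simp add: add_pos_pos)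
    have "1 - exp \<theta> / (1 + exp \<theta>) = 1 / (1 + exp \<theta>)"
      using pos by (simp add: field_simps)
    moreover have "(1 + exp \<theta>) ^ k * (1 + exp \<theta>) ^ (p - k) = (1 + exp \<theta>) ^ p"
      using k by (simp flip: power_add)
    ultimately show "exp (binom_C p k + \<theta> * real k - log_partition {0..p} (binom_C p) real \<theta>) =
        real (p choose k) * (exp \<theta> / (1 + exp \<theta>)) ^ k * (1 - exp \<theta> / (1 + exp \<theta>)) ^ (p - k)"
      using k by (simp add: exp_diff exp_add Z choose exp_of_nat2_mult power_divide)
  qed
  show ?thesis
  proof (intro equalityI subsetI)
    fix P
    assume "P \<in> exp_family {0..p} (binom_C p) real"
    then obtain \<theta> where "P = exp_pdf {0..p} (binom_C p) real \<theta>"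
      by (auto simp: exp_family_def)
    moreover have "0 < exp \<theta> / (1 + exp \<theta>)" "exp \<theta> / (1 + exp \<theta>) < 1"
      by (simp_all add: add_pos_pos)
    ultimately show "P \<in> ?B"
      unfolding pdf by blast
  next
    fix P
    assume "P \<in> ?B"
    then obtain q where q: "0 < q" "q < 1"
      and P: "P = (\<lambda>k\<in>{0..p}. real (p choose k) * q ^ k * (1 - q) ^ (p - k))"
      by blast
    have "exp (ln (q / (1 - q))) = q / (1 - q)"
      using q by simp
    then have "exp (ln (q / (1 - q))) / (1 + exp (ln (q / (1 - q)))) = q"
      using q by (simp add: field_simps)
    then have "P = exp_pdf {0..p} (binom_C p) real (ln (q / (1 - q)))"
      unfolding pdf P by simp
    then show "P \<in> exp_family {0..p} (binom_C p) real"
      by (auto simp: exp_family_def)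
  qed
qed

end

theory Submission
  imports Defs "HOL-Complex_Analysis.Conformal_Mappings"
begin

text \<open>Let \<open>\<psi>\<close> be the log-partition function in the affine coordinate \<open>\<theta>\<close>, so that \<open>h = \<psi>''\<close> is the Fisher metric,
  and let \<open>r = 1 / \<surd>h\<close>. The tangent bundle of the family is the complex plane with the metric
  \<open>h (Re z) |dz|\<^sup>2\<close>, and the torification \<open>N\<close> contains its quotient by a lattice of imaginary translations as
  the set of free points of the action.

  The imaginary translations are one Killing field of this metric. They preserve the fibres \<open>Re z = const\<close>,
  and two points of one fibre with different images in \<open>N\<close> are separated by a Kaehler function of \<open>N\<close>.
  Its Hamiltonian field \<open>Y\<close> is a second Killing field, and it is an entire function of \<open>z\<close>. The Killing
  equation gives \<open>Re Y (x + \<i> y) = k (y) r (x)\<close> with \<open>k \<noteq> 0\<close>, and harmonicity of \<open>Re Y\<close> gives \<open>r'' = \<mu> r\<close>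
  (\<open>killing_field_imp_ode\<close>, \<open>torification_separating_imp_ode\<close>); this expresses that the curvature is constant.

  The derivative \<open>\<psi>'\<close> is the mean of \<open>F\<close>, so it is bounded. This excludes the flat and the
  hyperbolic solutions and leaves \<open>r = P exp (a x) + Q exp (- a x)\<close> with \<open>a, P, Q > 0\<close>
  (\<open>positive_ode_solution\<close>). Integrating twice, \<open>exp \<psi>\<close> is a constant times \<open>exp (\<beta> x) (r x) powr \<kappa>\<close>. But
  \<open>exp \<psi>\<close> is a finite sum of exponentials with positive coefficients. Comparing coefficients gives the
  recurrence of the binomial coefficients, which has solutions of finite support only if \<open>\<kappa>\<close> is a natural
  number; then \<open>\<kappa> = p\<close>, the values of \<open>F\<close> are equally spaced, and the weights are binomial
  (\<open>exp_sum_binomial\<close>, \<open>binomial_if_constant_curvature\<close>). This is the first claim. It also shows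
  \<open>h = p a\<^sup>2 / (cosh (a \<theta> - s))\<^sup>2\<close> for some \<open>s\<close>, and \<open>\<theta> \<mapsto> a \<theta> - s\<close> is the isomorphism with the model.

  For such a metric, \<open>z \<mapsto> [exp (a z - s), 1]\<close> is a local isometry to the projective line with the
  Fubini-Study metric of curvature \<open>1 / p\<close> and turns translations into rotations
  (\<open>regular_torification_proj_line\<close>). That the projective line is a complete and simply connected
  Kaehler manifold is seen on the unit sphere of \<open>\<complex> \<times> \<real>\<close>: stereographic projection is a homeomorphism
  that is isometric up to a constant factor, so lengths of curves can be compared with chords.\<close>

section \<open>Calculus of smooth functions\<close>

lemma Ck_on_cong:
  assumes "open S" "\<And>x. x \<in> S \<Longrightarrow> f x = g x" "Ck_on k f S"
  shows "Ck_on k g S"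
  using assms(2,3)
proof (induction k arbitrary: f g)
  case 0
  then show ?case
    by (simp cong: continuous_on_cong)
next
  case (Suc k)
  have der: "(g has_derivative frechet_derivative f (at x)) (at x)" if "x \<in> S" for x
  proof (rule has_derivative_transform_within_open[OF _ \<open>open S\<close> that])
    show "(f has_derivative frechet_derivative f (at x)) (at x)"
      using Suc.prems(2) that by (simp flip: frechet_derivative_works)
  qed (rule Suc.prems(1))
  show ?case
    unfolding Ck_on.simps
  proof (intro conjI ballI allI)
    show "g differentiable at x" if "x \<in> S" for x
      using der[OF that] by (auto simp: differentiable_def)
    fix v
    have "frechet_derivative f (at x) v = frechet_derivative g (at x) v" if "x \<in> S" for x
      using frechet_derivative_at[OF der[OF that]] by simp
    moreover have "Ck_on k (\<lambda>x. frechet_derivative f (at x) v) S"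
      using Suc.prems by simp
    ultimately show "Ck_on k (\<lambda>x. frechet_derivative g (at x) v) S"
      by (rule Suc.IH)
  qed
qed

text \<open>\<open>Ck_on\<close> refers to \<^const>\<open>frechet_derivative\<close>. On an open set any formula \<open>D\<close> for the derivative may
  be used instead, so the closure properties below follow from the usual rules of differentiation by
  induction on \<open>k\<close>.\<close>

lemma Ck_on_SucI:
  assumes "open S" "\<And>x. x \<in> S \<Longrightarrow> (f has_derivative D x) (at x)"
    and "\<And>v. Ck_on k (\<lambda>x. D x v) S"
  shows "Ck_on (Suc k) f S"
  unfolding Ck_on.simps
proof (intro conjI ballI allI)
  show "f differentiable at x" if "x \<in> S" for x
    using assms(2)[OF that] by (auto simp: differentiable_def)
  show "Ck_on k (\<lambda>x. frechet_derivative f (at x) v) S" for v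
    by (rule Ck_on_cong[OF \<open>open S\<close> _ assms(3)[of v]]) (simp flip: frechet_derivative_at[OF assms(2)])
qed

lemma Ck_on_Suc_has_derivative:
  "Ck_on (Suc k) f S \<Longrightarrow> x \<in> S \<Longrightarrow> (f has_derivative frechet_derivative f (at x)) (at x)"
  by (simp flip: frechet_derivative_works)

lemma Ck_on_Suc_differentiable: "Ck_on (Suc k) f S \<Longrightarrow> x \<in> S \<Longrightarrow> f differentiable (at x)"
  by simp

lemma Ck_on_Suc_frechet_derivative: "Ck_on (Suc k) f S \<Longrightarrow> Ck_on k (\<lambda>x. frechet_derivative f (at x) v) S"
  by simp

lemma Ck_on_Suc_imp: "Ck_on (Suc k) f S \<Longrightarrow> Ck_on k f S"
proof (induction k arbitrary: f)
  case 0
  then have "f differentiable_on S"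
    by (simp add: differentiable_at_imp_differentiable_on)
  then show ?case
    by (simp add: differentiable_imp_continuous_on)
next
  case (Suc k)
  have "Ck_on k (\<lambda>x. frechet_derivative f (at x) v) S" for v
    using Suc.prems by (intro Suc.IH) (simp only: Ck_on.simps(2)[of "Suc k"])
  moreover have "\<forall>x\<in>S. f differentiable at x"
    using Suc.prems unfolding Ck_on.simps(2)[of "Suc k"] by blast
  ultimately show ?case by simp
qed

lemma Ck_on_const: "open S \<Longrightarrow> Ck_on k (\<lambda>_. c) S"
proof (induction k arbitrary: c)
  case (Suc k)
  show ?case
    by (rule Ck_on_SucI[where D="\<lambda>_ _. 0"]) (use Suc in \<open>auto intro!: derivative_eq_intros\<close>)
qed simp

lemma Ck_on_bounded_linear:
  assumes "bounded_linear L" "open S"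
  shows "Ck_on k L S"
proof (cases k)
  case 0
  then show ?thesis
    using assms by (simp add: linear_continuous_on)
next
  case (Suc l)
  show ?thesis unfolding Suc
    by (rule Ck_on_SucI[where D="\<lambda>_. L"])
       (use assms in \<open>auto intro: bounded_linear_imp_has_derivative Ck_on_const\<close>)
qed

lemma Ck_on_affine_precompose:
  assumes "bounded_linear L" "open S" "open T" "Ck_on k f S" "\<And>x. x \<in> T \<Longrightarrow> L x + b \<in> S"
  shows "Ck_on k (\<lambda>x. f (L x + b)) T"
  using assms(4)
proof (induction k arbitrary: f)
  case 0
  then have "continuous_on S f" by simp
  moreover have "continuous_on T (\<lambda>x. L x + b)"
    by (intro continuous_on_add linear_continuous_on assms(1) continuous_on_const)
  ultimately have "continuous_on T (\<lambda>x. f (L x + b))"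
    by (rule continuous_on_compose2) (use assms(5) in auto)
  then show ?case by simp
next
  case (Suc k)
  show ?case
  proof (rule Ck_on_SucI[OF \<open>open T\<close>, where D="\<lambda>x v. frechet_derivative f (at (L x + b)) (L v)"])
    fix x assume "x \<in> T"
    have "((\<lambda>x. L x + b) has_derivative L) (at x)"
      using assms(1) by (auto intro!: derivative_eq_intros bounded_linear_imp_has_derivative)
    from diff_chain_at[OF this Ck_on_Suc_has_derivative[OF Suc.prems assms(5)[OF \<open>x \<in> T\<close>]]]
    show "((\<lambda>x. f (L x + b)) has_derivative (\<lambda>v. frechet_derivative f (at (L x + b)) (L v))) (at x)"
      by (simp add: o_def)
  next
    show "Ck_on k (\<lambda>x. frechet_derivative f (at (L x + b)) (L v)) T" for v
      using Suc.prems by (intro Suc.IH) simp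
  qed
qed

lemma Ck_on_add:
  assumes "open S" "Ck_on k f S" "Ck_on k g S"
  shows "Ck_on k (\<lambda>x. f x + g x) S"
  using assms(2,3)
proof (induction k arbitrary: f g)
  case 0
  then show ?case by (simp add: continuous_on_add)
next
  case (Suc k)
  show ?case
  proof (rule Ck_on_SucI[OF \<open>open S\<close>])
    show "((\<lambda>x. f x + g x) has_derivative
        (\<lambda>v. frechet_derivative f (at x) v + frechet_derivative g (at x) v)) (at x)" if "x \<in> S" for x
      by (intro has_derivative_add Ck_on_Suc_has_derivative[of k, OF _ that] Suc.prems)
    show "Ck_on k (\<lambda>x. frechet_derivative f (at x) v + frechet_derivative g (at x) v) S" for v
      using Suc.prems by (intro Suc.IH) simp_all
  qed
qed

lemma Ck_on_mult:
  fixes f g :: "'a::real_normed_vector \<Rightarrow> 'b::real_normed_algebra"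
  assumes "open S" "Ck_on k f S" "Ck_on k g S"
  shows "Ck_on k (\<lambda>x. f x * g x) S"
  using assms(2,3)
proof (induction k arbitrary: f g)
  case 0
  then show ?case by (simp add: continuous_on_mult)
next
  case (Suc k)
  have fg: "Ck_on k f S" "Ck_on k g S"
    using Suc.prems by (auto dest: Ck_on_Suc_imp simp del: Ck_on.simps)
  show ?case
  proof (rule Ck_on_SucI[OF \<open>open S\<close>])
    show "((\<lambda>x. f x * g x) has_derivative
        (\<lambda>v. f x * frechet_derivative g (at x) v + frechet_derivative f (at x) v * g x)) (at x)"
      if "x \<in> S" for x
      by (intro has_derivative_mult Ck_on_Suc_has_derivative[of k, OF _ that] Suc.prems)
    show "Ck_on k (\<lambda>x. f x * frechet_derivative g (at x) v + frechet_derivative f (at x) v * g x) S" for v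
      using Suc.prems fg by (intro Ck_on_add Suc.IH \<open>open S\<close>) simp_all
  qed
qed

lemma Ck_on_inverse:
  fixes f :: "'a::real_normed_vector \<Rightarrow> 'b::real_normed_field"
  assumes "open S" "Ck_on k f S" "\<And>x. x \<in> S \<Longrightarrow> f x \<noteq> 0"
  shows "Ck_on k (\<lambda>x. inverse (f x)) S"
  using assms(2)
proof (induction k)
  case 0
  then show ?case using assms(3) by (simp add: continuous_on_inverse)
next
  case (Suc k)
  have inv: "Ck_on k (\<lambda>x. inverse (f x)) S"
    by (rule Suc.IH[OF Ck_on_Suc_imp[OF Suc.prems]])
  show ?case
  proof (rule Ck_on_SucI[OF \<open>open S\<close>])
    show "((\<lambda>x. inverse (f x)) has_derivative
        (\<lambda>v. (-1) * (inverse (f x) * frechet_derivative f (at x) v * inverse (f x)))) (at x)" if "x \<in> S" for x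
      using Deriv.has_derivative_inverse[OF assms(3)[OF that] Ck_on_Suc_has_derivative[OF Suc.prems that]]
      unfolding mult_minus1 .
    show "Ck_on k (\<lambda>x. (-1) * (inverse (f x) * frechet_derivative f (at x) v * inverse (f x))) S" for v
    proof -
      have "Ck_on k (\<lambda>x. frechet_derivative f (at x) v) S"
        using Suc.prems by simp
      then show ?thesis
        by (intro Ck_on_mult[OF \<open>open S\<close>] Ck_on_const[OF \<open>open S\<close>] inv)
    qed
  qed
qed

lemma Ck_on_exp:
  fixes f :: "'a::real_normed_vector \<Rightarrow> 'b::{real_normed_field,banach}"
  assumes "open S" "Ck_on k f S"
  shows "Ck_on k (\<lambda>x. exp (f x)) S"
  using assms(2)
proof (induction k)
  case 0
  then show ?case by (simp add: continuous_on_exp)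
next
  case (Suc k)
  have e: "Ck_on k (\<lambda>x. exp (f x)) S"
    by (rule Suc.IH[OF Ck_on_Suc_imp[OF Suc.prems]])
  show ?case
  proof (rule Ck_on_SucI[OF \<open>open S\<close>])
    fix x assume x: "x \<in> S"
    have "(exp has_derivative (*) (exp (f x))) (at (f x))"
      using DERIV_exp[of "f x"] by (simp add: has_field_derivative_def)
    from diff_chain_at[OF Ck_on_Suc_has_derivative[OF Suc.prems x] this]
    show "((\<lambda>x. exp (f x)) has_derivative
        (\<lambda>v. exp (f x) * frechet_derivative f (at x) v)) (at x)"
      by (simp add: o_def)
  next
    show "Ck_on k (\<lambda>x. exp (f x) * frechet_derivative f (at x) v) S" for v
    proof -
      have "Ck_on k (\<lambda>x. frechet_derivative f (at x) v) S"
        using Suc.prems by simp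
      then show ?thesis
        by (intro Ck_on_mult[OF \<open>open S\<close>] e)
    qed
  qed
qed

section \<open>Real analyticity of the Fubini-Study metric\<close>

text \<open>The number \<open>B\<close> bounds the norm \<open>\<Sum> \<bar>a (m, n)\<bar> r ^ (m + n)\<close>. With this norm the power series that
  converge absolutely for \<open>\<bar>x\<bar>, \<bar>y\<bar> \<le> r\<close> form a Banach algebra, so that a reciprocal is obtained from a
  geometric series, without a formula for its coefficients.\<close>

definition has_double_series :: "real \<Rightarrow> real \<Rightarrow> (real \<Rightarrow> real \<Rightarrow> real) \<Rightarrow> bool" where
  "has_double_series r B f \<longleftrightarrow>
     (\<exists>a :: nat \<times> nat \<Rightarrow> real.
        (\<lambda>(m, n). \<bar>a (m, n)\<bar> * r ^ (m + n)) summable_on UNIV \<and>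
        (\<Sum>\<^sub>\<infinity>(m, n). \<bar>a (m, n)\<bar> * r ^ (m + n)) \<le> B \<and>
        (\<forall>x y. \<bar>x\<bar> \<le> r \<longrightarrow> \<bar>y\<bar> \<le> r \<longrightarrow> ((\<lambda>(m, n). a (m, n) * x ^ m * y ^ n) has_sum f x y) UNIV))"

lemma has_double_series_cong:
  assumes "has_double_series r B f" "\<And>x y. \<bar>x\<bar> \<le> r \<Longrightarrow> \<bar>y\<bar> \<le> r \<Longrightarrow> f x y = g x y"
  shows "has_double_series r B g"
  using assms unfolding has_double_series_def by simp

lemma has_double_series_const: "has_double_series r \<bar>c\<bar> (\<lambda>_ _. c)"
proof -
  define a :: "nat \<times> nat \<Rightarrow> real" where "a = (\<lambda>mn. if mn = (0, 0) then c else 0)"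
  have 1: "((\<lambda>(m, n). \<bar>a (m, n)\<bar> * r ^ (m + n)) has_sum \<bar>c\<bar>) UNIV"
    by (rule has_sum_finite_neutralI[of "{(0, 0)}"]) (auto simp: a_def split: if_splits)
  have 2: "((\<lambda>(m, n). a (m, n) * x ^ m * y ^ n) has_sum c) UNIV" for x y :: real
    by (rule has_sum_finite_neutralI[of "{(0, 0)}"]) (auto simp: a_def split: if_splits)
  show ?thesis
    unfolding has_double_series_def
    using 1 2 by (intro exI[of _ a]) (auto simp: summable_on_def infsumI)
qed

lemma has_double_series_scale:
  assumes "has_double_series r B f"
  shows "has_double_series r (\<bar>c\<bar> * B) (\<lambda>x y. c * f x y)"
proof -
  obtain a where a: "(\<lambda>(m, n). \<bar>a (m, n)\<bar> * r ^ (m + n)) summable_on UNIV"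
    "(\<Sum>\<^sub>\<infinity>(m, n). \<bar>a (m, n)\<bar> * r ^ (m + n)) \<le> B"
    "\<And>x y. \<bar>x\<bar> \<le> r \<Longrightarrow> \<bar>y\<bar> \<le> r \<Longrightarrow> ((\<lambda>(m, n). a (m, n) * x ^ m * y ^ n) has_sum f x y) UNIV"
    using assms unfolding has_double_series_def by blast
  have 1: "((\<lambda>(m, n). \<bar>c * a (m, n)\<bar> * r ^ (m + n)) has_sum
      (\<bar>c\<bar> * (\<Sum>\<^sub>\<infinity>(m, n). \<bar>a (m, n)\<bar> * r ^ (m + n)))) UNIV"
    using has_sum_cmult_right[OF has_sum_infsum[OF a(1)], of "\<bar>c\<bar>"]
    by (simp add: case_prod_unfold abs_mult mult.assoc)
  have 2: "((\<lambda>(m, n). (c * a (m, n)) * x ^ m * y ^ n) has_sum (c * f x y)) UNIV"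
    if "\<bar>x\<bar> \<le> r" "\<bar>y\<bar> \<le> r" for x y :: real
    using has_sum_cmult_right[OF a(3)[OF that], of c] by (simp add: case_prod_unfold mult.assoc)
  show ?thesis
    unfolding has_double_series_def
  proof (intro exI[of _ "\<lambda>mn. c * a mn"] conjI allI impI)
    show "(\<Sum>\<^sub>\<infinity>(m, n). \<bar>c * a (m, n)\<bar> * r ^ (m + n)) \<le> \<bar>c\<bar> * B"
      using infsumI[OF 1] a(2) by (simp add: mult_left_mono)
  qed (use 1 2 in \<open>auto simp: summable_on_def\<close>)
qed

lemma has_double_series_add:
  assumes "has_double_series r B f" "has_double_series r C g" "r \<ge> 0"
  shows "has_double_series r (B + C) (\<lambda>x y. f x y + g x y)"
proof -
  obtain a where a: "(\<lambda>(m, n). \<bar>a (m, n)\<bar> * r ^ (m + n)) summable_on UNIV"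
    "(\<Sum>\<^sub>\<infinity>(m, n). \<bar>a (m, n)\<bar> * r ^ (m + n)) \<le> B"
    "\<And>x y. \<bar>x\<bar> \<le> r \<Longrightarrow> \<bar>y\<bar> \<le> r \<Longrightarrow> ((\<lambda>(m, n). a (m, n) * x ^ m * y ^ n) has_sum f x y) UNIV"
    using assms(1) unfolding has_double_series_def by blast
  obtain b where b: "(\<lambda>(m, n). \<bar>b (m, n)\<bar> * r ^ (m + n)) summable_on UNIV"
    "(\<Sum>\<^sub>\<infinity>(m, n). \<bar>b (m, n)\<bar> * r ^ (m + n)) \<le> C"
    "\<And>x y. \<bar>x\<bar> \<le> r \<Longrightarrow> \<bar>y\<bar> \<le> r \<Longrightarrow> ((\<lambda>(m, n). b (m, n) * x ^ m * y ^ n) has_sum g x y) UNIV"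
    using assms(2) unfolding has_double_series_def by blast
  have sum: "(\<lambda>(m, n). \<bar>a (m, n)\<bar> * r ^ (m + n) + \<bar>b (m, n)\<bar> * r ^ (m + n)) summable_on UNIV"
    using summable_on_add[OF a(1) b(1)] by (simp add: case_prod_unfold)
  have le: "\<bar>a (m, n) + b (m, n)\<bar> * r ^ (m + n) \<le> \<bar>a (m, n)\<bar> * r ^ (m + n) + \<bar>b (m, n)\<bar> * r ^ (m + n)" for m n
    using mult_right_mono[OF abs_triangle_ineq, of "r ^ (m + n)"] \<open>r \<ge> 0\<close> by (simp add: distrib_right)
  have 1: "(\<lambda>(m, n). \<bar>a (m, n) + b (m, n)\<bar> * r ^ (m + n)) summable_on UNIV"
    by (rule summable_on_comparison_test[OF sum]) (use le \<open>r \<ge> 0\<close> in auto)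
  have "(\<Sum>\<^sub>\<infinity>(m, n). \<bar>a (m, n) + b (m, n)\<bar> * r ^ (m + n))
      \<le> (\<Sum>\<^sub>\<infinity>(m, n). \<bar>a (m, n)\<bar> * r ^ (m + n) + \<bar>b (m, n)\<bar> * r ^ (m + n))"
    by (rule infsum_mono[OF 1 sum]) (use le in auto)
  also have "\<dots> \<le> B + C"
    using infsum_add[OF a(1) b(1)] a(2) b(2) by (simp add: case_prod_unfold)
  finally have 2: "(\<Sum>\<^sub>\<infinity>(m, n). \<bar>a (m, n) + b (m, n)\<bar> * r ^ (m + n)) \<le> B + C" .
  have 3: "((\<lambda>(m, n). (a (m, n) + b (m, n)) * x ^ m * y ^ n) has_sum (f x y + g x y)) UNIV"
    if "\<bar>x\<bar> \<le> r" "\<bar>y\<bar> \<le> r" for x y :: real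
    using has_sum_add[OF a(3)[OF that] b(3)[OF that]] by (simp add: case_prod_unfold distrib_right)
  show ?thesis
    unfolding has_double_series_def
    using 1 2 3 by (intro exI[of _ "\<lambda>mn. a mn + b mn"]) auto
qed

text \<open>Together with scalar multiples and sums, this gives multiplication by polynomials.\<close>

lemma has_double_series_shift:
  assumes "has_double_series r B f" "r \<ge> 0"
  shows "has_double_series r (r ^ (i + j) * B) (\<lambda>x y. x ^ i * y ^ j * f x y)"
proof -
  obtain a where a: "(\<lambda>(m, n). \<bar>a (m, n)\<bar> * r ^ (m + n)) summable_on UNIV"
    "(\<Sum>\<^sub>\<infinity>(m, n). \<bar>a (m, n)\<bar> * r ^ (m + n)) \<le> B"
    "\<And>x y. \<bar>x\<bar> \<le> r \<Longrightarrow> \<bar>y\<bar> \<le> r \<Longrightarrow> ((\<lambda>(m, n). a (m, n) * x ^ m * y ^ n) has_sum f x y) UNIV"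
    using assms(1) unfolding has_double_series_def by blast
  define s :: "nat \<times> nat \<Rightarrow> nat \<times> nat" where "s = (\<lambda>(m, n). (m + i, n + j))"
  define b where "b = (\<lambda>(m, n). if i \<le> m \<and> j \<le> n then a (m - i, n - j) else 0)"
  have s: "inj s" by (auto simp: s_def inj_on_def)
  have out: "b mn = 0" if "mn \<notin> range s" for mn
  proof (rule ccontr)
    assume "b mn \<noteq> 0"
    then have "mn = s (fst mn - i, snd mn - j)"
      by (auto simp: b_def s_def split: if_splits prod.splits)
    with that show False by blast
  qed
  have shift: "((\<lambda>mn. b mn * g mn) has_sum t) UNIV" if "((\<lambda>mn. a mn * g (s mn)) has_sum t) UNIV"
    for g :: "nat \<times> nat \<Rightarrow> real" and t
  proof -
    have "((\<lambda>mn. b mn * g mn) \<circ> s) = (\<lambda>mn. a mn * g (s mn))"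
      by (auto simp: b_def s_def)
    with that have "((\<lambda>mn. b mn * g mn) has_sum t) (range s)"
      by (simp add: has_sum_reindex[OF s])
    then show ?thesis
      by (rule has_sum_cong_neutral[THEN iffD1, rotated -1]) (auto simp: out)
  qed
  have shift': "((\<lambda>mn. \<bar>b mn\<bar> * g mn) has_sum t) UNIV" if "((\<lambda>mn. \<bar>a mn\<bar> * g (s mn)) has_sum t) UNIV"
    for g :: "nat \<times> nat \<Rightarrow> real" and t
  proof -
    have "((\<lambda>mn. \<bar>b mn\<bar> * g mn) \<circ> s) = (\<lambda>mn. \<bar>a mn\<bar> * g (s mn))"
      by (auto simp: b_def s_def)
    with that have "((\<lambda>mn. \<bar>b mn\<bar> * g mn) has_sum t) (range s)"
      by (simp add: has_sum_reindex[OF s])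
    then show ?thesis
      by (rule has_sum_cong_neutral[THEN iffD1, rotated -1]) (auto simp: out)
  qed
  have 1: "((\<lambda>(m, n). \<bar>b (m, n)\<bar> * r ^ (m + n)) has_sum
      (r ^ (i + j) * (\<Sum>\<^sub>\<infinity>(m, n). \<bar>a (m, n)\<bar> * r ^ (m + n)))) UNIV"
  proof -
    have "((\<lambda>mn. \<bar>b mn\<bar> * r ^ (fst mn + snd mn)) has_sum
      (r ^ (i + j) * (\<Sum>\<^sub>\<infinity>(m, n). \<bar>a (m, n)\<bar> * r ^ (m + n)))) UNIV"
      by (rule shift')
         (use has_sum_cmult_right[OF has_sum_infsum[OF a(1)], of "r ^ (i + j)"] in
           \<open>simp add: s_def case_prod_unfold power_add mult_ac\<close>)
    then show ?thesis by (simp add: case_prod_unfold)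
  qed
  have 2: "((\<lambda>(m, n). b (m, n) * x ^ m * y ^ n) has_sum (x ^ i * y ^ j * f x y)) UNIV"
    if "\<bar>x\<bar> \<le> r" "\<bar>y\<bar> \<le> r" for x y :: real
  proof -
    have "((\<lambda>mn. b mn * (x ^ fst mn * y ^ snd mn)) has_sum (x ^ i * y ^ j * f x y)) UNIV"
      by (rule shift)
         (use has_sum_cmult_right[OF a(3)[OF that], of "x ^ i * y ^ j"] in
           \<open>simp add: s_def case_prod_unfold power_add mult_ac\<close>)
    then show ?thesis by (simp add: case_prod_unfold mult.assoc)
  qed
  show ?thesis
    unfolding has_double_series_def
  proof (intro exI[of _ b] conjI allI impI)
    show "(\<Sum>\<^sub>\<infinity>(m, n). \<bar>b (m, n)\<bar> * r ^ (m + n)) \<le> r ^ (i + j) * B"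
      using infsumI[OF 1] a(2) \<open>r \<ge> 0\<close> by (simp add: mult_left_mono)
  qed (use 1 2 in \<open>auto simp: summable_on_def\<close>)
qed

text \<open>The coefficients of the sum are the sums of the coefficients. Summability of the bounds \<open>B k\<close> says
  that the family of all terms, indexed by \<open>k\<close> and the exponents, is absolutely summable, which
  permits to sum over \<open>k\<close> first.\<close>

lemma has_double_series_infsum:
  fixes f :: "nat \<Rightarrow> real \<Rightarrow> real \<Rightarrow> real"
  assumes f: "\<And>k. has_double_series r (B k) (f k)" and B: "summable B" and r: "r \<ge> 0"
  shows "\<exists>C. has_double_series r C (\<lambda>x y. \<Sum>\<^sub>\<infinity>k. f k x y)"
proof -
  define P where "P k a \<longleftrightarrow> (\<lambda>(m, n). \<bar>a (m, n)\<bar> * r ^ (m + n)) summable_on UNIV \<and>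
        (\<Sum>\<^sub>\<infinity>(m, n). \<bar>a (m, n)\<bar> * r ^ (m + n)) \<le> B k \<and>
        (\<forall>x y. \<bar>x\<bar> \<le> r \<longrightarrow> \<bar>y\<bar> \<le> r \<longrightarrow> ((\<lambda>(m, n). a (m, n) * x ^ m * y ^ n) has_sum f k x y) UNIV)"
    for k and a :: "nat \<times> nat \<Rightarrow> real"
  have "\<forall>k. \<exists>a. P k a"
    using f unfolding has_double_series_def P_def by simp
  from choice[OF this] obtain a where "\<forall>k. P k (a k)" ..
  then have a: "\<And>k. (\<lambda>(m, n). \<bar>a k (m, n)\<bar> * r ^ (m + n)) summable_on UNIV"
    "\<And>k. (\<Sum>\<^sub>\<infinity>(m, n). \<bar>a k (m, n)\<bar> * r ^ (m + n)) \<le> B k"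
    "\<And>k x y. \<bar>x\<bar> \<le> r \<Longrightarrow> \<bar>y\<bar> \<le> r \<Longrightarrow> ((\<lambda>(m, n). a k (m, n) * x ^ m * y ^ n) has_sum f k x y) UNIV"
    unfolding P_def by simp_all
  define w where "w = (\<lambda>mn :: nat \<times> nat. r ^ (fst mn + snd mn))"
  have w0: "w mn \<ge> 0" for mn using r by (simp add: w_def)
  have a1: "(\<lambda>mn. \<bar>a k mn\<bar> * w mn) summable_on UNIV" and a2: "(\<Sum>\<^sub>\<infinity>mn. \<bar>a k mn\<bar> * w mn) \<le> B k" for k
    using a(1,2)[of k] unfolding w_def case_prod_unfold prod.collapse .
  have nn: "(\<Sum>\<^sub>\<infinity>mn. \<bar>a k mn\<bar> * w mn) \<ge> 0" for k
    by (rule infsum_nonneg) (simp add: w0)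
  have outer: "(\<lambda>k. \<Sum>\<^sub>\<infinity>mn. \<bar>a k mn\<bar> * w mn) summable_on UNIV"
  proof (rule norm_summable_imp_summable_on)
    show "summable (\<lambda>k. norm (\<Sum>\<^sub>\<infinity>mn. \<bar>a k mn\<bar> * w mn))"
      by (rule summable_comparison_test[OF _ B]) (use nn a2 in auto)
  qed
  have u: "(\<lambda>(k, mn). \<bar>a k mn\<bar> * w mn) summable_on UNIV \<times> UNIV"
  proof (rule summable_on_SigmaI[OF _ outer])
    show "((\<lambda>mn. case (k, mn) of (k, mn) \<Rightarrow> \<bar>a k mn\<bar> * w mn) has_sum (\<Sum>\<^sub>\<infinity>mn. \<bar>a k mn\<bar> * w mn)) UNIV" for k
      unfolding prod.case by (rule has_sum_infsum[OF a1])
  qed (simp add: w0)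
  have u': "(\<lambda>(mn, k). \<bar>a k mn\<bar> * w mn) summable_on UNIV \<times> UNIV"
    using u[THEN summable_on_swap[THEN iffD1]] by (simp only: prod.case)
  define A where "A = (\<lambda>mn. \<Sum>\<^sub>\<infinity>k. a k mn)"
  have t: "(\<lambda>(mn, k). a k mn * g mn) summable_on UNIV \<times> UNIV" if "\<And>mn. \<bar>g mn\<bar> \<le> w mn" for g
    by (rule summable_on_iff_abs_summable_on_real[THEN iffD2], rule summable_on_comparison_test[OF u'])
       (use that in \<open>auto simp: abs_mult intro!: mult_left_mono\<close>)
  have At: "((\<lambda>mn. A mn * g mn) has_sum (\<Sum>\<^sub>\<infinity>(mn, k). a k mn * g mn)) UNIV" if "\<And>mn. \<bar>g mn\<bar> \<le> w mn" for g
  proof -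
    have "((\<lambda>mn. \<Sum>\<^sub>\<infinity>k. a k mn * g mn) has_sum (\<Sum>\<^sub>\<infinity>(mn, k)\<in>UNIV \<times> UNIV. a k mn * g mn)) UNIV"
    proof (rule has_sum_SigmaD[OF has_sum_infsum[OF t[OF that]]])
      fix mn
      have "(\<lambda>k. a k mn * g mn) summable_on UNIV"
        by (rule summable_on_SigmaD1[where f="\<lambda>mn k. a k mn * g mn", OF t[OF that]]) simp
      then show "((\<lambda>k. case (mn, k) of (mn, k) \<Rightarrow> a k mn * g mn) has_sum (\<Sum>\<^sub>\<infinity>k. a k mn * g mn)) UNIV"
        by simp
    qed
    moreover have "(\<Sum>\<^sub>\<infinity>k. a k mn * g mn) = A mn * g mn" for mn
      unfolding A_def by (rule infsum_cmult_left')
    ultimately show ?thesis by simp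
  qed
  have Aw: "(\<lambda>mn. \<bar>A mn\<bar> * w mn) summable_on UNIV"
  proof -
    have "(\<lambda>mn. A mn * w mn) summable_on UNIV"
      using At[of w] w0 by (auto simp: summable_on_def)
    from summable_on_iff_abs_summable_on_real[THEN iffD1, OF this] show ?thesis
      by (simp add: abs_mult w0)
  qed
  have sum: "((\<lambda>(m, n). A (m, n) * x ^ m * y ^ n) has_sum (\<Sum>\<^sub>\<infinity>k. f k x y)) UNIV"
    if xy: "\<bar>x\<bar> \<le> r" "\<bar>y\<bar> \<le> r" for x y
  proof -
    define g where "g = (\<lambda>mn :: nat \<times> nat. x ^ fst mn * y ^ snd mn)"
    have g: "\<bar>g mn\<bar> \<le> w mn" for mn
      unfolding g_def w_def power_add abs_mult power_abs
      by (intro mult_mono power_mono xy) (use r in auto)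
    have fk: "(\<Sum>\<^sub>\<infinity>mn. a k mn * g mn) = f k x y" for k
      using infsumI[OF a(3)[OF xy, of k]] by (simp add: g_def case_prod_unfold mult.assoc)
    have "(\<Sum>\<^sub>\<infinity>(mn, k). a k mn * g mn) = (\<Sum>\<^sub>\<infinity>k. \<Sum>\<^sub>\<infinity>mn. a k mn * g mn)"
      using infsum_Sigma'_banach[OF t[of g]] infsum_swap_banach[OF t[of g]] g by simp
    with At[of g] g show ?thesis by (simp add: fk) (simp add: g_def case_prod_unfold mult.assoc)
  qed
  show ?thesis
    unfolding has_double_series_def
    by (rule exI, rule exI[of _ A]) (use Aw sum in \<open>auto simp: w_def case_prod_unfold\<close>)
qed

lemma real_analytic_onI_series:
  assumes "\<And>w. w \<in> S \<Longrightarrow> \<exists>r>0. \<exists>B. has_double_series r B (\<lambda>x y. f (w + Complex x y))"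
  shows "real_analytic_on f S"
  unfolding real_analytic_on_def
proof
  fix w assume "w \<in> S"
  then obtain r B where r: "r > 0" and "has_double_series r B (\<lambda>x y. f (w + Complex x y))"
    using assms by blast
  then obtain a where a: "\<And>x y. \<bar>x\<bar> \<le> r \<Longrightarrow> \<bar>y\<bar> \<le> r \<Longrightarrow>
      ((\<lambda>(m, n). a (m, n) * x ^ m * y ^ n) has_sum f (w + Complex x y)) UNIV"
    unfolding has_double_series_def by blast
  have "((\<lambda>(m, n). a (m, n) * Re (z - w) ^ m * Im (z - w) ^ n) has_sum f z) UNIV" if "z \<in> ball w r" for z
  proof -
    have "cmod (z - w) \<le> r"
      using that by (simp add: dist_norm norm_minus_commute)
    then have "\<bar>Re (z - w)\<bar> \<le> r" "\<bar>Im (z - w)\<bar> \<le> r"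
      using abs_Re_le_cmod[of "z - w"] abs_Im_le_cmod[of "z - w"] by linarith+
    from a[OF this] show ?thesis
      by (simp only: complex_surj) simp
  qed
  with r show "\<exists>r>0. \<exists>a. \<forall>z\<in>ball w r.
      ((\<lambda>(m, n). a m n * Re (z - w) ^ m * Im (z - w) ^ n) has_sum f z) UNIV"
    by (intro exI[of _ r] conjI exI[of _ "\<lambda>m n. a (m, n)"] ballI) simp_all
qed

lemma inverse_square_sums:
  fixes x :: real
  assumes "\<bar>x\<bar> < 1"
  shows "(\<lambda>k. real (Suc k) * x ^ k) sums (1 / (1 - x)\<^sup>2)"
proof -
  have "(\<lambda>k. of_nat (Suc k) * x ^ k) sums (1 / (1 - x)\<^sup>2)"
    by (rule geometric_deriv_sums) (use assms in simp)
  then show ?thesis by simp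
qed

text \<open>The expansion is \<open>1 / (A + q)\<^sup>2 = \<Sum>k. (k + 1) (- q) ^ k / A ^ (k + 2)\<close>. The assumption \<open>mult\<close> says that
  multiplication by \<open>q\<close> has operator norm at most \<open>B\<close>, so the norms of the terms are dominated by the
  same series at \<open>q = - B\<close>.\<close>

lemma has_double_series_inverse_square:
  assumes q: "has_double_series r B q" and "B < A" "0 \<le> B" "0 \<le> r"
    and mult: "\<And>C g. has_double_series r C g \<Longrightarrow> has_double_series r (B * C) (\<lambda>x y. q x y * g x y)"
    and bound: "\<And>x y. \<bar>x\<bar> \<le> r \<Longrightarrow> \<bar>y\<bar> \<le> r \<Longrightarrow> \<bar>q x y\<bar> \<le> B"
  shows "\<exists>C. has_double_series r C (\<lambda>x y. 1 / (A + q x y)\<^sup>2)"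
proof -
  have pow: "has_double_series r (B ^ k) (\<lambda>x y. q x y ^ k)" for k
  proof (induction k)
    case 0
    show ?case using has_double_series_const[of r 1] by simp
  next
    case (Suc k)
    show ?case using mult[OF Suc] by simp
  qed
  define c where "c k = real (Suc k) * (-1) ^ k / A ^ (k + 2)" for k
  have A: "A > 0" using assms by simp
  have powc: "has_double_series r (\<bar>c k\<bar> * B ^ k) (\<lambda>x y. c k * q x y ^ k)" for k
    by (rule has_double_series_scale[OF pow])
  have sums: "(\<lambda>k. c k * t ^ k) sums (1 / (A + t)\<^sup>2)" if "\<bar>t\<bar> \<le> B" for t
  proof -
    have "\<bar>- t / A\<bar> < 1" using that A \<open>B < A\<close> by simp
    from sums_mult[OF inverse_square_sums[OF this], of "1 / A\<^sup>2"]
    have "(\<lambda>k. 1 / A\<^sup>2 * (real (Suc k) * (- t / A) ^ k)) sums (1 / A\<^sup>2 * (1 / (1 - - t / A)\<^sup>2))" .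
    moreover have "1 / A\<^sup>2 * (real (Suc k) * (- t / A) ^ k) = c k * t ^ k" for k
    proof -
      have "(- t / A) ^ k = (-1) ^ k * t ^ k / A ^ k"
        by (simp only: power_divide power_minus[of t k])
      then show ?thesis by (simp add: c_def power2_eq_square)
    qed
    moreover have "1 / A\<^sup>2 * (1 / (1 - - t / A)\<^sup>2) = 1 / (A + t)\<^sup>2"
      using A by (simp add: power_mult_distrib[symmetric] field_simps)
    ultimately show ?thesis by (simp only:)
  qed
  have eq: "c k * (- t) ^ k = \<bar>c k\<bar> * t ^ k" if "t \<ge> 0" for t k
  proof -
    have "\<bar>c k\<bar> = real (Suc k) / A ^ (k + 2)"
      using A by (simp add: c_def abs_mult power_abs)
    moreover have "(-1) ^ k * (- t) ^ k = t ^ k"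
      by (simp flip: power_mult_distrib)
    ultimately show ?thesis by (simp add: c_def mult.assoc)
  qed
  have summable: "summable (\<lambda>k. \<bar>c k\<bar> * B ^ k)"
    using sums_summable[OF sums[of "- B"]] eq[OF \<open>0 \<le> B\<close>] \<open>0 \<le> B\<close> by simp
  have "(\<Sum>\<^sub>\<infinity>k. c k * q x y ^ k) = 1 / (A + q x y)\<^sup>2"
    if xy: "\<bar>x\<bar> \<le> r" "\<bar>y\<bar> \<le> r" for x y
  proof -
    have "summable (\<lambda>k. norm (c k * q x y ^ k))"
    proof (rule summable_comparison_test[OF _ summable], intro exI allI impI)
      show "norm (norm (c k * q x y ^ k)) \<le> \<bar>c k\<bar> * B ^ k" for k
        using bound[OF xy] by (simp add: abs_mult power_abs mult_left_mono power_mono)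
    qed
    from norm_summable_imp_has_sum[OF this sums[OF bound[OF xy]]] show ?thesis
      by (rule infsumI)
  qed
  note eq = this
  obtain C where "has_double_series r C (\<lambda>x y. \<Sum>\<^sub>\<infinity>k. c k * q x y ^ k)"
    using has_double_series_infsum[OF powc summable \<open>0 \<le> r\<close>] by blast
  from has_double_series_cong[OF this eq] show ?thesis by (rule exI)
qed

text \<open>Near \<open>w\<close> the denominator is the square of \<open>A + q\<close>, where \<open>A = 1 + \<bar>w\<bar>\<^sup>2\<close> and \<open>q\<close> is a polynomial in the
  displacement without constant term. Its norm \<open>B r\<close> tends to \<open>0\<close> with the radius \<open>r\<close> and is eventually
  smaller than \<open>A\<close>.\<close>

lemma real_analytic_on_fubini_study:
  "real_analytic_on (\<lambda>z. d / (1 + (cmod z)\<^sup>2)\<^sup>2) S"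
proof (rule real_analytic_onI_series)
  fix w :: complex
  define a b A where "a = 2 * Re w" and "b = 2 * Im w" and "A = 1 + (cmod w)\<^sup>2"
  define q where "q x y = a * x + b * y + x\<^sup>2 + y\<^sup>2" for x y :: real
  define B where "B r = \<bar>a\<bar> * r + \<bar>b\<bar> * r + r\<^sup>2 + r\<^sup>2" for r :: real
  have "(B \<longlongrightarrow> B 0) (at_right 0)"
    unfolding B_def by (intro tendsto_intros)
  then have "\<forall>\<^sub>F r in at_right 0. B r < A"
    by (rule order_tendstoD) (simp add: B_def A_def add_pos_nonneg)
  then have "\<forall>\<^sub>F r in at_right 0. B r < A \<and> r > 0"
    by (intro eventually_conj eventually_at_right_less)
  then obtain r where r: "B r < A" "r > 0"
    using eventually_happens'[OF trivial_limit_at_right_real] by blast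
  have B0: "B r \<ge> 0" using r by (simp add: B_def)
  have mult: "has_double_series r (B r * C) (\<lambda>x y. q x y * g x y)" if g: "has_double_series r C g" for C g
  proof -
    have r0: "r \<ge> 0" using r by simp
    note shift = has_double_series_shift[OF g r0]
    have s: "has_double_series r (\<bar>a\<bar> * (r ^ (1 + 0) * C) + \<bar>b\<bar> * (r ^ (0 + 1) * C)
        + r ^ (2 + 0) * C + r ^ (0 + 2) * C)
      (\<lambda>x y. a * (x ^ 1 * y ^ 0 * g x y) + b * (x ^ 0 * y ^ 1 * g x y)
        + x ^ 2 * y ^ 0 * g x y + x ^ 0 * y ^ 2 * g x y)"
      by (intro has_double_series_add has_double_series_scale shift r0)
    have "\<bar>a\<bar> * (r ^ (1 + 0) * C) + \<bar>b\<bar> * (r ^ (0 + 1) * C) + r ^ (2 + 0) * C + r ^ (0 + 2) * C = B r * C"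
      by (simp only: B_def distrib_right mult.assoc add_0_left add_0_right power_one_right)
    moreover have "a * (x ^ 1 * y ^ 0 * g x y) + b * (x ^ 0 * y ^ 1 * g x y)
        + x ^ 2 * y ^ 0 * g x y + x ^ 0 * y ^ 2 * g x y = q x y * g x y" for x y
      by (simp add: q_def distrib_right)
    ultimately show ?thesis
      using s by (simp only:)
  qed
  have q: "has_double_series r (B r) q"
    using mult[OF has_double_series_const[of r 1]] by simp
  have bound: "\<bar>q x y\<bar> \<le> B r" if "\<bar>x\<bar> \<le> r" "\<bar>y\<bar> \<le> r" for x y
  proof -
    have "\<bar>q x y\<bar> \<le> \<bar>a * x\<bar> + \<bar>b * y\<bar> + \<bar>x\<^sup>2\<bar> + \<bar>y\<^sup>2\<bar>"
      unfolding q_def by linarith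
    also have "\<dots> \<le> B r"
      unfolding B_def abs_mult power_abs
      by (intro add_mono mult_left_mono power_mono that) auto
    finally show ?thesis .
  qed
  obtain C where C: "has_double_series r C (\<lambda>x y. 1 / (A + q x y)\<^sup>2)"
    using has_double_series_inverse_square[OF q r(1) B0 _ mult bound] r by auto
  have "(cmod (w + Complex x y))\<^sup>2 = (cmod w)\<^sup>2 + q x y" for x y
    by (simp add: cmod_power2 q_def a_def b_def) (simp add: power2_eq_square algebra_simps)
  then have "(\<lambda>x y. d / (1 + (cmod (w + Complex x y))\<^sup>2)\<^sup>2) = (\<lambda>x y. d * (1 / (A + q x y)\<^sup>2))"
    by (simp add: A_def add.assoc)
  then show "\<exists>r>0. \<exists>B. has_double_series r B (\<lambda>x y. d / (1 + (cmod (w + Complex x y))\<^sup>2)\<^sup>2)"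
    using has_double_series_scale[OF C, of d] r by auto
qed

section \<open>The projective line is a sphere\<close>

lemma quotient_map_quotient_topology: "quotient_map X (quotient_topology X q) q"
proof -
  have "openin (quotient_topology X q) (q ` topspace X)"
  proof -
    have "{x \<in> topspace X. q x \<in> q ` topspace X} = topspace X" by blast
    then show ?thesis by (simp add: openin_quotient_topology)
  qed
  then have "topspace (quotient_topology X q) = q ` topspace X"
    by (meson openin_quotient_topology openin_subset openin_topspace subset_antisym)
  then show ?thesis
    by (simp add: quotient_map_def openin_quotient_topology)
qed

text \<open>Loops are mapped to \<open>S\<close>, deformed there, and the deformation is mapped back.\<close>

lemma homeomorphic_simply_connected_space:
  assumes h: "homeomorphic_map X (top_of_set S) h" and S: "simply_connected S"
  shows "simply_connected_space X"
proof -
  obtain k where k: "homeomorphic_maps X (top_of_set S) h k"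
    using h homeomorphic_map_maps by blast
  then have hc: "continuous_map X (top_of_set S) h" and kc: "continuous_map (top_of_set S) X k"
    and kh: "\<And>x. x \<in> topspace X \<Longrightarrow> k (h x) = x"
    by (auto simp: homeomorphic_maps_def)
  show ?thesis
    unfolding simply_connected_space_def
  proof (intro allI impI)
    fix p q assume pq: "pathin X p \<and> p 1 = p 0 \<and> pathin X q \<and> q 1 = q 0"
    have "pathin (top_of_set S) (h \<circ> p)" "pathin (top_of_set S) (h \<circ> q)"
      using pq hc pathin_compose by blast+
    then have "path (h \<circ> p)" "path_image (h \<circ> p) \<subseteq> S" "path (h \<circ> q)" "path_image (h \<circ> q) \<subseteq> S"
      by (auto simp: pathin_def path_def path_image_def)
    moreover have "pathfinish (h \<circ> p) = pathstart (h \<circ> p)" "pathfinish (h \<circ> q) = pathstart (h \<circ> q)"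
      using pq by (auto simp: pathfinish_def pathstart_def)
    ultimately have "homotopic_loops S (h \<circ> p) (h \<circ> q)"
      using S unfolding simply_connected_def by blast
    then have "homotopic_with (\<lambda>r. r 1 = r 0) (top_of_set {0..1}) (top_of_set S) (h \<circ> p) (h \<circ> q)"
      by (simp add: homotopic_loops_def pathfinish_def pathstart_def)
    then have hom: "homotopic_with (\<lambda>r. r 1 = r 0) (top_of_set {0..1}) X (k \<circ> (h \<circ> p)) (k \<circ> (h \<circ> q))"
      by (rule homotopic_with_compose_continuous_map_left[OF _ kc]) simp
    have in_X: "r t \<in> topspace X" if "pathin X r" "t \<in> {0..1}" for r t
      using that by (auto simp: pathin_def continuous_map_def)
    \<comment> \<open>A path is constrained on the unit interval only, so the two sides need not be equal functions.\<close>
    have p_eq: "homotopic_with (\<lambda>r. r 1 = r 0) (top_of_set {0..1}) X r (k \<circ> (h \<circ> r))"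
      if "pathin X r" "r 1 = r 0" for r
      by (rule homotopic_with_equal) (use that in_X[OF that(1)] kh in \<open>auto simp: pathin_def\<close>)
    have "homotopic_with (\<lambda>r. r 1 = r 0) (top_of_set {0..1}) X p (k \<circ> (h \<circ> q))"
      by (rule homotopic_with_trans[OF p_eq hom]) (use pq in auto)
    moreover have "homotopic_with (\<lambda>r. r 1 = r 0) (top_of_set {0..1}) X (k \<circ> (h \<circ> q)) q"
      by (rule homotopic_with_symD[OF p_eq]) (use pq in auto)
    ultimately show "homotopic_with (\<lambda>r. r 1 = r 0) (top_of_set {0..1}) X p q"
      by (rule homotopic_with_trans)
  qed
qed

subsection \<open>Points\<close>

abbreviation proj_topology :: "(complex \<times> complex) set topology" where
  "proj_topology \<equiv> quotient_topology (top_of_set (UNIV - {(0, 0)})) proj_point"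

lemma tops_proj_line: "tops (proj_line c) = proj_topology"
  by (simp add: proj_line_def)

lemma topspace_proj_topology: "topspace proj_topology = proj_point ` (UNIV - {(0, 0)})"
  using quotient_map_quotient_topology[of "top_of_set (UNIV - {(0::complex, 0::complex)})" proj_point]
  by (simp add: quotient_map_def)

lemma mem_proj_point: "w \<in> proj_point (z0, z1) \<longleftrightarrow> (\<exists>c. c \<noteq> 0 \<and> w = (c * z0, c * z1))"
  by (auto simp: proj_point_def)

lemma proj_point_scale:
  assumes "c \<noteq> 0" shows "proj_point (c * z0, c * z1) = proj_point (z0, z1)"
proof (intro set_eqI iffI)
  fix w assume "w \<in> proj_point (c * z0, c * z1)"
  then obtain d where "d \<noteq> 0" "w = (d * (c * z0), d * (c * z1))"
    by (auto simp: mem_proj_point)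
  with assms show "w \<in> proj_point (z0, z1)"
    unfolding mem_proj_point by (intro exI[of _ "d * c"]) (simp add: mult.assoc)
next
  fix w assume "w \<in> proj_point (z0, z1)"
  then obtain d where "d \<noteq> 0" "w = (d * z0, d * z1)"
    by (auto simp: mem_proj_point)
  with assms show "w \<in> proj_point (c * z0, c * z1)"
    unfolding mem_proj_point by (intro exI[of _ "d / c"]) simp
qed

lemma proj_point_affine: "z1 \<noteq> 0 \<Longrightarrow> proj_point (z0, z1) = proj_point (z0 / z1, 1)"
  using proj_point_scale[of z1 "z0 / z1" 1] by simp

lemma proj_point_affine': "z0 \<noteq> 0 \<Longrightarrow> proj_point (z0, z1) = proj_point (1, z1 / z0)"
  using proj_point_scale[of z0 1 "z1 / z0"] by simp

lemma proj_point_cases: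
  assumes "l \<in> topspace proj_topology"
  obtains w where "l = proj_point (w, 1)" | "l = proj_point (1, 0)"
proof -
  obtain z0 z1 where l: "l = proj_point (z0, z1)" "(z0, z1) \<noteq> (0, 0)"
    using assms by (auto simp: topspace_proj_topology)
  show ?thesis
  proof (cases "z1 = 0")
    case True
    then show ?thesis using l that(2) proj_point_affine'[of z0 z1] by simp
  next
    case False
    then show ?thesis using l that(1) proj_point_affine[of z1 z0] by simp
  qed
qed

subsection \<open>The sphere\<close>

text \<open>The point of the unit sphere whose stereographic projection from \<open>(0, 1)\<close> is \<open>z\<^sub>0 / z\<^sub>1\<close>, in homogeneous
  coordinates; on vectors of norm one this is the Hopf fibration.\<close>

definition hopf :: "complex \<times> complex \<Rightarrow> complex \<times> real" where
  "hopf = (\<lambda>(z0, z1). (2 * z0 * cnj z1 / of_real ((cmod z0)\<^sup>2 + (cmod z1)\<^sup>2),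
     ((cmod z0)\<^sup>2 - (cmod z1)\<^sup>2) / ((cmod z0)\<^sup>2 + (cmod z1)\<^sup>2)))"

definition sphere_map :: "(complex \<times> complex) set \<Rightarrow> complex \<times> real" where
  "sphere_map l = hopf (SOME v. v \<in> l)"

lemma hopf_scale:
  assumes "c \<noteq> 0" shows "hopf (c * z0, c * z1) = hopf (z0, z1)"
proof -
  have n: "(cmod (c * z0))\<^sup>2 + (cmod (c * z1))\<^sup>2 = (cmod c)\<^sup>2 * ((cmod z0)\<^sup>2 + (cmod z1)\<^sup>2)"
    "(cmod (c * z0))\<^sup>2 - (cmod (c * z1))\<^sup>2 = (cmod c)\<^sup>2 * ((cmod z0)\<^sup>2 - (cmod z1)\<^sup>2)"
    by (simp_all add: norm_mult power_mult_distrib distrib_left right_diff_distrib)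
  have "2 * (c * z0) * cnj (c * z1) = of_real ((cmod c)\<^sup>2) * (2 * z0 * cnj z1)"
    by (simp add: complex_norm_square[of c] mult_ac del: of_real_power)
  then show ?thesis
    unfolding hopf_def prod.case n of_real_mult using assms by (simp only: mult_divide_mult_cancel_left_if) simp
qed

lemma sphere_map_proj_point: "sphere_map (proj_point (z0, z1)) = hopf (z0, z1)"
proof -
  have "(z0, z1) \<in> proj_point (z0, z1)"
    unfolding mem_proj_point by (intro exI[of _ 1]) simp
  then have "(SOME v. v \<in> proj_point (z0, z1)) \<in> proj_point (z0, z1)"
    by (rule someI)
  then show ?thesis
    unfolding sphere_map_def by (auto simp: mem_proj_point hopf_scale)
qed

lemma sphere_complex_real: "(a, b) \<in> sphere (0 :: complex \<times> real) 1 \<longleftrightarrow> (cmod a)\<^sup>2 + b\<^sup>2 = 1"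
proof -
  have "(a, b) \<in> sphere (0 :: complex \<times> real) 1 \<longleftrightarrow> norm (a, b) = 1"
    by simp
  also have "\<dots> \<longleftrightarrow> (cmod a)\<^sup>2 + b\<^sup>2 = 1"
    by (simp add: norm_Pair)
  finally show ?thesis .
qed

lemma hopf_affine:
  "hopf (w, 1) = (2 * w / of_real ((cmod w)\<^sup>2 + 1), ((cmod w)\<^sup>2 - 1) / ((cmod w)\<^sup>2 + 1))"
  by (simp add: hopf_def)

lemma hopf_infinity: "hopf (1, 0) = (0, 1)"
  by (simp add: hopf_def)

lemma hopf_affine_stereographic:
  "snd (hopf (w, 1)) \<noteq> 1" "fst (hopf (w, 1)) / of_real (1 - snd (hopf (w, 1))) = w"
proof -
  have pos: "(cmod w)\<^sup>2 + 1 \<noteq> 0"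
    by (smt (verit) zero_le_power2)
  have "1 - snd (hopf (w, 1)) = 2 / ((cmod w)\<^sup>2 + 1)"
    using pos by (simp add: hopf_affine diff_divide_eq_iff)
  moreover have "of_real ((cmod w)\<^sup>2 + 1) \<noteq> (0 :: complex)"
    using pos of_real_eq_0_iff by blast
  ultimately show "snd (hopf (w, 1)) \<noteq> 1" "fst (hopf (w, 1)) / of_real (1 - snd (hopf (w, 1))) = w"
    using pos by (auto simp: hopf_affine simp del: of_real_add of_real_power)
qed

lemma hopf_in_sphere: "hopf (w, 1) \<in> sphere 0 1"
proof -
  define n where "n = (cmod w)\<^sup>2 + 1"
  have n: "n \<noteq> 0"
    unfolding n_def by (smt (verit) zero_le_power2)
  have "(cmod (fst (hopf (w, 1))))\<^sup>2 = 4 * (n - 1) / n\<^sup>2"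
    unfolding hopf_affine fst_conv norm_divide norm_mult power_divide norm_of_real power2_abs n_def[symmetric]
    by (simp add: n_def power_mult_distrib)
  moreover have "(snd (hopf (w, 1)))\<^sup>2 = (n - 2)\<^sup>2 / n\<^sup>2"
    by (simp add: hopf_affine n_def power_divide)
  ultimately have 1: "(cmod (fst (hopf (w, 1))))\<^sup>2 + (snd (hopf (w, 1)))\<^sup>2 = 1"
  proof -
    have "4 * (n - 1) + (n - 2)\<^sup>2 = n\<^sup>2" by (simp add: power2_eq_square algebra_simps)
    then have "4 * (n - 1) / n\<^sup>2 + (n - 2)\<^sup>2 / n\<^sup>2 = 1"
      using n by (simp flip: add_divide_distrib)
    then show ?thesis
      using \<open>(cmod (fst (hopf (w, 1))))\<^sup>2 = _\<close> \<open>(snd (hopf (w, 1)))\<^sup>2 = _\<close> by simp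
  qed
  then show ?thesis
    using sphere_complex_real[of "fst (hopf (w, 1))" "snd (hopf (w, 1))"] by simp
qed

lemma sphere_map_inj: "inj_on sphere_map (topspace proj_topology)"
proof (rule inj_onI)
  fix l l' assume l: "l \<in> topspace proj_topology" and l': "l' \<in> topspace proj_topology"
    and eq: "sphere_map l = sphere_map l'"
  from l show "l = l'"
  proof (cases rule: proj_point_cases)
    case (1 w)
    from l' show ?thesis
    proof (cases rule: proj_point_cases)
      case (1 w')
      then have "hopf (w, 1) = hopf (w', 1)"
        using eq \<open>l = proj_point (w, 1)\<close> by (simp add: sphere_map_proj_point)
      then have "w = w'"
        using hopf_affine_stereographic(2)[of w] hopf_affine_stereographic(2)[of w'] by metis
      then show ?thesis using 1 \<open>l = proj_point (w, 1)\<close> by simp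
    next
      case 2
      then show ?thesis
        using eq \<open>l = proj_point (w, 1)\<close> hopf_affine_stereographic(1)[of w]
        by (simp add: sphere_map_proj_point hopf_infinity)
    qed
  next
    case 2
    from l' show ?thesis
    proof (cases rule: proj_point_cases)
      case (1 w)
      then show ?thesis
        using eq 2 hopf_affine_stereographic(1)[of w]
        by (metis sphere_map_proj_point hopf_infinity snd_conv)
    qed (use 2 in simp)
  qed
qed

lemma sphere_map_image: "sphere_map ` topspace proj_topology = sphere 0 1"
proof (intro equalityI subsetI)
  fix s assume "s \<in> sphere_map ` topspace proj_topology"
  then obtain l where l: "l \<in> topspace proj_topology" "s = sphere_map l" by blast
  from l(1) show "s \<in> sphere 0 1"
  proof (cases rule: proj_point_cases)
    case (1 w)
    then show ?thesis using l hopf_in_sphere[of w] by (simp add: sphere_map_proj_point)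
  next
    case 2
    then show ?thesis using l by (simp add: sphere_map_proj_point hopf_infinity norm_Pair)
  qed
next
  fix s :: "complex \<times> real" assume s: "s \<in> sphere 0 1"
  obtain a b where ab: "s = (a, b)" by (cases s)
  have n: "(cmod a)\<^sup>2 = 1 - b\<^sup>2"
    using s unfolding ab sphere_complex_real by simp
  show "s \<in> sphere_map ` topspace proj_topology"
  proof (cases "b = 1")
    case True
    then have "s = sphere_map (proj_point (1, 0))"
      using n ab by (simp add: sphere_map_proj_point hopf_infinity)
    then show ?thesis by (auto simp: topspace_proj_topology)
  next
    case False
    define w where "w = a / of_real (1 - b)"
    have "(cmod w)\<^sup>2 = (1 - b\<^sup>2) / (1 - b)\<^sup>2"
      by (simp only: w_def norm_divide norm_of_real power_divide n power2_abs)
    then have w: "(cmod w)\<^sup>2 = (1 + b) / (1 - b)"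
    proof -
      have "(1 - b\<^sup>2) = (1 + b) * (1 - b)" by (simp add: power2_eq_square algebra_simps)
      then show ?thesis using \<open>(cmod w)\<^sup>2 = _\<close> False by (simp add: power2_eq_square)
    qed
    have "of_real (1 - b) \<noteq> (0 :: complex)" using False by (simp del: of_real_diff)
    moreover have "(cmod w)\<^sup>2 + 1 = 2 / (1 - b)" "(cmod w)\<^sup>2 - 1 = 2 * b / (1 - b)"
      using False by (simp_all add: w field_simps)
    ultimately have "hopf (w, 1) = s"
      unfolding hopf_affine ab using False by (simp add: w_def del: of_real_diff)
    then have "s = sphere_map (proj_point (w, 1))"
      by (simp add: sphere_map_proj_point)
    then show ?thesis by (auto simp: topspace_proj_topology)
  qed
qed

lemma continuous_on_hopf: "continuous_on (UNIV - {(0, 0)}) hopf"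
proof -
  have nz: "(cmod (fst v))\<^sup>2 + (cmod (snd v))\<^sup>2 \<noteq> 0" if "v \<in> UNIV - {(0, 0)}" for v
    using that by (cases v) (auto simp: sum_power2_eq_zero_iff)
  have nz': "of_real ((cmod (fst v))\<^sup>2 + (cmod (snd v))\<^sup>2) \<noteq> (0 :: complex)" if "v \<in> UNIV - {(0, 0)}" for v
    using nz[OF that] of_real_eq_0_iff by blast
  show ?thesis
    unfolding hopf_def case_prod_unfold
    by (intro continuous_intros ballI nz nz')
qed

text \<open>A continuous bijection from a compact space to a Hausdorff space is a homeomorphism. The projective
  line is compact because every point has a representative of norm one.\<close>

lemma homeomorphic_map_sphere_map: "homeomorphic_map proj_topology (top_of_set (sphere 0 1)) sphere_map"
proof (rule continuous_imp_homeomorphic_map)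
  have q: "quotient_map (top_of_set (UNIV - {(0::complex, 0::complex)})) proj_topology proj_point"
    by (rule quotient_map_quotient_topology)
  have "continuous_map proj_topology euclidean sphere_map"
  proof (rule continuous_compose_quotient_map[OF q])
    have "sphere_map \<circ> proj_point = hopf"
      by (auto simp: sphere_map_proj_point)
    then show "continuous_map (top_of_set (UNIV - {(0, 0)})) euclidean (sphere_map \<circ> proj_point)"
      using continuous_on_hopf by simp
  qed
  then show "continuous_map proj_topology (top_of_set (sphere 0 1)) sphere_map"
    using sphere_map_image by (auto simp: continuous_map_in_subtopology)
  have "compactin (top_of_set (UNIV - {(0::complex, 0::complex)})) (sphere 0 1)"
    by (auto simp: compactin_subtopology zero_prod_def[symmetric])
  then have "compactin proj_topology (proj_point ` sphere 0 1)"
    by (rule image_compactin[OF _ quotient_imp_continuous_map[OF q]])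
  moreover have "proj_point ` sphere 0 1 = topspace proj_topology"
  proof (intro equalityI subsetI)
    fix l assume "l \<in> topspace proj_topology"
    then obtain z0 z1 where l: "l = proj_point (z0, z1)" "(z0, z1) \<noteq> 0"
      by (auto simp: topspace_proj_topology zero_prod_def)
    define r where "r = inverse (norm (z0, z1))"
    have "r \<noteq> 0" using l(2) by (simp add: r_def)
    then have "l = proj_point (r *\<^sub>R (z0, z1))"
      using proj_point_scale[of "of_real r" z0 z1] l(1) by (simp add: scaleR_conv_of_real)
    moreover have "r *\<^sub>R (z0, z1) \<in> sphere 0 1"
      using l(2) by (simp add: r_def del: scaleR_Pair)
    ultimately show "l \<in> proj_point ` sphere 0 1" by blast
  next
    fix l assume "l \<in> proj_point ` sphere 0 1"
    then obtain v where "l = proj_point v" "norm v = 1" by auto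
    moreover from this have "v \<noteq> (0, 0)" by auto
    ultimately show "l \<in> topspace proj_topology"
      unfolding topspace_proj_topology by blast
  qed
  ultimately show "compact_space proj_topology"
    by (simp add: compact_space_def)
qed (use sphere_map_image sphere_map_inj in \<open>auto intro: Hausdorff_space_subtopology\<close>)

lemma second_countable_euclidean: "second_countable (euclidean :: 'a::second_countable_topology topology)"
proof -
  obtain B :: "'a set set" where B: "countable B" "topological_basis B"
    using ex_countable_basis by blast
  show ?thesis
    unfolding second_countable_def
  proof (intro exI[of _ B] conjI allI impI ballI)
    show "openin euclidean V" if "V \<in> B" for V
      unfolding open_openin[symmetric] by (rule topological_basis_open[OF B(2) that])
    show "\<exists>V\<in>B. x \<in> V \<and> V \<subseteq> U" if "openin euclidean U \<and> x \<in> U" for U :: "'a set" and x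
    proof -
      have "open U" "x \<in> U" using that open_openin by blast+
      then obtain V where "V \<in> B" "x \<in> V" "V \<subseteq> U" by (rule topological_basisE[OF B(2)])
      then show ?thesis by blast
    qed
  qed (rule B(1))
qed

lemma Hausdorff_proj_topology: "Hausdorff_space proj_topology"
  and second_countable_proj_topology: "second_countable proj_topology"
  and connected_proj_topology: "connected_space proj_topology"
  and simply_connected_proj_topology: "simply_connected_space proj_topology"
proof -
  let ?S = "sphere (0 :: complex \<times> real) 1"
  have homeo: "proj_topology homeomorphic_space (top_of_set ?S)"
    using homeomorphic_map_sphere_map homeomorphic_map_imp_homeomorphic_space by blast
  show "Hausdorff_space proj_topology"
    using homeo homeomorphic_Hausdorff_space Hausdorff_space_subtopology Hausdorff_space_euclidean by blast
  show "second_countable proj_topology"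
    using homeo homeomorphic_space_second_countability second_countable_subtopology
      second_countable_euclidean by blast
  have sc: "simply_connected ?S"
    by (rule simply_connected_sphere) simp
  then show "simply_connected_space proj_topology"
    by (rule homeomorphic_simply_connected_space[OF homeomorphic_map_sphere_map])
  have "connected ?S"
    using sc by (rule simply_connected_imp_connected)
  then show "connected_space proj_topology"
    using homeomorphic_connected_space[OF homeo] connectedin_iff_connected[of ?S]
    unfolding connectedin_def by simp
qed

section \<open>Charts, metric and action on the projective line\<close>

text \<open>The inverses of the two charts.\<close>

definition aff0 :: "complex \<Rightarrow> (complex \<times> complex) set" where "aff0 w = proj_point (w, 1)"
definition aff1 :: "complex \<Rightarrow> (complex \<times> complex) set" where "aff1 w = proj_point (1, w)"

lemma sphere_map_aff: "sphere_map (aff0 w) = hopf (w, 1)" "sphere_map (aff1 w) = hopf (1, w)"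
  by (simp_all add: aff0_def aff1_def sphere_map_proj_point)

lemma proj_coord_aff [simp]: "proj_coord0 (aff0 w) = w" "proj_coord1 (aff1 w) = w"
  by (simp_all add: aff0_def aff1_def proj_coord_proj_point)

lemma aff0_eq_iff [simp]: "aff0 w = aff0 w' \<longleftrightarrow> w = w'" and aff1_eq_iff [simp]: "aff1 w = aff1 w' \<longleftrightarrow> w = w'"
  using proj_coord_aff by metis+

lemma proj_point_conv_aff:
  "z1 \<noteq> 0 \<Longrightarrow> proj_point (z0, z1) = aff0 (z0 / z1)" "z0 \<noteq> 0 \<Longrightarrow> proj_point (z0, z1) = aff1 (z1 / z0)"
  unfolding aff0_def aff1_def by (rule proj_point_affine, simp) (rule proj_point_affine', simp)

lemma aff1_conv_aff0: "w \<noteq> 0 \<Longrightarrow> aff1 w = aff0 (inverse w)"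
  using proj_point_conv_aff(1)[of w 1] by (simp add: aff1_def inverse_eq_divide)

lemma aff0_conv_aff1: "w \<noteq> 0 \<Longrightarrow> aff0 w = aff1 (inverse w)"
  using proj_point_conv_aff(2)[of w 1] by (simp add: aff0_def inverse_eq_divide)

lemma aff0_neq_infinity: "aff0 w \<noteq> aff1 0"
proof
  assume "aff0 w = aff1 0"
  then have "hopf (w, 1) = (0, 1)"
    by (metis sphere_map_aff hopf_infinity)
  with hopf_affine_stereographic(1)[of w] show False by simp
qed

lemma atlas_proj_line:
  "atlas (proj_line c) = {(range aff0, proj_coord0), (range aff1, proj_coord1)}"
proof -
  have "{proj_point (z0, z1) |z0 z1. z1 \<noteq> 0} = range aff0"
  proof (intro equalityI subsetI)
    show "l \<in> range aff0" if "l \<in> {proj_point (z0, z1) |z0 z1. z1 \<noteq> 0}" for l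
      using that proj_point_conv_aff(1) by blast
    show "l \<in> {proj_point (z0, z1) |z0 z1. z1 \<noteq> 0}" if "l \<in> range aff0" for l
      using that one_neq_zero unfolding aff0_def by blast
  qed
  moreover have "{proj_point (z0, z1) |z0 z1. z0 \<noteq> 0} = range aff1"
  proof (intro equalityI subsetI)
    show "l \<in> range aff1" if "l \<in> {proj_point (z0, z1) |z0 z1. z0 \<noteq> 0}" for l
      using that proj_point_conv_aff(2) by blast
    show "l \<in> {proj_point (z0, z1) |z0 z1. z0 \<noteq> 0}" if "l \<in> range aff1" for l
      using that one_neq_zero unfolding aff1_def by blast
  qed
  ultimately show ?thesis by (simp add: proj_line_def)
qed

lemma met_proj_line: "met (proj_line c) = (\<lambda>\<phi> l u v. 4 / (c * (1 + (cmod (\<phi> l))\<^sup>2)\<^sup>2) * (u \<bullet> v))"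
  by (simp add: proj_line_def)

lemma inv_into_aff [simp]:
  "inv_into (range aff0) proj_coord0 w = aff0 w" "inv_into (range aff1) proj_coord1 w = aff1 w"
  by (rule inv_into_f_eq; auto intro!: inj_onI)+

lemma aff_in_topspace [simp]: "aff0 w \<in> topspace proj_topology" "aff1 w \<in> topspace proj_topology"
  by (auto simp: topspace_proj_topology aff0_def aff1_def)

lemma aff_cases:
  assumes "l \<in> topspace proj_topology"
  obtains w where "l = aff0 w" | "l = aff1 0"
  using assms by (rule proj_point_cases) (simp_all add: aff0_def aff1_def)

lemma topspace_proj_eq: "topspace proj_topology = insert (aff1 0) (range aff0)"
proof (intro equalityI subsetI)
  fix l assume "l \<in> topspace proj_topology"
  then show "l \<in> insert (aff1 0) (range aff0)" by (cases rule: aff_cases) simp_all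
qed auto

lemma topspace_proj_eq': "topspace proj_topology = insert (aff0 0) (range aff1)"
proof (intro equalityI subsetI)
  fix l assume "l \<in> topspace proj_topology"
  then show "l \<in> insert (aff0 0) (range aff1)"
  proof (cases rule: aff_cases)
    case (1 w)
    then show ?thesis using aff0_conv_aff1[of w] by (cases "w = 0") simp_all
  qed simp
qed auto

lemma aff_mem_iff [simp]: "aff0 w \<in> range aff1 \<longleftrightarrow> w \<noteq> 0" "aff1 w \<in> range aff0 \<longleftrightarrow> w \<noteq> 0"
proof -
  show "aff1 w \<in> range aff0 \<longleftrightarrow> w \<noteq> 0"
    using aff1_conv_aff0[of w] aff0_neq_infinity by (cases "w = 0") (auto simp: eq_commute[of "aff1 0"])
  show "aff0 w \<in> range aff1 \<longleftrightarrow> w \<noteq> 0"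
  proof (cases "w = 0")
    case True
    have "aff0 0 \<noteq> aff1 v" for v
    proof (cases "v = 0")
      case False
      then show ?thesis by (simp add: aff1_conv_aff0)
    qed (use aff0_neq_infinity in simp)
    then show ?thesis using True by auto
  qed (use aff0_conv_aff1[of w] in auto)
qed

lemma hopf_antiaffine: "hopf (1, w) = (2 * cnj w / of_real (1 + (cmod w)\<^sup>2), (1 - (cmod w)\<^sup>2) / (1 + (cmod w)\<^sup>2))"
  by (simp add: hopf_def)

lemma hopf_antiaffine_stereographic:
  "snd (hopf (1, w)) \<noteq> -1" "cnj (fst (hopf (1, w))) / of_real (1 + snd (hopf (1, w))) = w"
proof -
  have pos: "1 + (cmod w)\<^sup>2 \<noteq> 0"
    by (smt (verit) zero_le_power2)
  have "1 + snd (hopf (1, w)) = 2 / (1 + (cmod w)\<^sup>2)"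
    using pos by (simp add: hopf_antiaffine add_divide_eq_iff)
  moreover have "of_real (1 + (cmod w)\<^sup>2) \<noteq> (0 :: complex)"
    using pos of_real_eq_0_iff by blast
  ultimately show "snd (hopf (1, w)) \<noteq> -1" "cnj (fst (hopf (1, w))) / of_real (1 + snd (hopf (1, w))) = w"
    using pos by (auto simp: hopf_antiaffine simp del: of_real_add of_real_power)
qed

lemma continuous_map_sphere_map: "continuous_map proj_topology euclidean sphere_map"
  using homeomorphic_imp_continuous_map[OF homeomorphic_map_sphere_map] continuous_map_in_subtopology by blast

lemma continuous_map_proj_point:
  assumes "continuous_on UNIV f" "\<And>x. f x \<noteq> (0, 0)"
  shows "continuous_map euclidean proj_topology (\<lambda>x. proj_point (f x))"
proof -
  have "continuous_map euclidean (top_of_set (UNIV - {(0, 0)})) f"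
    using assms by (auto simp: continuous_map_in_subtopology)
  from continuous_map_compose[OF this quotient_imp_continuous_map[OF quotient_map_quotient_topology]]
  show ?thesis by (simp add: o_def)
qed

text \<open>Here \<open>V\<close> contains the whole sphere except one pole and \<open>g\<close> is the stereographic projection from that
  pole (possibly followed by conjugation). The chart \<open>\<phi>\<close> is \<open>g \<circ> sphere_map\<close>, hence continuous.\<close>

lemma chart_homeomorphic:
  assumes g: "continuous_on V g" and V: "open V"
    and U: "U = {l \<in> topspace proj_topology. sphere_map l \<in> V}"
    and a: "\<And>w. a w \<in> U" "\<And>l. l \<in> U \<Longrightarrow> a (\<phi> l) = l" "\<And>w. \<phi> (a w) = w" "\<And>w. g (sphere_map (a w)) = w"
    and cont: "continuous_map euclidean proj_topology a"
  shows "openin proj_topology U \<and> open (\<phi> ` U) \<and>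
    homeomorphic_map (subtopology proj_topology U) (top_of_set (\<phi> ` U)) \<phi>"
proof -
  have im: "\<phi> ` U = UNIV"
    using a by (auto simp: image_iff) metis
  have "continuous_map (subtopology proj_topology U) (top_of_set V) sphere_map"
    using continuous_map_sphere_map U by (auto simp: continuous_map_in_subtopology continuous_map_from_subtopology)
  moreover have "continuous_map (top_of_set V) euclidean g"
    using g by simp
  ultimately have "continuous_map (subtopology proj_topology U) euclidean (g \<circ> sphere_map)"
    by (rule continuous_map_compose)
  then have "continuous_map (subtopology proj_topology U) euclidean \<phi>"
  proof (rule continuous_map_eq)
    fix l assume "l \<in> topspace (subtopology proj_topology U)"
    then have "l \<in> U" by simp
    then show "(g \<circ> sphere_map) l = \<phi> l"
      using a(4)[of "\<phi> l"] a(2)[of l] by simp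
  qed
  moreover have "continuous_map euclidean (subtopology proj_topology U) a"
    using cont a(1) by (auto simp: continuous_map_in_subtopology)
  ultimately have "homeomorphic_maps (subtopology proj_topology U) euclidean \<phi> a"
    using a(2,3) by (auto simp: homeomorphic_maps_def)
  then have "homeomorphic_map (subtopology proj_topology U) euclidean \<phi>"
    using homeomorphic_map_maps by blast
  moreover have "openin proj_topology U"
    unfolding U by (rule openin_continuous_map_preimage[OF continuous_map_sphere_map]) (simp add: V)
  ultimately show ?thesis by (simp add: im)
qed

lemma proj_line_chart:
  assumes "(U, \<phi>) \<in> atlas (proj_line c)"
  shows "openin proj_topology U \<and> open (\<phi> ` U) \<and>
    homeomorphic_map (subtopology proj_topology U) (top_of_set (\<phi> ` U)) \<phi>"
proof -
  have sep: "snd s \<noteq> b \<longleftrightarrow> s \<in> UNIV \<times> (-{b})" for s :: "complex \<times> real" and b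
    by (cases s) auto
  have 0: "openin proj_topology (range aff0) \<and> open (proj_coord0 ` range aff0) \<and>
    homeomorphic_map (subtopology proj_topology (range aff0)) (top_of_set (proj_coord0 ` range aff0)) proj_coord0"
  proof (rule chart_homeomorphic[where V="UNIV \<times> -{1}" and a=aff0
          and g="\<lambda>s. fst s / of_real (1 - snd s)"])
    show "range aff0 = {l \<in> topspace proj_topology. sphere_map l \<in> UNIV \<times> -{1}}"
      using hopf_affine_stereographic(1)
      by (auto simp: topspace_proj_eq sphere_map_aff hopf_infinity simp flip: sep)
    show "continuous_on (UNIV \<times> - {1::real}) (\<lambda>s. fst s / complex_of_real (1 - snd s))"
      by (intro continuous_intros) auto
    show "continuous_map euclidean proj_topology aff0"
      unfolding aff0_def by (rule continuous_map_proj_point) (auto intro!: continuous_intros)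
    show "fst (sphere_map (aff0 w)) / of_real (1 - snd (sphere_map (aff0 w))) = w" for w
      using hopf_affine_stereographic(2) unfolding sphere_map_aff .
  qed (auto intro!: open_Times)
  have 1: "openin proj_topology (range aff1) \<and> open (proj_coord1 ` range aff1) \<and>
    homeomorphic_map (subtopology proj_topology (range aff1)) (top_of_set (proj_coord1 ` range aff1)) proj_coord1"
  proof (rule chart_homeomorphic[where V="UNIV \<times> -{-1}" and a=aff1
          and g="\<lambda>s. cnj (fst s) / of_real (1 + snd s)"])
    have "snd (hopf (0, 1)) = -1" by (simp add: hopf_def)
    then show "range aff1 = {l \<in> topspace proj_topology. sphere_map l \<in> UNIV \<times> -{-1}}"
      using hopf_antiaffine_stereographic(1)
      by (auto simp: topspace_proj_eq' sphere_map_aff simp flip: sep)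
    show "continuous_on (UNIV \<times> - {-1::real}) (\<lambda>s. cnj (fst s) / complex_of_real (1 + snd s))"
    proof (intro continuous_intros ballI)
      fix s :: "complex \<times> real" assume "s \<in> UNIV \<times> -{-1}"
      then have "1 + snd s \<noteq> 0" by auto
      then show "complex_of_real (1 + snd s) \<noteq> 0" using of_real_eq_0_iff by blast
    qed
    show "continuous_map euclidean proj_topology aff1"
      unfolding aff1_def by (rule continuous_map_proj_point) (auto intro!: continuous_intros)
    show "cnj (fst (sphere_map (aff1 w))) / of_real (1 + snd (sphere_map (aff1 w))) = w" for w
      using hopf_antiaffine_stereographic(2) unfolding sphere_map_aff .
  qed (auto intro!: open_Times)
  show ?thesis
    using assms 0 1 unfolding atlas_proj_line by auto
qed

subsection \<open>The action in the two charts\<close>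

abbreviation rot :: "real \<Rightarrow> complex" where
  "rot t \<equiv> exp (2 * \<i> * of_real pi * of_real t)"

lemma norm_rot [simp]: "cmod (rot t) = 1"
  by simp

lemma proj_action_aff:
  "proj_action t (aff0 w) = aff0 (rot t * w)" "proj_action t (aff1 w) = aff1 (inverse (rot t) * w)"
proof -
  show "proj_action t (aff0 w) = aff0 (rot t * w)"
    by (simp only: aff0_def proj_action_proj_point)
  have "proj_action t (aff1 w) = proj_point (rot t, w)"
    by (simp only: aff1_def proj_action_proj_point mult_1_right)
  also have "\<dots> = aff1 (w / rot t)"
    by (rule proj_point_conv_aff(2)) (rule exp_not_eq_zero)
  finally show "proj_action t (aff1 w) = aff1 (inverse (rot t) * w)"
    by (simp only: divide_inverse mult.commute)
qed

lemma proj_action_0: "proj_action 0 = id"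
  by (rule ext) (simp add: proj_action_def case_prod_unfold)

text \<open>For \<open>t = 0\<close> these are also the coordinate changes, so the compatibility of charts and metric is a
  special case of the invariance under the action.\<close>

lemma loc_map_proj_action:
  "loc_map (range aff0) proj_coord0 proj_coord0 (proj_action t) z = rot t * z"
  "loc_map (range aff1) proj_coord1 proj_coord1 (proj_action t) z = inverse (rot t) * z"
  "z \<noteq> 0 \<Longrightarrow> loc_map (range aff0) proj_coord0 proj_coord1 (proj_action t) z = inverse (rot t * z)"
  "z \<noteq> 0 \<Longrightarrow> loc_map (range aff1) proj_coord1 proj_coord0 (proj_action t) z = rot t * inverse z"
proof -
  show "loc_map (range aff0) proj_coord0 proj_coord0 (proj_action t) z = rot t * z"
    "loc_map (range aff1) proj_coord1 proj_coord1 (proj_action t) z = inverse (rot t) * z"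
    unfolding loc_map_def inv_into_aff proj_action_aff proj_coord_aff by (rule refl)+
  show "loc_map (range aff0) proj_coord0 proj_coord1 (proj_action t) z = inverse (rot t * z)" if "z \<noteq> 0"
  proof -
    have "rot t * z \<noteq> 0" using that by simp
    from aff0_conv_aff1[OF this] show ?thesis
      unfolding loc_map_def inv_into_aff proj_action_aff by (simp only: proj_coord_aff)
  qed
  show "loc_map (range aff1) proj_coord1 proj_coord0 (proj_action t) z = rot t * inverse z" if "z \<noteq> 0"
  proof -
    have "inverse (rot t) * z \<noteq> 0" using that by simp
    from aff1_conv_aff0[OF this] show ?thesis
      unfolding loc_map_def inv_into_aff proj_action_aff
      by (simp only: proj_coord_aff inverse_mult_distrib inverse_inverse_eq)
  qed
qed

lemma domain_proj_action:
  "{p \<in> range aff0. proj_action t p \<in> range aff0} = range aff0"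
  "{p \<in> range aff1. proj_action t p \<in> range aff1} = range aff1"
  "{p \<in> range aff0. proj_action t p \<in> range aff1} = aff0 ` (-{0})"
  "{p \<in> range aff1. proj_action t p \<in> range aff0} = aff1 ` (-{0})"
proof -
  have range: "{p \<in> range a. P p} = a ` {w. P (a w)}" for a :: "complex \<Rightarrow> (complex \<times> complex) set" and P
    by auto
  have nz: "{w. rot t * w \<noteq> 0} = -{0}" "{w. inverse (rot t) * w \<noteq> 0} = -{0}"
    by auto
  show "{p \<in> range aff0. proj_action t p \<in> range aff0} = range aff0"
    "{p \<in> range aff1. proj_action t p \<in> range aff1} = range aff1"
    "{p \<in> range aff0. proj_action t p \<in> range aff1} = aff0 ` (-{0})"
    "{p \<in> range aff1. proj_action t p \<in> range aff0} = aff1 ` (-{0})"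
    unfolding range proj_action_aff aff_mem_iff nz by auto
qed

lemma proj_coord_range [simp]:
  "proj_coord0 ` aff0 ` X = X" "proj_coord1 ` aff1 ` X = X"
  by (simp_all add: image_image)

lemma continuous_map_proj_action:
  "continuous_map (prod_topology euclideanreal proj_topology) proj_topology (\<lambda>(t, l). proj_action t l)"
proof -
  obtain k where k: "homeomorphic_maps proj_topology (top_of_set (sphere 0 1)) sphere_map k"
    using homeomorphic_map_sphere_map homeomorphic_map_maps by blast
  then have kc: "continuous_map (top_of_set (sphere 0 1)) proj_topology k"
    and ks: "\<And>l. l \<in> topspace proj_topology \<Longrightarrow> k (sphere_map l) = l"
    by (auto simp: homeomorphic_maps_def)
  define \<rho> where "\<rho> = (\<lambda>(t, a :: complex, b :: real). (rot t * a, b))"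
  have hopf: "hopf (rot t * z0, z1) = \<rho> (t, hopf (z0, z1))" for t z0 z1
    by (simp add: hopf_def \<rho>_def norm_mult mult.assoc mult.left_commute)
  have act: "sphere_map (proj_action t l) = \<rho> (t, sphere_map l)" if l: "l \<in> topspace proj_topology" for t l
  proof -
    obtain z0 z1 where "l = proj_point (z0, z1)" using l by (auto simp: topspace_proj_topology)
    then show ?thesis
      by (simp only: proj_action_proj_point sphere_map_proj_point hopf)
  qed
  have act_top: "proj_action t l \<in> topspace proj_topology" if "l \<in> topspace proj_topology" for t l
    using that by (auto simp: topspace_proj_eq proj_action_aff)
  have "continuous_on UNIV (\<lambda>x. \<rho> (fst x, snd x))"
    unfolding \<rho>_def case_prod_unfold by (intro continuous_intros)
  then have "continuous_map euclidean euclidean \<rho>" by simp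
  moreover have "continuous_map (prod_topology euclideanreal proj_topology) euclidean
      (\<lambda>x. (fst x, sphere_map (snd x)))"
    unfolding prod_topology_euclidean[where 'a=real and 'b="complex \<times> real", symmetric]
    by (intro continuous_map_pairedI continuous_map_fst
          continuous_map_compose[OF continuous_map_snd continuous_map_sphere_map, unfolded o_def])
  ultimately have "continuous_map (prod_topology euclideanreal proj_topology) euclidean
      (\<rho> \<circ> (\<lambda>x. (fst x, sphere_map (snd x))))"
    by (rule continuous_map_compose[rotated])
  then have "continuous_map (prod_topology euclideanreal proj_topology) euclidean (\<lambda>(t, l). sphere_map (proj_action t l))"
    by (rule continuous_map_eq) (auto simp: act)
  then have "continuous_map (prod_topology euclideanreal proj_topology) (top_of_set (sphere 0 1))
      (\<lambda>(t, l). sphere_map (proj_action t l))"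
    unfolding continuous_map_in_subtopology using sphere_map_image act_top by auto
  from continuous_map_compose[OF this kc] show ?thesis
    by (rule continuous_map_eq) (auto simp: ks act_top)
qed

subsection \<open>The Kaehler structure\<close>

lemma inner_mult_complex: "(d * u) \<bullet> (d * v) = (cmod d)\<^sup>2 * (u \<bullet> v)" for d u v :: complex
  unfolding cmod_power2 inner_complex_def by (simp add: power2_eq_square algebra_simps)

lemma deriv_loc_map_proj_action:
  "deriv (loc_map (range aff0) proj_coord0 proj_coord0 (proj_action t)) z = rot t"
  "deriv (loc_map (range aff1) proj_coord1 proj_coord1 (proj_action t)) z = inverse (rot t)"
  "z \<noteq> 0 \<Longrightarrow> deriv (loc_map (range aff0) proj_coord0 proj_coord1 (proj_action t)) z = - inverse (rot t * z\<^sup>2)"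
  "z \<noteq> 0 \<Longrightarrow> deriv (loc_map (range aff1) proj_coord1 proj_coord0 (proj_action t)) z = - (rot t * inverse (z\<^sup>2))"
proof -
  have "((\<lambda>z. rot t * z) has_field_derivative rot t) (at z)"
    "((\<lambda>z. inverse (rot t) * z) has_field_derivative inverse (rot t)) (at z)"
    by (rule DERIV_cmult_Id)+
  then show "deriv (loc_map (range aff0) proj_coord0 proj_coord0 (proj_action t)) z = rot t"
    "deriv (loc_map (range aff1) proj_coord1 proj_coord1 (proj_action t)) z = inverse (rot t)"
    unfolding loc_map_proj_action(1,2)[abs_def] by (simp_all only: DERIV_imp_deriv)
  assume z: "z \<noteq> 0"
  have inv: "(inverse has_field_derivative - inverse (z\<^sup>2)) (at z)"
    using DERIV_inverse[OF z, of UNIV] by (simp add: numeral_2_eq_2)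
  have "((\<lambda>z. inverse (rot t) * inverse z) has_field_derivative inverse (rot t) * - inverse (z\<^sup>2)) (at z)"
    by (rule DERIV_cmult[OF inv])
  then have "(loc_map (range aff0) proj_coord0 proj_coord1 (proj_action t) has_field_derivative
      inverse (rot t) * - inverse (z\<^sup>2)) (at z)"
    by (rule has_field_derivative_transform_within_open[where S="-{0}"])
       (use z in \<open>auto simp only: loc_map_proj_action inverse_mult_distrib open_Compl closed_singleton Compl_iff singleton_iff simp_thms\<close>)
  from DERIV_imp_deriv[OF this]
  show "deriv (loc_map (range aff0) proj_coord0 proj_coord1 (proj_action t)) z = - inverse (rot t * z\<^sup>2)"
    by (simp only: inverse_mult_distrib mult_minus_right)
  have "((\<lambda>z. rot t * inverse z) has_field_derivative rot t * - inverse (z\<^sup>2)) (at z)"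
    by (rule DERIV_cmult[OF inv])
  then have "(loc_map (range aff1) proj_coord1 proj_coord0 (proj_action t) has_field_derivative
      rot t * - inverse (z\<^sup>2)) (at z)"
    by (rule has_field_derivative_transform_within_open[where S="-{0}"])
       (use z in \<open>auto simp only: loc_map_proj_action open_Compl closed_singleton Compl_iff singleton_iff simp_thms\<close>)
  from DERIV_imp_deriv[OF this]
  show "deriv (loc_map (range aff1) proj_coord1 proj_coord0 (proj_action t)) z = - (rot t * inverse (z\<^sup>2))"
    by (simp only: mult_minus_right)
qed

lemma loc_map_proj_action_holomorphic:
  assumes "(U, \<phi>) \<in> atlas (proj_line c)" "(V, \<psi>) \<in> atlas (proj_line c)"
  shows "loc_map U \<phi> \<psi> (proj_action t) holomorphic_on \<phi> ` {p \<in> U. proj_action t p \<in> V}"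
proof -
  consider "U = range aff0" "\<phi> = proj_coord0" "V = range aff0" "\<psi> = proj_coord0"
    | "U = range aff1" "\<phi> = proj_coord1" "V = range aff1" "\<psi> = proj_coord1"
    | "U = range aff0" "\<phi> = proj_coord0" "V = range aff1" "\<psi> = proj_coord1"
    | "U = range aff1" "\<phi> = proj_coord1" "V = range aff0" "\<psi> = proj_coord0"
    using assms unfolding atlas_proj_line by auto
  then show ?thesis
  proof cases
    case 1
    show ?thesis
      unfolding 1 domain_proj_action loc_map_proj_action(1,2)[abs_def] by (intro holomorphic_intros)
  next
    case 2
    show ?thesis
      unfolding 2 domain_proj_action loc_map_proj_action(1,2)[abs_def] by (intro holomorphic_intros)
  next
    case 3
    have "(\<lambda>z. inverse (rot t * z)) holomorphic_on -{0}"
      by (intro holomorphic_intros) auto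
    then show ?thesis
      unfolding 3 domain_proj_action proj_coord_range
      by (rule holomorphic_transform) (simp only: loc_map_proj_action Compl_iff singleton_iff simp_thms)
  next
    case 4
    have "(\<lambda>z. rot t * inverse z) holomorphic_on -{0}"
      by (intro holomorphic_intros) auto
    then show ?thesis
      unfolding 4 domain_proj_action proj_coord_range
      by (rule holomorphic_transform) (simp only: loc_map_proj_action Compl_iff singleton_iff simp_thms)
  qed
qed

text \<open>The Fubini-Study metric is invariant under \<open>w \<mapsto> 1 / w\<close>, up to rotations.\<close>

lemma fubini_study_inverse:
  fixes z :: complex
  assumes "z \<noteq> 0" "cmod d = 1 / (cmod z)\<^sup>2" "cmod w = 1 / cmod z"
  shows "4 / (c * (1 + (cmod w)\<^sup>2)\<^sup>2) * ((cmod d)\<^sup>2 * x) = 4 / (c * (1 + (cmod z)\<^sup>2)\<^sup>2) * x"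
proof -
  have z: "(cmod z)\<^sup>2 \<noteq> 0" using assms(1) by simp
  have "1 + (cmod w)\<^sup>2 = (1 + (cmod z)\<^sup>2) / (cmod z)\<^sup>2"
    using z by (simp add: assms(3) power_divide add_divide_distrib)
  then show ?thesis
    using z by (simp add: assms(2) power_divide)
qed

lemma isometric_mapI:
  assumes "\<And>U \<phi> V \<psi> p u v. \<lbrakk>(U, \<phi>) \<in> atlas M; (V, \<psi>) \<in> atlas N; p \<in> U; f p \<in> V\<rbrakk> \<Longrightarrow>
    met N \<psi> (f p) (deriv (loc_map U \<phi> \<psi> f) (\<phi> p) * u) (deriv (loc_map U \<phi> \<psi> f) (\<phi> p) * v) = met M \<phi> p u v"
  shows "isometric_map M N f"
  unfolding isometric_map_def by safe (rule assms)

lemma isometric_mapD: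
  assumes "isometric_map M N f" "(U, \<phi>) \<in> atlas M" "(V, \<psi>) \<in> atlas N" "p \<in> U" "f p \<in> V"
  shows "met N \<psi> (f p) (deriv (loc_map U \<phi> \<psi> f) (\<phi> p) * u) (deriv (loc_map U \<phi> \<psi> f) (\<phi> p) * v) = met M \<phi> p u v"
  using bspec[OF bspec[OF assms(1)[unfolded isometric_map_def] assms(2), unfolded prod.case] assms(3), unfolded prod.case]
    assms(4,5) by blast

lemma holomorphic_mapI:
  assumes "continuous_map (tops M) (tops N) f"
    and "\<And>U \<phi> V \<psi>. \<lbrakk>(U, \<phi>) \<in> atlas M; (V, \<psi>) \<in> atlas N\<rbrakk> \<Longrightarrow> loc_map U \<phi> \<psi> f holomorphic_on \<phi> ` {p \<in> U. f p \<in> V}"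
  shows "holomorphic_map M N f"
  unfolding holomorphic_map_def
proof (rule conjI)
  show "\<forall>(U, \<phi>)\<in>atlas M. \<forall>(V, \<psi>)\<in>atlas N. loc_map U \<phi> \<psi> f holomorphic_on \<phi> ` {p \<in> U. f p \<in> V}"
    by safe (rule assms(2))
qed (rule assms(1))

lemma holomorphic_mapD:
  assumes "holomorphic_map M N f" "(U, \<phi>) \<in> atlas M" "(V, \<psi>) \<in> atlas N"
  shows "loc_map U \<phi> \<psi> f holomorphic_on \<phi> ` {p \<in> U. f p \<in> V}"
  using bspec[OF bspec[OF conjunct2[OF assms(1)[unfolded holomorphic_map_def]] assms(2), unfolded prod.case] assms(3), unfolded prod.case] .

lemma proj_action_isometric: "isometric_map (proj_line c) (proj_line c) (proj_action t)"
proof (rule isometric_mapI)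
  fix U \<phi> V \<psi> p u v
  assume U: "(U, \<phi>) \<in> atlas (proj_line c)" and V: "(V, \<psi>) \<in> atlas (proj_line c)"
    and p: "p \<in> U" "proj_action t p \<in> V"
  consider "U = range aff0" "\<phi> = proj_coord0" "V = range aff0" "\<psi> = proj_coord0"
    | "U = range aff1" "\<phi> = proj_coord1" "V = range aff1" "\<psi> = proj_coord1"
    | "U = range aff0" "\<phi> = proj_coord0" "V = range aff1" "\<psi> = proj_coord1"
    | "U = range aff1" "\<phi> = proj_coord1" "V = range aff0" "\<psi> = proj_coord0"
    using U V unfolding atlas_proj_line by auto
  then show "met (proj_line c) \<psi> (proj_action t p) (deriv (loc_map U \<phi> \<psi> (proj_action t)) (\<phi> p) * u)
      (deriv (loc_map U \<phi> \<psi> (proj_action t)) (\<phi> p) * v) = met (proj_line c) \<phi> p u v"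
  proof cases
    case 1
    then obtain z where z: "p = aff0 z" using p by auto
    show ?thesis
      unfolding met_proj_line inner_mult_complex 1 z proj_coord_aff deriv_loc_map_proj_action proj_action_aff
      by (simp only: norm_mult norm_rot) simp
  next
    case 2
    then obtain z where z: "p = aff1 z" using p by auto
    show ?thesis
      unfolding met_proj_line inner_mult_complex 2 z proj_coord_aff deriv_loc_map_proj_action proj_action_aff
      by (simp only: norm_mult norm_rot norm_inverse) simp
  next
    case 3
    then obtain z where z: "p = aff0 z" using p by auto
    then have nz: "z \<noteq> 0" "rot t * z \<noteq> 0"
      using p unfolding 3 z proj_action_aff aff_mem_iff by auto
    show ?thesis
      unfolding met_proj_line inner_mult_complex 3 z proj_coord_aff deriv_loc_map_proj_action(3)[OF nz(1)]
        proj_action_aff aff0_conv_aff1[OF nz(2)]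
      by (rule fubini_study_inverse[OF nz(1)])
         (simp_all only: norm_mult norm_rot norm_inverse norm_minus_cancel norm_power mult_1_left divide_inverse)
  next
    case 4
    then obtain z where z: "p = aff1 z" using p by auto
    then have nz: "z \<noteq> 0" "inverse (rot t) * z \<noteq> 0"
      using p unfolding 4 z proj_action_aff aff_mem_iff by auto
    show ?thesis
      unfolding met_proj_line inner_mult_complex 4 z proj_coord_aff deriv_loc_map_proj_action(4)[OF nz(1)]
        proj_action_aff aff1_conv_aff0[OF nz(2)]
      by (rule fubini_study_inverse[OF nz(1)])
         (simp_all only: norm_mult norm_rot norm_inverse norm_minus_cancel norm_power mult_1_left inverse_1 divide_inverse)
  qed
qed

lemma Ck_on_fubini_study: "Ck_on k (\<lambda>z. d / (1 + (cmod z)\<^sup>2)\<^sup>2) UNIV"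
proof -
  define n :: "complex \<Rightarrow> real" where "n z = 1 + (Re z * Re z + Im z * Im z)" for z
  have n: "1 + (cmod z)\<^sup>2 = n z" for z
    by (simp only: n_def cmod_power2) (simp only: power2_eq_square)
  have nz: "n z \<noteq> 0" for z
    unfolding n_def by (smt (verit) zero_le_square)
  have "Ck_on k n UNIV"
    unfolding n_def
    by (intro Ck_on_add Ck_on_mult Ck_on_const open_UNIV Ck_on_bounded_linear[OF bounded_linear_Re]
          Ck_on_bounded_linear[OF bounded_linear_Im])
  then have "Ck_on k (\<lambda>z. d * inverse (n z * n z)) UNIV"
    by (intro Ck_on_mult Ck_on_const open_UNIV Ck_on_inverse) (use nz in auto)
  then show ?thesis
    unfolding n divide_inverse unfolding power2_eq_square .
qed

lemma loc_met_proj_line: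
  assumes "(U, \<phi>) \<in> atlas (proj_line c)"
  shows "loc_met (proj_line c) U \<phi> z u v = (4 / c * (u \<bullet> v)) / (1 + (cmod z)\<^sup>2)\<^sup>2"
  using assms unfolding loc_met_def met_proj_line atlas_proj_line by auto

lemma linear_complex_real:
  fixes L :: "complex \<Rightarrow> real"
  assumes "linear L" shows "L v = Re v * L 1 + Im v * L \<i>"
proof -
  have "v = Re v *\<^sub>R 1 + Im v *\<^sub>R \<i>" by (simp add: complex_eq_iff)
  then have "L v = L (Re v *\<^sub>R 1 + Im v *\<^sub>R \<i>)" by simp
  then show ?thesis by (simp add: linear_add[OF assms] linear_scale[OF assms])
qed

text \<open>The left-hand side is alternating in three vectors of a plane.\<close>

lemma kahler_form_closed_dim1:
  fixes u v w :: complex and L :: "complex \<Rightarrow> real"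
  assumes "linear L"
  shows "L u * ((\<i> * v) \<bullet> w) + L v * ((\<i> * w) \<bullet> u) + L w * ((\<i> * u) \<bullet> v) = 0"
  unfolding linear_complex_real[OF assms, of u] linear_complex_real[OF assms, of v] linear_complex_real[OF assms, of w]
  by (simp add: inner_complex_def algebra_simps)

lemma kahler_manifold_proj_line:
  assumes c: "c > 0"
  shows "kahler_manifold (proj_line c)"
proof
  show "Hausdorff_space (tops (proj_line c))" "second_countable (tops (proj_line c))"
    unfolding tops_proj_line by (rule Hausdorff_proj_topology second_countable_proj_topology)+
  have "range aff0 \<union> range aff1 = topspace proj_topology"
    unfolding topspace_proj_eq using topspace_proj_eq aff_in_topspace by auto
  then show "pts (proj_line c) = (\<Union>(U, \<phi>)\<in>atlas (proj_line c). U)"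
    unfolding tops_proj_line atlas_proj_line by simp
  show "openin (tops (proj_line c)) U \<and> open (\<phi> ` U) \<and>
      homeomorphic_map (subtopology (tops (proj_line c)) U) (top_of_set (\<phi> ` U)) \<phi>"
    if "(U, \<phi>) \<in> atlas (proj_line c)" for U \<phi>
    unfolding tops_proj_line using proj_line_chart[OF that] .
  show "loc_map U \<phi> \<psi> id holomorphic_on \<phi> ` (U \<inter> V)"
    if "(U, \<phi>) \<in> atlas (proj_line c)" "(V, \<psi>) \<in> atlas (proj_line c)" for U \<phi> V \<psi>
    using loc_map_proj_action_holomorphic[OF that, of 0] unfolding proj_action_0 id_apply Collect_conj_eq Collect_mem_eq .
  show "met (proj_line c) \<psi> p (deriv (loc_map U \<phi> \<psi> id) (\<phi> p) * u) (deriv (loc_map U \<phi> \<psi> id) (\<phi> p) * v)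
      = met (proj_line c) \<phi> p u v"
    if "(U, \<phi>) \<in> atlas (proj_line c)" "(V, \<psi>) \<in> atlas (proj_line c)" "p \<in> U \<inter> V" for U \<phi> V \<psi> p u v
    using isometric_mapD[OF proj_action_isometric[of c 0, unfolded proj_action_0] that(1,2)] that(3) by simp
  have pos: "4 / (c * (1 + (cmod z)\<^sup>2)\<^sup>2) > 0" for z
  proof -
    have "1 + (cmod z)\<^sup>2 > 0" by (rule add_pos_nonneg) simp_all
    then show ?thesis using c by simp
  qed
  show "bilinear (met (proj_line c) \<phi> p)" for \<phi> p
    unfolding met_proj_line bilinear_def
    by (auto intro!: linearI simp: inner_add_left inner_add_right distrib_left mult.left_commute add_divide_distrib)
  show "met (proj_line c) \<phi> p u v = met (proj_line c) \<phi> p v u" for \<phi> p u v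
    unfolding met_proj_line by (simp add: inner_commute)
  show "met (proj_line c) \<phi> p u u > 0" if "u \<noteq> 0" for \<phi> p u
    unfolding met_proj_line using that by (intro mult_pos_pos pos) simp
  show "met (proj_line c) \<phi> p (\<i> * u) (\<i> * v) = met (proj_line c) \<phi> p u v" for \<phi> p u v
    unfolding met_proj_line inner_mult_complex by simp
  show "smooth_on (\<lambda>z. loc_met (proj_line c) U \<phi> z u v) (\<phi> ` U)"
    if U: "(U, \<phi>) \<in> atlas (proj_line c)" for U \<phi> u v
  proof -
    have "\<phi> ` U = UNIV" using U unfolding atlas_proj_line by auto
    then show ?thesis
      unfolding loc_met_proj_line[OF U] smooth_on_def by (simp only:) (intro allI Ck_on_fubini_study)
  qed
  show "frechet_derivative (\<lambda>z. loc_form (proj_line c) U \<phi> z v w) (at z) u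
       + frechet_derivative (\<lambda>z. loc_form (proj_line c) U \<phi> z w u) (at z) v
       + frechet_derivative (\<lambda>z. loc_form (proj_line c) U \<phi> z u v) (at z) w = 0"
    if U: "(U, \<phi>) \<in> atlas (proj_line c)" for U \<phi> u v w z
  proof -
    define L where "L = frechet_derivative (\<lambda>z. (4 / c) / (1 + (cmod z)\<^sup>2)\<^sup>2) (at z)"
    have L: "((\<lambda>z. (4 / c) / (1 + (cmod z)\<^sup>2)\<^sup>2) has_derivative L) (at z)"
      unfolding L_def by (rule Ck_on_Suc_has_derivative[OF Ck_on_fubini_study UNIV_I])
    have form: "frechet_derivative (\<lambda>z. loc_form (proj_line c) U \<phi> z a b) (at z) = (\<lambda>h. L h * ((\<i> * a) \<bullet> b))" for a b
    proof -
      have eq: "loc_form (proj_line c) U \<phi> z a b = (4 / c) / (1 + (cmod z)\<^sup>2)\<^sup>2 * ((\<i> * a) \<bullet> b)" for z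
        unfolding loc_form_def loc_met_proj_line[OF U] by simp
      have "((\<lambda>z. (4 / c) / (1 + (cmod z)\<^sup>2)\<^sup>2 * ((\<i> * a) \<bullet> b)) has_derivative (\<lambda>h. L h * ((\<i> * a) \<bullet> b))) (at z)"
        by (rule has_derivative_mult_left[OF L])
      from frechet_derivative_at[OF this] show ?thesis
        unfolding eq by (rule sym)
    qed
    show ?thesis
      unfolding form by (rule kahler_form_closed_dim1[OF has_derivative_linear[OF L]])
  qed
qed

subsection \<open>The torus action\<close>

lemma proj_action_add: "proj_action (s + t) l = proj_action s (proj_action t l)"
  if "l \<in> topspace proj_topology"
proof -
  have rot: "rot (s + t) = rot s * rot t"
    by (simp only: of_real_add distrib_left exp_add)
  from that show ?thesis
  proof (cases rule: aff_cases)
    case (1 w)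
    show ?thesis
      unfolding 1 proj_action_aff aff0_eq_iff rot by (rule mult.assoc)
  qed (simp only: proj_action_aff mult_zero_right)
qed

lemma rot_eq_1_iff: "rot t = 1 \<longleftrightarrow> t \<in> \<int>"
proof -
  have "rot t = 1 \<longleftrightarrow> (\<exists>n::int. 2 * pi * t = of_int (2 * n) * pi)"
    unfolding exp_eq_1 by simp
  also have "\<dots> \<longleftrightarrow> (\<exists>n::int. t = of_int n)"
    by simp
  also have "\<dots> \<longleftrightarrow> t \<in> \<int>"
    by (auto elim!: Ints_cases)
  finally show ?thesis .
qed

lemma free_points_proj_action: "free_points (proj_line c) proj_action = aff0 ` (-{0})"
proof (intro equalityI subsetI)
  fix l assume l: "l \<in> free_points (proj_line c) proj_action"
  have half: "(1/2 :: real) \<notin> \<int>"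
    using rot_eq_1_iff[of "1/2"] by simp
  have "l \<noteq> aff0 0" "l \<noteq> aff1 0"
    using l half by (auto simp only: free_points_def proj_action_aff mult_zero_right)
  moreover have "l \<in> topspace proj_topology"
    using l by (simp add: free_points_def tops_proj_line)
  ultimately show "l \<in> aff0 ` (-{0})"
    by (auto elim: aff_cases)
next
  fix l assume "l \<in> aff0 ` (-{0})"
  then obtain w where w: "w \<noteq> 0" "l = aff0 w" by auto
  have "t \<in> \<int>" if "proj_action t l = l" for t
  proof -
    have "rot t * w = 1 * w"
      using that unfolding w proj_action_aff aff0_eq_iff mult_1_left .
    from mult_right_cancel[OF w(1), THEN iffD1, OF this] show ?thesis by (simp only: rot_eq_1_iff)
  qed
  then show "l \<in> free_points (proj_line c) proj_action"
    by (simp add: free_points_def tops_proj_line w)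
qed

lemma smooth_loc_map_proj_action:
  assumes "(U, \<phi>) \<in> atlas (proj_line c)" "(V, \<psi>) \<in> atlas (proj_line c)"
  shows "smooth_on (\<lambda>(t, z). loc_map U \<phi> \<psi> (proj_action t) z) {(t, \<phi> p) |t p. p \<in> U \<and> proj_action t p \<in> V}"
  unfolding smooth_on_def
proof
  fix k
  have dom: "{(t, \<phi> p) |t p. p \<in> U \<and> proj_action t p \<in> V} = S"
    if T: "\<And>t. \<phi> ` {p \<in> U. proj_action t p \<in> V} = T" and S: "S = UNIV \<times> T" for S and T :: "complex set"
  proof (intro equalityI subsetI)
    fix x assume "x \<in> {(t, \<phi> p) |t p. p \<in> U \<and> proj_action t p \<in> V}"
    then obtain t p where "x = (t, \<phi> p)" "p \<in> U" "proj_action t p \<in> V" by blast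
    then show "x \<in> S" using T[of t] S by blast
  next
    fix x assume "x \<in> S"
    then obtain t z where x: "x = (t, z)" "z \<in> T" using S by auto
    then have "z \<in> \<phi> ` {p \<in> U. proj_action t p \<in> V}" using T[of t] by simp
    then show "x \<in> {(t, \<phi> p) |t p. p \<in> U \<and> proj_action t p \<in> V}" using x by blast
  qed
  have op: "open (UNIV :: (real \<times> complex) set)" "open (UNIV \<times> (-{0}) :: (real \<times> complex) set)"
    by (auto intro!: open_Times)
  have snd: "Ck_on k snd S" if "open S" for S :: "(real \<times> complex) set"
    by (rule Ck_on_bounded_linear[OF bounded_linear_snd that])
  have rot: "Ck_on k (\<lambda>x. rot (fst x)) S" if "open S" for S :: "(real \<times> complex) set"
    by (intro Ck_on_exp[OF that] Ck_on_bounded_linear[OF _ that] bounded_linear_compose[OF bounded_linear_mult_right]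
      bounded_linear_compose[OF bounded_linear_of_real] bounded_linear_fst)
  consider "U = range aff0" "\<phi> = proj_coord0" "V = range aff0" "\<psi> = proj_coord0"
    | "U = range aff1" "\<phi> = proj_coord1" "V = range aff1" "\<psi> = proj_coord1"
    | "U = range aff0" "\<phi> = proj_coord0" "V = range aff1" "\<psi> = proj_coord1"
    | "U = range aff1" "\<phi> = proj_coord1" "V = range aff0" "\<psi> = proj_coord0"
    using assms unfolding atlas_proj_line by auto
  then show "Ck_on k (\<lambda>(t, z). loc_map U \<phi> \<psi> (proj_action t) z) {(t, \<phi> p) |t p. p \<in> U \<and> proj_action t p \<in> V}"
  proof cases
    case 1
    have D: "{(t, \<phi> p) |t p. p \<in> U \<and> proj_action t p \<in> V} = UNIV"
      by (rule dom[of UNIV]) (simp_all only: 1 domain_proj_action proj_coord_range UNIV_Times_UNIV)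
    have "Ck_on k (\<lambda>x. rot (fst x) * snd x) (UNIV :: (real \<times> complex) set)"
      by (rule Ck_on_mult[OF op(1) rot[OF op(1)] snd[OF op(1)]])
    then show ?thesis
      unfolding D unfolding 1 loc_map_proj_action(1) case_prod_unfold .
  next
    case 2
    have D: "{(t, \<phi> p) |t p. p \<in> U \<and> proj_action t p \<in> V} = UNIV"
      by (rule dom[of UNIV]) (simp_all only: 2 domain_proj_action proj_coord_range UNIV_Times_UNIV)
    have "Ck_on k (\<lambda>x. inverse (rot (fst x)) * snd x) (UNIV :: (real \<times> complex) set)"
      by (rule Ck_on_mult[OF op(1) Ck_on_inverse[OF op(1) rot[OF op(1)]] snd[OF op(1)]]) (rule exp_not_eq_zero)
    then show ?thesis
      unfolding D unfolding 2 loc_map_proj_action(2) case_prod_unfold .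
  next
    case 3
    have D: "{(t, \<phi> p) |t p. p \<in> U \<and> proj_action t p \<in> V} = UNIV \<times> (-{0})"
      by (rule dom[of "-{0}"]) (simp_all only: 3 domain_proj_action proj_coord_range)
    have "Ck_on k (\<lambda>x. inverse (rot (fst x) * snd x)) (UNIV \<times> (-{0}) :: (real \<times> complex) set)"
      by (rule Ck_on_inverse[OF op(2) Ck_on_mult[OF op(2) rot[OF op(2)] snd[OF op(2)]]]) auto
    then show ?thesis
      unfolding D by (rule Ck_on_cong[OF op(2), rotated]) (auto simp only: 3 loc_map_proj_action(3) Compl_iff singleton_iff simp_thms mem_Times_iff prod.case fst_conv snd_conv)
  next
    case 4
    have D: "{(t, \<phi> p) |t p. p \<in> U \<and> proj_action t p \<in> V} = UNIV \<times> (-{0})"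
      by (rule dom[of "-{0}"]) (simp_all only: 4 domain_proj_action proj_coord_range)
    have "Ck_on k (\<lambda>x. rot (fst x) * inverse (snd x)) (UNIV \<times> (-{0}) :: (real \<times> complex) set)"
      by (rule Ck_on_mult[OF op(2) rot[OF op(2)] Ck_on_inverse[OF op(2) snd[OF op(2)]]]) auto
    then show ?thesis
      unfolding D by (rule Ck_on_cong[OF op(2), rotated]) (auto simp only: 4 loc_map_proj_action(4) Compl_iff singleton_iff simp_thms mem_Times_iff prod.case fst_conv snd_conv)
  qed
qed

lemma torus_action_proj_line:
  assumes "c > 0"
  shows "torus_action (proj_line c) proj_action"
proof (intro torus_action.intro torus_action_axioms.intro kahler_manifold_proj_line[OF assms])
  show "proj_action 0 p = p" for p by (simp add: proj_action_0)
  have rot_1: "rot 1 = 1" using rot_eq_1_iff[of 1] by simp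
  show "proj_action 1 p = p" if "p \<in> pts (proj_line c)" for p
    using that unfolding tops_proj_line
    by (cases rule: aff_cases) (simp_all only: proj_action_aff rot_1 mult_1_left inverse_1)
  show "proj_action (s + t) p = proj_action s (proj_action t p)" if "p \<in> pts (proj_line c)" for p s t
    using that unfolding tops_proj_line by (rule proj_action_add)
  show cont: "continuous_map (prod_topology euclideanreal (tops (proj_line c))) (tops (proj_line c)) (\<lambda>(t, p). proj_action t p)"
    unfolding tops_proj_line by (rule continuous_map_proj_action)
  show "smooth_on (\<lambda>(t, z). loc_map U \<phi> \<psi> (proj_action t) z) {(t, \<phi> p) |t p. p \<in> U \<and> proj_action t p \<in> V}"
    if "(U, \<phi>) \<in> atlas (proj_line c)" "(V, \<psi>) \<in> atlas (proj_line c)" for U \<phi> V \<psi>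
    by (rule smooth_loc_map_proj_action[OF that])
  show "holomorphic_map (proj_line c) (proj_line c) (proj_action t)" for t
  proof (rule holomorphic_mapI[OF _ loc_map_proj_action_holomorphic])
    have "continuous_map proj_topology (prod_topology euclideanreal proj_topology) (\<lambda>p. (t, p))"
      by (intro continuous_map_pairedI) simp_all
    from continuous_map_compose[OF this continuous_map_proj_action]
    show "continuous_map (tops (proj_line c)) (tops (proj_line c)) (proj_action t)"
      by (simp add: tops_proj_line o_def)
  qed
  show "isometric_map (proj_line c) (proj_line c) (proj_action t)" for t
    by (rule proj_action_isometric)
  show "t \<in> \<int>" if "\<And>p. p \<in> pts (proj_line c) \<Longrightarrow> proj_action t p = p" for t
  proof -
    have "proj_action t (aff0 1) = aff0 1" by (rule that) (simp add: tops_proj_line)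
    then show ?thesis
      by (simp only: proj_action_aff aff0_eq_iff mult_1_right rot_eq_1_iff)
  qed
qed

section \<open>Lengths of curves on the projective line\<close>

lemma has_derivative_hopf_affine:
  fixes w :: complex
  defines "n \<equiv> w \<bullet> w + 1"
  shows "((\<lambda>w. hopf (w, 1)) has_derivative
    (\<lambda>v. ((2 / n) *\<^sub>R v - (4 * (w \<bullet> v) / n\<^sup>2) *\<^sub>R w, 4 * (w \<bullet> v) / n\<^sup>2))) (at w)"
proof -
  have n: "n \<noteq> 0"
    unfolding n_def by (smt (verit) inner_ge_zero)
  have "hopf (w, 1) = (inverse (w \<bullet> w + 1) *\<^sub>R (2 *\<^sub>R w), 1 - 2 * inverse (w \<bullet> w + 1))" for w
  proof -
    have "w \<bullet> w + 1 \<noteq> 0" by (smt (verit) inner_ge_zero)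
    then show ?thesis
      by (simp add: hopf_affine power2_norm_eq_inner scaleR_conv_of_real field_simps del: inner_complex_def)
  qed
  then have eq: "(\<lambda>w. hopf (w, 1)) = (\<lambda>w. (inverse (w \<bullet> w + 1) *\<^sub>R (2 *\<^sub>R w), 1 - 2 * inverse (w \<bullet> w + 1)))"
    by (rule ext)
  have d: "((\<lambda>w. inverse (w \<bullet> w + 1)) has_derivative (\<lambda>v. - (2 * (w \<bullet> v)) / n\<^sup>2)) (at w)"
    using n unfolding n_def
    by (auto intro!: derivative_eq_intros simp: power2_eq_square inner_commute divide_inverse)
  show ?thesis
    unfolding eq
  proof (intro has_derivative_Pair)
    show "((\<lambda>w. inverse (w \<bullet> w + 1) *\<^sub>R 2 *\<^sub>R w) has_derivative
        (\<lambda>v. (2 / n) *\<^sub>R v - (4 * (w \<bullet> v) / n\<^sup>2) *\<^sub>R w)) (at w)"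
      by (rule has_derivative_eq_rhs[OF has_derivative_scaleR[OF d has_derivative_scaleR_right[OF has_derivative_ident]]])
         (auto simp: n_def divide_inverse mult_ac)
    show "((\<lambda>w. 1 - 2 * inverse (w \<bullet> w + 1)) has_derivative (\<lambda>v. 4 * (w \<bullet> v) / n\<^sup>2)) (at w)"
      by (rule has_derivative_eq_rhs[OF has_derivative_diff[OF has_derivative_const has_derivative_mult_right[OF d]]])
         auto
  qed
qed

lemma power2_norm_scaled_diff:
  fixes v w :: "'a::real_inner"
  shows "(norm (\<alpha> *\<^sub>R v - \<beta> *\<^sub>R w))\<^sup>2 = \<alpha>\<^sup>2 * (v \<bullet> v) - 2 * \<alpha> * \<beta> * (w \<bullet> v) + \<beta>\<^sup>2 * (w \<bullet> w)"
  unfolding power2_norm_eq_inner inner_diff_left inner_diff_right inner_scaleR_left inner_scaleR_right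
    inner_commute[of v w] by algebra

text \<open>The inverse stereographic projection is an isometry from the Fubini-Study metric of curvature \<open>1\<close>
  to the unit sphere.\<close>

lemma norm_derivative_hopf_affine:
  fixes w v :: complex
  defines "n \<equiv> w \<bullet> w + 1"
  shows "norm ((2 / n) *\<^sub>R v - (4 * (w \<bullet> v) / n\<^sup>2) *\<^sub>R w, 4 * (w \<bullet> v) / n\<^sup>2) = 2 * cmod v / (1 + (cmod w)\<^sup>2)"
proof -
  have n: "n > 0"
    unfolding n_def by (smt (verit) inner_ge_zero)
  define \<alpha> \<beta> where "\<alpha> = 2 / n" and "\<beta> = 4 * (w \<bullet> v) / n\<^sup>2"
  have ww: "w \<bullet> w = n - 1" by (simp add: n_def)
  have \<beta>: "\<beta> * n = 2 * \<alpha> * (w \<bullet> v)"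
    using n by (simp add: \<alpha>_def \<beta>_def power2_eq_square)
  have "(norm (\<alpha> *\<^sub>R v - \<beta> *\<^sub>R w))\<^sup>2 + \<beta>\<^sup>2 = \<alpha>\<^sup>2 * (v \<bullet> v) + \<beta> * (\<beta> * n - 2 * \<alpha> * (w \<bullet> v))"
    unfolding power2_norm_scaled_diff ww by algebra
  then have "(norm (\<alpha> *\<^sub>R v - \<beta> *\<^sub>R w))\<^sup>2 + \<beta>\<^sup>2 = \<alpha>\<^sup>2 * (cmod v)\<^sup>2"
    by (simp add: \<beta> power2_norm_eq_inner)
  moreover have "1 + (cmod w)\<^sup>2 = n"
    unfolding n_def power2_norm_eq_inner by (rule add.commute)
  then have "2 * cmod v / (1 + (cmod w)\<^sup>2) = \<alpha> * cmod v"
    by (simp only: \<alpha>_def times_divide_eq_left)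
  moreover have "\<alpha> * cmod v \<ge> 0" using n by (simp add: \<alpha>_def)
  ultimately show ?thesis
    unfolding \<alpha>_def[symmetric] \<beta>_def[symmetric] norm_Pair real_norm_def power2_abs
    by (simp add: real_sqrt_unique power_mult_distrib)
qed

lemma hopf_antiaffine_conv_affine: "hopf (1, w) = (cnj (fst (hopf (w, 1))), - snd (hopf (w, 1)))"
  by (simp add: hopf_def add.commute minus_divide_left)

text \<open>What the estimates of lengths use of a chart \<open>\<phi>\<close>: its inverse \<open>a\<close>; a differentiable map \<open>st\<close> on an open
  subset \<open>V\<close> of the ambient space of the sphere with \<open>\<phi> = st \<circ> sphere_map\<close>; and the derivative \<open>H'\<close> of
  the parametrization of the sphere by \<open>a\<close>. Both charts have them, so no case distinction is needed later.\<close>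

lemma proj_chart_data:
  assumes "(U, \<phi>) \<in> atlas (proj_line c)"
  obtains a V st H' where
    "U = range a" "\<And>w. \<phi> (a w) = w"
    "open V" "\<And>l. l \<in> topspace proj_topology \<Longrightarrow> sphere_map l \<in> V \<longleftrightarrow> l \<in> U"
    "\<And>s. s \<in> V \<Longrightarrow> st differentiable (at s)" "\<And>w. st (sphere_map (a w)) = w"
    "\<And>w. ((\<lambda>w. sphere_map (a w)) has_derivative H' w) (at w)"
    "\<And>w v. norm (H' w v) = 2 * cmod v / (1 + (cmod w)\<^sup>2)"
    "a = aff0 \<or> a = aff1"
proof -
  consider "U = range aff0" "\<phi> = proj_coord0" | "U = range aff1" "\<phi> = proj_coord1"
    using assms unfolding atlas_proj_line by auto
  then show ?thesis
  proof cases
    case 1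
    define H' where "H' w v = ((2 / (w \<bullet> w + 1)) *\<^sub>R v - (4 * (w \<bullet> v) / (w \<bullet> w + 1)\<^sup>2) *\<^sub>R w,
      4 * (w \<bullet> v) / (w \<bullet> w + 1)\<^sup>2)" for w v :: complex
    show ?thesis
    proof (rule that[of aff0 "UNIV \<times> -{1}" "\<lambda>s. inverse (1 - snd s) *\<^sub>R fst s" H'])
      show "sphere_map l \<in> UNIV \<times> -{1} \<longleftrightarrow> l \<in> U" if "l \<in> topspace proj_topology" for l
        using that unfolding topspace_proj_eq 1
        using hopf_affine_stereographic(1) by (auto simp: sphere_map_aff hopf_infinity mem_Times_iff)
      show "(\<lambda>s. inverse (1 - snd s) *\<^sub>R fst s) differentiable at s" if "s \<in> UNIV \<times> -{1}"
        for s :: "complex \<times> real"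
      proof -
        have "1 - snd s \<noteq> 0" using that by (auto simp: mem_Times_iff)
        then show ?thesis
          by (intro differentiable_scaleR differentiable_inverse differentiable_diff differentiable_const
                bounded_linear_imp_differentiable[OF bounded_linear_fst] bounded_linear_imp_differentiable[OF bounded_linear_snd])
      qed
      show "inverse (1 - snd (sphere_map (aff0 w))) *\<^sub>R fst (sphere_map (aff0 w)) = w" for w
        using hopf_affine_stereographic(2)[of w] unfolding sphere_map_aff
        by (simp add: scaleR_conv_of_real divide_inverse mult.commute)
      show "((\<lambda>w. sphere_map (aff0 w)) has_derivative H' w) (at w)" for w
        unfolding sphere_map_aff H'_def by (rule has_derivative_hopf_affine)
      show "norm (H' w v) = 2 * cmod v / (1 + (cmod w)\<^sup>2)" for w v
        unfolding H'_def by (rule norm_derivative_hopf_affine)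
    qed (use 1 in \<open>auto intro!: open_Times\<close>)
  next
    case 2
    define R where "R s = (cnj (fst s), - snd s)" for s :: "complex \<times> real"
    have R: "bounded_linear R"
      unfolding R_def
      by (intro bounded_linear_Pair bounded_linear_compose[OF bounded_linear_cnj] bounded_linear_minus
            bounded_linear_fst bounded_linear_snd)
    have normR: "norm (R s) = norm s" for s
      by (cases s) (simp add: R_def norm_Pair)
    define H' where "H' w v = R ((2 / (w \<bullet> w + 1)) *\<^sub>R v - (4 * (w \<bullet> v) / (w \<bullet> w + 1)\<^sup>2) *\<^sub>R w,
      4 * (w \<bullet> v) / (w \<bullet> w + 1)\<^sup>2)" for w v :: complex
    have hopf0: "hopf (0, 1) = (0, -1)" by (simp add: hopf_def)
    show ?thesis
    proof (rule that[of aff1 "UNIV \<times> -{-1}" "\<lambda>s. inverse (1 + snd s) *\<^sub>R cnj (fst s)" H'])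
      show "sphere_map l \<in> UNIV \<times> -{-1} \<longleftrightarrow> l \<in> U" if "l \<in> topspace proj_topology" for l
        using that unfolding topspace_proj_eq' 2
        using hopf_antiaffine_stereographic(1) by (auto simp: sphere_map_aff hopf0 mem_Times_iff)
      show "(\<lambda>s. inverse (1 + snd s) *\<^sub>R cnj (fst s)) differentiable at s" if "s \<in> UNIV \<times> -{-1}"
        for s :: "complex \<times> real"
      proof -
        have "1 + snd s \<noteq> 0" using that by (auto simp: mem_Times_iff)
        then show ?thesis
          by (intro differentiable_scaleR differentiable_inverse differentiable_add differentiable_const
                bounded_linear_imp_differentiable[OF bounded_linear_compose[OF bounded_linear_cnj bounded_linear_fst]]
                bounded_linear_imp_differentiable[OF bounded_linear_snd])
      qed
      show "inverse (1 + snd (sphere_map (aff1 w))) *\<^sub>R cnj (fst (sphere_map (aff1 w))) = w" for w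
        using hopf_antiaffine_stereographic(2)[of w] unfolding sphere_map_aff
        by (simp add: scaleR_conv_of_real divide_inverse mult.commute)
      show "((\<lambda>w. sphere_map (aff1 w)) has_derivative H' w) (at w)" for w
        unfolding sphere_map_aff H'_def hopf_antiaffine_conv_affine R_def[symmetric]
        by (rule bounded_linear.has_derivative[OF R has_derivative_hopf_affine])
      show "norm (H' w v) = 2 * cmod v / (1 + (cmod w)\<^sup>2)" for w v
        unfolding H'_def normR by (rule norm_derivative_hopf_affine)
    qed (use 2 in \<open>auto intro!: open_Times\<close>)
  qed
qed

lemma proj_line_charts_cover:
  assumes "l \<in> topspace proj_topology"
  obtains U \<phi> where "(U, \<phi>) \<in> atlas (proj_line c)" "l \<in> U"
proof -
  from assms show ?thesis
  proof (cases rule: aff_cases)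
    case (1 w)
    then show ?thesis using that[of "range aff0" proj_coord0] by (simp add: atlas_proj_line)
  next
    case 2
    then show ?thesis using that[of "range aff1" proj_coord1] by (simp add: atlas_proj_line)
  qed
qed

text \<open>The chart in the definition of the speed is an arbitrary one and may change from one parameter to
  the next.\<close>

lemma speed_cases:
  assumes "\<gamma> t \<in> topspace proj_topology"
  obtains U \<phi> where "(U, \<phi>) \<in> atlas (proj_line c)" "\<gamma> t \<in> U"
    "speed (proj_line c) \<gamma> t = sqrt (met (proj_line c) \<phi> (\<gamma> t)
      (vector_derivative (\<phi> \<circ> \<gamma>) (at t)) (vector_derivative (\<phi> \<circ> \<gamma>) (at t)))"
proof -
  define X where "X = (SOME (U, \<phi>). (U, \<phi>) \<in> atlas (proj_line c) \<and> \<gamma> t \<in> U)"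
  obtain U \<phi> where U: "X = (U, \<phi>)" by (cases X)
  obtain U' \<phi>' where "(U', \<phi>') \<in> atlas (proj_line c)" "\<gamma> t \<in> U'"
    using proj_line_charts_cover[OF assms] .
  then have "\<exists>x. (case x of (U, \<phi>) \<Rightarrow> (U, \<phi>) \<in> atlas (proj_line c) \<and> \<gamma> t \<in> U)"
    by (intro exI[of _ "(U', \<phi>')"]) simp
  from someI_ex[OF this] have "(U, \<phi>) \<in> atlas (proj_line c)" "\<gamma> t \<in> U"
    unfolding X_def[symmetric] U by auto
  then show ?thesis
    by (rule that) (simp add: speed_def X_def[symmetric] U Let_def)
qed

lemma sqrt_met_proj_line:
  assumes "c > 0"
  shows "sqrt (met (proj_line c) \<phi> l v v) = 2 / sqrt c * cmod v / (1 + (cmod (\<phi> l))\<^sup>2)"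
proof -
  have "met (proj_line c) \<phi> l v v = (2 / sqrt c * cmod v / (1 + (cmod (\<phi> l))\<^sup>2))\<^sup>2"
    using assms by (simp add: met_proj_line power_divide power_mult_distrib dot_square_norm)
  moreover have "2 / sqrt c * cmod v / (1 + (cmod (\<phi> l))\<^sup>2) \<ge> 0"
    using assms by (simp add: add_nonneg_nonneg)
  ultimately show ?thesis by (simp only: real_sqrt_abs abs_of_nonneg)
qed

lemma pathin_eventually_in:
  assumes "pathin X \<gamma>" "t \<in> {0<..<1}" "openin X U" "\<gamma> t \<in> U"
  shows "\<forall>\<^sub>F s in nhds t. s \<in> {0<..<1} \<and> \<gamma> s \<in> U"
proof -
  have "openin (top_of_set {0..1}) {s \<in> topspace (top_of_set {0..1}). \<gamma> s \<in> U}"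
    using assms(1,3) unfolding pathin_def by (rule openin_continuous_map_preimage)
  then have "openin (top_of_set {0..1}) {s \<in> {0..1}. \<gamma> s \<in> U}"
    by (simp only: topspace_euclidean_subtopology)
  then obtain T where T: "open T" "{s \<in> {0..1}. \<gamma> s \<in> U} = {0..1} \<inter> T"
    unfolding openin_open by blast
  have "t \<in> {s \<in> {0..1}. \<gamma> s \<in> U}" using assms(2,4) by simp
  then have "t \<in> T" unfolding T(2) by simp
  then have "open (T \<inter> {0<..<1})" "t \<in> T \<inter> {0<..<1}"
    using open_Int[OF T(1) open_greaterThanLessThan[of 0 1]] assms(2) by simp_all
  then have "\<forall>\<^sub>F s in nhds t. s \<in> T \<inter> {0<..<1}"
    by (rule eventually_nhds_in_open)
  then show ?thesis
  proof (rule eventually_mono)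
    fix s assume s: "s \<in> T \<inter> {0<..<1}"
    then have "s \<in> {s \<in> {0..1}. \<gamma> s \<in> U}" unfolding T(2) by auto
    with s show "s \<in> {0<..<1} \<and> \<gamma> s \<in> U" by auto
  qed
qed

lemma has_vector_derivative_transform_eventually:
  assumes "(f has_vector_derivative f') (at x)" "\<forall>\<^sub>F s in nhds x. f s = g s"
  shows "(g has_vector_derivative f') (at x)"
proof -
  obtain S where S: "open S" "x \<in> S" "\<And>s. s \<in> S \<Longrightarrow> f s = g s"
    using assms(2) unfolding eventually_nhds by blast
  show ?thesis by (rule has_vector_derivative_transform_within_open[OF assms(1) S])
qed

text \<open>The sphere of radius \<open>1 / \<surd>c\<close> is isometric to the projective line. If the curve on the unit sphere is
  differentiable at \<open>t\<close>, then so is its coordinate expression in whichever chart defines the speed,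
  because the charts are restrictions of differentiable maps.\<close>

lemma speed_conv_sphere:
  assumes c: "c > 0" and path: "pathin proj_topology \<gamma>" and t: "t \<in> {0<..<1}"
    and der: "((\<lambda>s. sphere_map (\<gamma> s)) has_vector_derivative d) (at t)"
  shows "norm d = sqrt c * speed (proj_line c) \<gamma> t"
proof -
  have "\<gamma> t \<in> topspace proj_topology"
    using path t by (auto simp: pathin_def continuous_map_def)
  then obtain U \<phi> where U: "(U, \<phi>) \<in> atlas (proj_line c)" "\<gamma> t \<in> U"
    and speed: "speed (proj_line c) \<gamma> t = sqrt (met (proj_line c) \<phi> (\<gamma> t)
      (vector_derivative (\<phi> \<circ> \<gamma>) (at t)) (vector_derivative (\<phi> \<circ> \<gamma>) (at t)))"
    by (rule speed_cases)
  obtain a V st H' where a: "U = range a" "\<And>w. \<phi> (a w) = w"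
    and V: "open V" "\<And>l. l \<in> topspace proj_topology \<Longrightarrow> sphere_map l \<in> V \<longleftrightarrow> l \<in> U"
    and st: "\<And>s. s \<in> V \<Longrightarrow> st differentiable (at s)" "\<And>w. st (sphere_map (a w)) = w"
    and H': "\<And>w. ((\<lambda>w. sphere_map (a w)) has_derivative H' w) (at w)"
    and norm_H': "\<And>w v. norm (H' w v) = 2 * cmod v / (1 + (cmod w)\<^sup>2)" and "a = aff0 \<or> a = aff1"
    by (rule proj_chart_data[OF U(1)]) (rule that)
  have "openin proj_topology U" using proj_line_chart[OF U(1)] by blast
  from pathin_eventually_in[OF path t this U(2)]
  have ev: "\<forall>\<^sub>F s in nhds t. \<gamma> s \<in> U" by (rule eventually_mono) simp
  have inU: "sphere_map l \<in> V" if "l \<in> U" for l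
    using V(2)[of l] that openin_subset[OF \<open>openin proj_topology U\<close>] by auto
  obtain st' where st': "(st has_derivative st') (at (sphere_map (\<gamma> t)))"
    using st(1)[OF inU[OF U(2)]] by (auto simp: differentiable_def)
  have "(st \<circ> (\<lambda>s. sphere_map (\<gamma> s)) has_vector_derivative st' d) (at t)"
  proof -
    have "((\<lambda>s. sphere_map (\<gamma> s)) has_derivative (\<lambda>x. x *\<^sub>R d)) (at t)"
      using der by (simp add: has_vector_derivative_def)
    from diff_chain_at[OF this st']
    have "(st \<circ> (\<lambda>s. sphere_map (\<gamma> s)) has_derivative (st' \<circ> (\<lambda>x. x *\<^sub>R d))) (at t)" .
    moreover have "st' \<circ> (\<lambda>x. x *\<^sub>R d) = (\<lambda>x. x *\<^sub>R st' d)"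
      using has_derivative_bounded_linear[OF st'] by (auto simp: linear_simps)
    ultimately show ?thesis by (simp add: has_vector_derivative_def)
  qed
  moreover have "\<forall>\<^sub>F s in nhds t. (st \<circ> (\<lambda>s. sphere_map (\<gamma> s))) s = (\<phi> \<circ> \<gamma>) s"
    using ev by (rule eventually_mono) (auto simp: a st(2))
  ultimately have v: "(\<phi> \<circ> \<gamma> has_vector_derivative st' d) (at t)"
    by (rule has_vector_derivative_transform_eventually)
  define w where "w = \<phi> (\<gamma> t)"
  have "((\<lambda>w. sphere_map (a w)) \<circ> (\<phi> \<circ> \<gamma>) has_vector_derivative H' w (st' d)) (at t)"
  proof -
    have "(\<phi> \<circ> \<gamma> has_derivative (\<lambda>x. x *\<^sub>R st' d)) (at t)"
      using v by (simp add: has_vector_derivative_def)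
    from diff_chain_at[OF this] H'[of w]
    have "((\<lambda>w. sphere_map (a w)) \<circ> (\<phi> \<circ> \<gamma>) has_derivative (H' w \<circ> (\<lambda>x. x *\<^sub>R st' d))) (at t)"
      by (simp add: w_def)
    moreover have "H' w \<circ> (\<lambda>x. x *\<^sub>R st' d) = (\<lambda>x. x *\<^sub>R H' w (st' d))"
      using has_derivative_bounded_linear[OF H'[of w]] by (auto simp: linear_simps)
    ultimately show ?thesis by (simp add: has_vector_derivative_def)
  qed
  moreover have "\<forall>\<^sub>F s in nhds t. ((\<lambda>w. sphere_map (a w)) \<circ> (\<phi> \<circ> \<gamma>)) s = sphere_map (\<gamma> s)"
    using ev by (rule eventually_mono) (auto simp: a)
  ultimately have "((\<lambda>s. sphere_map (\<gamma> s)) has_vector_derivative H' w (st' d)) (at t)"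
    by (rule has_vector_derivative_transform_eventually)
  then have "d = H' w (st' d)"
    using der vector_derivative_unique_at by blast
  then have "norm d = 2 * cmod (st' d) / (1 + (cmod w)\<^sup>2)"
    using norm_H'[of w "st' d"] by simp
  moreover have "speed (proj_line c) \<gamma> t = 2 / sqrt c * cmod (st' d) / (1 + (cmod w)\<^sup>2)"
    unfolding speed vector_derivative_at[OF v] sqrt_met_proj_line[OF c] w_def ..
  ultimately show ?thesis using c by simp
qed

text \<open>Near each parameter the curve stays in one chart, in which it is piecewise \<open>C\<^sup>1\<close>. The intervals on which
  the claim holds can be joined, so by compactness (Bolzano's principle) it holds on all of \<open>[0, 1]\<close>.\<close>

lemma curve_derivative_off_finite_set:
  assumes \<gamma>: "curve_between (proj_line c) p q \<gamma>"
  obtains k where "finite k" "\<And>t. t \<in> {0<..<1} - k \<Longrightarrow> (\<lambda>s. sphere_map (\<gamma> s)) differentiable (at t)"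
proof -
  have path: "pathin proj_topology \<gamma>"
    using \<gamma> by (simp add: curve_between_def tops_proj_line)
  define P where "P a b \<longleftrightarrow> (0 \<le> a \<longrightarrow> b \<le> 1 \<longrightarrow> (\<exists>k. finite k \<and>
    (\<forall>t\<in>{a<..<b} - k. (\<lambda>s. sphere_map (\<gamma> s)) differentiable (at t))))" for a b :: real
  have "P 0 1"
  proof (rule Bolzano[where P=P])
    fix a b c assume ab: "P a b" and bc: "P b c" and le: "a \<le> b" "b \<le> c"
    show "P a c"
      unfolding P_def
    proof (intro impI)
      assume "0 \<le> a" "c \<le> 1"
      then obtain k l where k: "finite k" "\<And>t. t \<in> {a<..<b} - k \<Longrightarrow> (\<lambda>s. sphere_map (\<gamma> s)) differentiable (at t)"
        and l: "finite l" "\<And>t. t \<in> {b<..<c} - l \<Longrightarrow> (\<lambda>s. sphere_map (\<gamma> s)) differentiable (at t)"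
        using ab bc le unfolding P_def by (meson order_trans)
      have "(\<lambda>s. sphere_map (\<gamma> s)) differentiable (at t)" if "t \<in> {a<..<c} - (insert b (k \<union> l))" for t
        using that k(2)[of t] l(2)[of t] by (cases "t < b") auto
      moreover have "finite (insert b (k \<union> l))" using k l by simp
      ultimately show "\<exists>k. finite k \<and> (\<forall>t\<in>{a<..<c} - k. (\<lambda>s. sphere_map (\<gamma> s)) differentiable (at t))"
        by blast
    qed
  next
    fix x :: real assume x: "0 \<le> x" "x \<le> 1"
    then have "\<gamma> x \<in> topspace proj_topology"
      using path by (auto simp: pathin_def continuous_map_def)
    then obtain U \<phi> where U: "(U, \<phi>) \<in> atlas (proj_line c)" "\<gamma> x \<in> U"
      using proj_line_charts_cover[of "\<gamma> x" c] by blast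
    obtain a V st H' where a: "U = range a" "\<And>w. \<phi> (a w) = w"
      and "open V" "\<And>l. l \<in> topspace proj_topology \<Longrightarrow> sphere_map l \<in> V \<longleftrightarrow> l \<in> U"
      and "\<And>s. s \<in> V \<Longrightarrow> st differentiable (at s)" "\<And>w. st (sphere_map (a w)) = w"
      and H': "\<And>w. ((\<lambda>w. sphere_map (a w)) has_derivative H' w) (at w)"
      and "\<And>w v. norm (H' w v) = 2 * cmod v / (1 + (cmod w)\<^sup>2)" "a = aff0 \<or> a = aff1"
      by (rule proj_chart_data[OF U(1)]) (rule that)
    have oU: "openin proj_topology U" using proj_line_chart[OF U(1)] by blast
    have "openin (top_of_set {0..1}) {s \<in> topspace (top_of_set {0..1}). \<gamma> s \<in> U}"
      using path oU unfolding pathin_def by (rule openin_continuous_map_preimage)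
    then have "openin (top_of_set {0..1}) {s \<in> {0..1}. \<gamma> s \<in> U}"
      by (simp only: topspace_euclidean_subtopology)
    then obtain T where T: "open T" "{s \<in> {0..1}. \<gamma> s \<in> U} = {0..1} \<inter> T"
      unfolding openin_open by blast
    have "x \<in> {s \<in> {0..1}. \<gamma> s \<in> U}" using x U(2) by simp
    then have "x \<in> T" unfolding T(2) by simp
    then obtain d where d: "d > 0" "ball x d \<subseteq> T" using T(1) open_contains_ball by blast
    have "P l u" if lu: "l \<le> x" "x \<le> u" "u - l < d" for l u
      unfolding P_def
    proof (intro impI)
      assume lu': "0 \<le> l" "u \<le> 1"
      have im: "\<gamma> ` {l..u} \<subseteq> U"
      proof clarify
        fix s assume s: "s \<in> {l..u}"
        then have "s \<in> ball x d" using lu by (auto simp: dist_real_def)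
        then have "s \<in> {s \<in> {0..1}. \<gamma> s \<in> U}" unfolding T(2) using d s lu' by auto
        then show "\<gamma> s \<in> U" by simp
      qed
      have "\<forall>(U, \<phi>)\<in>atlas (proj_line c). \<forall>a b. 0 \<le> a \<and> a \<le> b \<and> b \<le> 1 \<and> \<gamma> ` {a..b} \<subseteq> U \<longrightarrow>
          (\<phi> \<circ> \<gamma>) piecewise_C1_differentiable_on {a..b}"
        using \<gamma> unfolding curve_between_def by (elim conjE)
      from bspec[OF this U(1), unfolded prod.case] im lu lu'
      have "(\<phi> \<circ> \<gamma>) piecewise_C1_differentiable_on {l..u}" by simp
      then obtain k where k: "finite k" "\<phi> \<circ> \<gamma> C1_differentiable_on {l..u} - k"
        unfolding piecewise_C1_differentiable_on_def by blast
      show "\<exists>k. finite k \<and> (\<forall>t\<in>{l<..<u} - k. (\<lambda>s. sphere_map (\<gamma> s)) differentiable (at t))"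
      proof (intro exI[of _ k] conjI ballI k(1))
        fix t assume t: "t \<in> {l<..<u} - k"
        then obtain v where v: "(\<phi> \<circ> \<gamma> has_vector_derivative v) (at t)"
          using k(2) unfolding C1_differentiable_on_def by force
        have "(\<phi> \<circ> \<gamma> has_derivative (\<lambda>x. x *\<^sub>R v)) (at t)"
          using v by (simp add: has_vector_derivative_def)
        from diff_chain_at[OF this] H'[of "\<phi> (\<gamma> t)"]
        have "((\<lambda>w. sphere_map (a w)) \<circ> (\<phi> \<circ> \<gamma>) has_derivative (H' (\<phi> (\<gamma> t)) \<circ> (\<lambda>x. x *\<^sub>R v))) (at t)"
          by simp
        then have "((\<lambda>s. sphere_map (\<gamma> s)) has_derivative (H' (\<phi> (\<gamma> t)) \<circ> (\<lambda>x. x *\<^sub>R v))) (at t)"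
        proof (rule has_derivative_transform_within_open)
          show "open {l<..<u}" "t \<in> {l<..<u}" using t by auto
          fix s assume "s \<in> {l<..<u}"
          then have "\<gamma> s \<in> U" using im by force
          then show "((\<lambda>w. sphere_map (a w)) \<circ> (\<phi> \<circ> \<gamma>)) s = sphere_map (\<gamma> s)"
            using a by auto
        qed
        then show "(\<lambda>s. sphere_map (\<gamma> s)) differentiable (at t)"
          by (auto simp: differentiable_def)
      qed
    qed
    then show "\<exists>d>0. \<forall>a b. a \<le> x \<and> x \<le> b \<and> b - a < d \<longrightarrow> P a b"
      using d(1) by blast
  qed simp
  then show ?thesis using that unfolding P_def by auto
qed

text \<open>On the sphere a chord is not longer than an arc with the same ends: integrate the derivative of the
  embedded curve.\<close>

lemma dist_sphere_le_length:
  assumes c: "c > 0" and \<gamma>: "curve_between (proj_line c) p q \<gamma>"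
  shows "dist (sphere_map p) (sphere_map q) \<le> sqrt c * integral {0..1} (speed (proj_line c) \<gamma>)"
proof -
  define \<sigma> where "\<sigma> = (\<lambda>s. sphere_map (\<gamma> s))"
  have path: "pathin proj_topology \<gamma>" and ends: "\<gamma> 0 = p" "\<gamma> 1 = q" and int: "speed (proj_line c) \<gamma> integrable_on {0..1}"
    using \<gamma> by (simp_all only: curve_between_def tops_proj_line)
  obtain k where k: "finite k" and diff: "\<And>t. t \<in> {0<..<1} - k \<Longrightarrow> \<sigma> differentiable (at t)"
    using curve_derivative_off_finite_set[OF \<gamma>] unfolding \<sigma>_def by blast
  have "continuous_map (top_of_set {0..1}) euclidean (sphere_map \<circ> \<gamma>)"
    using path continuous_map_sphere_map unfolding pathin_def by (rule continuous_map_compose)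
  then have cont: "continuous_on {0..1} \<sigma>" by (simp add: \<sigma>_def o_def)
  define \<sigma>' where "\<sigma>' t = (if t \<in> {0<..<1} - k then vector_derivative \<sigma> (at t) else 0)" for t
  have der: "(\<sigma> has_vector_derivative \<sigma>' t) (at t)" if "t \<in> {0<..<1} - k" for t
    using diff[OF that] that by (simp add: \<sigma>'_def vector_derivative_works)
  have I: "(\<sigma>' has_integral (\<sigma> 1 - \<sigma> 0)) {0..1}"
    by (rule fundamental_theorem_of_calculus_interior_strong[OF k _ der cont]) auto
  have norm: "norm (\<sigma>' t) = sqrt c * speed (proj_line c) \<gamma> t" if "t \<in> {0<..<1} - k" for t
    using speed_conv_sphere[OF c path _ der[OF that, unfolded \<sigma>_def]] that by simp
  have int': "(\<lambda>t. sqrt c * speed (proj_line c) \<gamma> t) integrable_on {0..1}"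
    using integrable_on_cmult_left[OF int, of "sqrt c"] by simp
  have "norm (integral {0..1} \<sigma>') \<le> integral {0..1} (\<lambda>t. if t \<in> {0<..<1} - k then sqrt c * speed (proj_line c) \<gamma> t else 0)"
  proof (rule integral_norm_bound_integral)
    show "\<sigma>' integrable_on {0..1}" using I by blast
    show "(\<lambda>t. if t \<in> {0<..<1} - k then sqrt c * speed (proj_line c) \<gamma> t else 0) integrable_on {0..1}"
      by (rule integrable_spike_finite[of "insert 0 (insert 1 k)" _ _ "\<lambda>t. sqrt c * speed (proj_line c) \<gamma> t"]) (use k int' in auto)
    show "norm (\<sigma>' t) \<le> (if t \<in> {0<..<1} - k then sqrt c * speed (proj_line c) \<gamma> t else 0)" if "t \<in> {0..1}" for t
    proof (cases "t \<in> {0<..<1} - k")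
      case True
      then show ?thesis using norm[OF True] by simp
    next
      case False
      then show ?thesis by (simp only: \<sigma>'_def if_False norm_zero order_refl)
    qed
  qed
  also have "\<dots> = integral {0..1} (\<lambda>t. sqrt c * speed (proj_line c) \<gamma> t)"
    by (rule integral_spike[of "insert 0 (insert 1 k)"]) (use k in \<open>auto intro: negligible_finite\<close>)
  also have "\<dots> = sqrt c * integral {0..1} (speed (proj_line c) \<gamma>)"
    by simp
  finally show ?thesis
    using integral_unique[OF I] ends by (simp add: \<sigma>_def dist_norm norm_minus_commute)
qed

section \<open>Completeness of the projective line\<close>

definition seg :: "complex \<Rightarrow> complex \<Rightarrow> real \<Rightarrow> complex" where
  "seg v w t = of_real (1 - t) * v + of_real t * w"

text \<open>The image of a line segment of the plane \<open>\<complex>\<^sup>2\<close>. Such curves join any two points, and their coordinate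
  expressions are quotients of affine functions.\<close>

definition proj_segment :: "complex \<times> complex \<Rightarrow> complex \<times> complex \<Rightarrow> real \<Rightarrow> (complex \<times> complex) set" where
  "proj_segment v w t = proj_point (seg (fst v) (fst w) t, seg (snd v) (snd w) t)"

lemma seg_has_vector_derivative: "(seg v w has_vector_derivative (w - v)) (at t)"
proof -
  have "seg v w = (\<lambda>t. v + t *\<^sub>R (w - v))"
    by (rule ext) (simp add: seg_def scaleR_conv_of_real algebra_simps)
  moreover have "((\<lambda>t. v + t *\<^sub>R (w - v)) has_vector_derivative (w - v)) (at t)"
    by (auto intro!: derivative_eq_intros)
  ultimately show ?thesis by simp
qed

lemma continuous_on_seg: "continuous_on S (seg v w)"
  using seg_has_vector_derivative has_vector_derivative_continuous
  by (meson continuous_at_imp_continuous_on)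

lemma seg_quotient_derivative:
  assumes "seg v' w' t \<noteq> 0"
  shows "((\<lambda>t. seg v w t / seg v' w' t) has_vector_derivative ((v' * w - v * w') / (seg v' w' t)\<^sup>2)) (at t)"
proof -
  have num: "(w - v) * seg v' w' t - seg v w t * (w' - v') = v' * w - v * w'"
    by (simp add: seg_def algebra_simps)
  have "((\<lambda>t. seg v w t / seg v' w' t) has_derivative (\<lambda>h. ((h *\<^sub>R (w - v)) * seg v' w' t -
      seg v w t * (h *\<^sub>R (w' - v'))) / (seg v' w' t * seg v' w' t))) (at t)"
    by (rule has_derivative_divide'[OF seg_has_vector_derivative[of v w t, unfolded has_vector_derivative_def]
          seg_has_vector_derivative[of v' w' t, unfolded has_vector_derivative_def] assms])
  moreover have "((h *\<^sub>R (w - v)) * seg v' w' t - seg v w t * (h *\<^sub>R (w' - v'))) / (seg v' w' t * seg v' w' t) =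
      h *\<^sub>R ((v' * w - v * w') / (seg v' w' t)\<^sup>2)" for h
    unfolding num[symmetric] power2_eq_square scaleR_conv_of_real times_divide_eq_right
    by (rule arg_cong2[where f="(/)", OF _ refl]) algebra
  ultimately show ?thesis
    by (simp only: has_vector_derivative_def)
qed

lemma proj_segment_chart:
  assumes U: "(U, \<phi>) \<in> atlas (proj_line c)"
    and nz: "\<And>t. (seg (fst v) (fst w) t, seg (snd v) (snd w) t) \<noteq> (0, 0)"
  obtains y y' x x' where "\<And>t. proj_segment v w t \<in> U \<longleftrightarrow> seg y y' t \<noteq> 0"
    "\<And>s. seg y y' s \<noteq> 0 \<Longrightarrow> \<phi> (proj_segment v w s) = seg x x' s / seg y y' s"
    "(x = fst v \<and> x' = fst w \<and> y = snd v \<and> y' = snd w) \<or> (x = snd v \<and> x' = snd w \<and> y = fst v \<and> y' = fst w)"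
proof -
  consider "U = range aff0" "\<phi> = proj_coord0" | "U = range aff1" "\<phi> = proj_coord1"
    using U unfolding atlas_proj_line by auto
  then show ?thesis
  proof cases
    case 1
    show ?thesis
    proof (rule that[of "snd v" "snd w" "fst v" "fst w"])
      show "proj_segment v w t \<in> U \<longleftrightarrow> seg (snd v) (snd w) t \<noteq> 0" for t
      proof (cases "seg (snd v) (snd w) t = 0")
        case True
        then have "proj_segment v w t = aff1 0"
          using nz[of t] proj_point_conv_aff(2)[of "seg (fst v) (fst w) t" 0] by (simp add: proj_segment_def)
        then show ?thesis using True aff_mem_iff(2)[of 0] unfolding 1 by simp
      next
        case False
        then show ?thesis unfolding proj_segment_def 1 proj_point_conv_aff(1)[OF False] by simp
      qed
      show "\<phi> (proj_segment v w s) = seg (fst v) (fst w) s / seg (snd v) (snd w) s" if "seg (snd v) (snd w) s \<noteq> 0" for s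
        unfolding proj_segment_def 1 proj_point_conv_aff(1)[OF that] by simp
    qed simp
  next
    case 2
    show ?thesis
    proof (rule that[of "fst v" "fst w" "snd v" "snd w"])
      show "proj_segment v w t \<in> U \<longleftrightarrow> seg (fst v) (fst w) t \<noteq> 0" for t
      proof (cases "seg (fst v) (fst w) t = 0")
        case True
        then have "proj_segment v w t = aff0 0"
          using nz[of t] proj_point_conv_aff(1)[of "seg (snd v) (snd w) t" 0] by (simp add: proj_segment_def)
        then show ?thesis using True aff_mem_iff(1)[of 0] unfolding 2 by simp
      next
        case False
        then show ?thesis unfolding proj_segment_def 2 proj_point_conv_aff(2)[OF False] by simp
      qed
      show "\<phi> (proj_segment v w s) = seg (snd v) (snd w) s / seg (fst v) (fst w) s" if "seg (fst v) (fst w) s \<noteq> 0" for s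
        unfolding proj_segment_def 2 proj_point_conv_aff(2)[OF that] by simp
    qed simp
  qed
qed

lemma proj_segment_chart_derivative:
  assumes "seg y y' t \<noteq> 0"
    and \<phi>: "\<And>s. seg y y' s \<noteq> 0 \<Longrightarrow> \<phi> (proj_segment v w s) = seg x x' s / seg y y' s"
  shows "(\<phi> \<circ> proj_segment v w has_vector_derivative (y * x' - x * y') / (seg y y' t)\<^sup>2) (at t)"
proof (rule has_vector_derivative_transform_within_open[OF seg_quotient_derivative[OF assms(1)]])
  have "open (seg y y' -` (-{0}))"
    using continuous_on_seg[of UNIV] by (intro open_vimage) auto
  then show "open {s. seg y y' s \<noteq> 0}" by (simp add: vimage_def)
  show "t \<in> {s. seg y y' s \<noteq> 0}" using assms(1) by simp
  show "seg x x' s / seg y y' s = (\<phi> \<circ> proj_segment v w) s" if "s \<in> {s. seg y y' s \<noteq> 0}" for s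
    using \<phi>[of s] that by simp
qed

text \<open>The numerator of the derivative of a quotient of two affine functions is constant, namely the
  determinant of \<open>v\<close> and \<open>w\<close>.\<close>

lemma speed_proj_segment:
  assumes c: "c > 0" and nz: "\<And>t. (seg (fst v) (fst w) t, seg (snd v) (snd w) t) \<noteq> (0, 0)"
  shows "speed (proj_line c) (proj_segment v w) t =
    2 / sqrt c * cmod (fst v * snd w - snd v * fst w) / ((cmod (seg (fst v) (fst w) t))\<^sup>2 + (cmod (seg (snd v) (snd w) t))\<^sup>2)"
proof -
  have "proj_segment v w t \<in> topspace proj_topology"
    unfolding proj_segment_def topspace_proj_topology using nz[of t] by blast
  then obtain U \<phi> where U: "(U, \<phi>) \<in> atlas (proj_line c)" "proj_segment v w t \<in> U"
    and speed: "speed (proj_line c) (proj_segment v w) t = sqrt (met (proj_line c) \<phi> (proj_segment v w t)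
      (vector_derivative (\<phi> \<circ> proj_segment v w) (at t)) (vector_derivative (\<phi> \<circ> proj_segment v w) (at t)))"
    by (rule speed_cases)
  obtain y y' x x' where y: "\<And>t. proj_segment v w t \<in> U \<longleftrightarrow> seg y y' t \<noteq> 0"
    and \<phi>: "\<And>s. seg y y' s \<noteq> 0 \<Longrightarrow> \<phi> (proj_segment v w s) = seg x x' s / seg y y' s"
    and xy: "(x = fst v \<and> x' = fst w \<and> y = snd v \<and> y' = snd w) \<or> (x = snd v \<and> x' = snd w \<and> y = fst v \<and> y' = fst w)"
    by (rule proj_segment_chart[OF U(1) nz]) (rule that)
  have y0: "seg y y' t \<noteq> 0" using y U(2) by simp
  have "(\<phi> \<circ> proj_segment v w has_vector_derivative (y * x' - x * y') / (seg y y' t)\<^sup>2) (at t)"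
    by (rule proj_segment_chart_derivative[where \<phi>=\<phi> and v=v and w=w, OF y0 \<phi>])
  note vd = vector_derivative_at[OF this]
  have "speed (proj_line c) (proj_segment v w) t =
      2 / sqrt c * (cmod (y * x' - x * y') / (cmod (seg y y' t))\<^sup>2) / (1 + (cmod (seg x x' t))\<^sup>2 / (cmod (seg y y' t))\<^sup>2)"
    unfolding speed vd sqrt_met_proj_line[OF c] \<phi>[OF y0]
      norm_divide norm_power power_divide ..
  also have "\<dots> = 2 / sqrt c * cmod (y * x' - x * y') / ((cmod (seg x x' t))\<^sup>2 + (cmod (seg y y' t))\<^sup>2)"
  proof -
    have frac: "k * (d / n) / (1 + m / n) = k * d / (m + n)" if n: "n \<noteq> 0" for k d m n :: real
    proof -
      have "1 + m / n = (m + n) / n" using n by (simp add: add_divide_distrib)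
      then show ?thesis using n by simp
    qed
    show ?thesis by (rule frac) (use y0 in simp)
  qed
  also have "cmod (y * x' - x * y') = cmod (fst v * snd w - snd v * fst w)"
    using xy norm_minus_commute[of "fst v * snd w" "snd v * fst w"] by (auto simp: mult.commute)
  also have "(cmod (seg x x' t))\<^sup>2 + (cmod (seg y y' t))\<^sup>2 = (cmod (seg (fst v) (fst w) t))\<^sup>2 + (cmod (seg (snd v) (snd w) t))\<^sup>2"
    using xy by (auto simp: add.commute)
  finally show ?thesis .
qed

lemma proj_segment_curve:
  assumes c: "c > 0" and nz: "\<And>t. (seg (fst v) (fst w) t, seg (snd v) (snd w) t) \<noteq> (0, 0)"
  shows "curve_between (proj_line c) (proj_point v) (proj_point w) (proj_segment v w)"
proof -
  have "continuous_map euclidean proj_topology (proj_segment v w)"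
    unfolding proj_segment_def
    by (rule continuous_map_proj_point[OF _ nz]) (intro continuous_intros continuous_on_seg)
  then have 1: "pathin (tops (proj_line c)) (proj_segment v w)"
    unfolding pathin_def tops_proj_line by (rule continuous_map_from_subtopology)
  have 2: "proj_segment v w 0 = proj_point v" "proj_segment v w 1 = proj_point w"
    by (simp_all add: proj_segment_def seg_def)
  have 3: "(\<phi> \<circ> proj_segment v w) piecewise_C1_differentiable_on {a..b}"
    if U: "(U, \<phi>) \<in> atlas (proj_line c)" and im: "proj_segment v w ` {a..b} \<subseteq> U" for U \<phi> a b
  proof (rule C1_differentiable_imp_piecewise)
    obtain y y' x x' where y: "\<And>t. proj_segment v w t \<in> U \<longleftrightarrow> seg y y' t \<noteq> 0"
      and \<phi>: "\<And>s. seg y y' s \<noteq> 0 \<Longrightarrow> \<phi> (proj_segment v w s) = seg x x' s / seg y y' s"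
      and "(x = fst v \<and> x' = fst w \<and> y = snd v \<and> y' = snd w) \<or> (x = snd v \<and> x' = snd w \<and> y = fst v \<and> y' = fst w)"
      by (rule proj_segment_chart[OF U nz]) (rule that)
    have nz: "seg y y' t \<noteq> 0" if "t \<in> {a..b}" for t using y im that by blast
    show "\<phi> \<circ> proj_segment v w C1_differentiable_on {a..b}"
      unfolding C1_differentiable_on_def
    proof (intro exI conjI ballI)
      show "(\<phi> \<circ> proj_segment v w has_vector_derivative (y * x' - x * y') / (seg y y' t)\<^sup>2) (at t)" if "t \<in> {a..b}" for t
        by (rule proj_segment_chart_derivative[where \<phi>=\<phi> and v=v and w=w, OF nz[OF that] \<phi>])
      show "continuous_on {a..b} (\<lambda>t. (y * x' - x * y') / (seg y y' t)\<^sup>2)"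
        by (intro continuous_intros continuous_on_seg) (simp add: nz)
    qed
  qed
  have pos: "(cmod (seg (fst v) (fst w) t))\<^sup>2 + (cmod (seg (snd v) (snd w) t))\<^sup>2 \<noteq> 0" for t
    using nz[of t] by (auto simp: sum_power2_eq_zero_iff)
  have "continuous_on {0..1} (\<lambda>t. 2 / sqrt c * cmod (fst v * snd w - snd v * fst w) /
      ((cmod (seg (fst v) (fst w) t))\<^sup>2 + (cmod (seg (snd v) (snd w) t))\<^sup>2))"
    by (intro continuous_intros continuous_on_seg ballI pos)
  then have 4: "speed (proj_line c) (proj_segment v w) integrable_on {0..1}"
    unfolding speed_proj_segment[OF c nz, abs_def] by (rule integrable_continuous_interval)
  show ?thesis
    unfolding curve_between_def
  proof (intro conjI 1 2 4)
    show "\<forall>(U, \<phi>)\<in>atlas (proj_line c). \<forall>a b. 0 \<le> a \<and> a \<le> b \<and> b \<le> 1 \<and> proj_segment v w ` {a..b} \<subseteq> U \<longrightarrow>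
        (\<phi> \<circ> proj_segment v w) piecewise_C1_differentiable_on {a..b}"
      by safe (rule 3)
  qed
qed

lemma length_proj_segment_le:
  assumes c: "c > 0" and nz: "\<And>t. (cmod (seg (fst v) (fst w) t))\<^sup>2 + (cmod (seg (snd v) (snd w) t))\<^sup>2 \<ge> 1"
  shows "curve_between (proj_line c) (proj_point v) (proj_point w) (proj_segment v w)"
    "integral {0..1} (speed (proj_line c) (proj_segment v w)) \<le> 2 / sqrt c * cmod (fst v * snd w - snd v * fst w)"
proof -
  have nz': "(seg (fst v) (fst w) t, seg (snd v) (snd w) t) \<noteq> (0, 0)" for t
    using nz[of t] by auto
  show curve: "curve_between (proj_line c) (proj_point v) (proj_point w) (proj_segment v w)"
    by (rule proj_segment_curve[OF c nz'])
  define K where "K = 2 / sqrt c * cmod (fst v * snd w - snd v * fst w)"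
  have K: "K \<ge> 0" using c by (simp add: K_def)
  have "speed (proj_line c) (proj_segment v w) t \<le> K" for t
    unfolding speed_proj_segment[OF c nz'] K_def[symmetric]
    using frac_le[OF K order_refl _ nz[of t]] by simp
  then have "integral {0..1} (speed (proj_line c) (proj_segment v w)) \<le> integral {0..1} (\<lambda>t :: real. K)"
    using curve by (intro integral_le) (auto simp only: curve_between_def integrable_const_ivl)
  then show "integral {0..1} (speed (proj_line c) (proj_segment v w)) \<le> 2 / sqrt c * cmod (fst v * snd w - snd v * fst w)"
    by (simp add: K_def)
qed

lemma length_bounded_below:
  assumes "c > 0"
  shows "bdd_below ((\<lambda>\<gamma>. integral {0..1} (speed (proj_line c) \<gamma>)) ` {\<gamma>. curve_between (proj_line c) p q \<gamma>})"
proof (rule bdd_belowI2)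
  fix \<gamma> assume "\<gamma> \<in> {\<gamma>. curve_between (proj_line c) p q \<gamma>}"
  then have "dist (sphere_map p) (sphere_map q) \<le> sqrt c * integral {0..1} (speed (proj_line c) \<gamma>)"
    using dist_sphere_le_length[OF assms] by blast
  then show "dist (sphere_map p) (sphere_map q) / sqrt c \<le> integral {0..1} (speed (proj_line c) \<gamma>)"
    using assms by (simp add: divide_le_eq mult.commute)
qed

lemma riemannian_dist_le_length:
  assumes "c > 0" "curve_between (proj_line c) p q \<gamma>"
  shows "riemannian_dist (proj_line c) p q \<le> integral {0..1} (speed (proj_line c) \<gamma>)"
  unfolding riemannian_dist_def
  by (rule cINF_lower[OF length_bounded_below[OF assms(1)]]) (use assms(2) in simp)

lemma riemannian_dist_aff_le:
  assumes "c > 0" and a: "a = aff0 \<or> a = aff1"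
  shows "riemannian_dist (proj_line c) (a z) (a z') \<le> 2 / sqrt c * cmod (z - z')"
proof -
  define v w where "v = (if a = aff0 then (z, 1) else (1, z))" and "w = (if a = aff0 then (z', 1) else (1, z'))"
  have neq: "aff1 \<noteq> aff0" using aff0_neq_infinity[of 0] by metis
  have vw: "proj_point v = a z" "proj_point w = a z'"
    using a neq by (auto simp: v_def w_def aff0_def aff1_def)
  have seg1: "seg 1 1 t = 1" for t by (simp add: seg_def)
  have nz: "(cmod (seg (fst v) (fst w) t))\<^sup>2 + (cmod (seg (snd v) (snd w) t))\<^sup>2 \<ge> 1" for t
    by (simp add: v_def w_def seg1)
  have "cmod (fst v * snd w - snd v * fst w) = cmod (z - z')"
    by (simp add: v_def w_def norm_minus_commute)
  then show ?thesis
    using riemannian_dist_le_length[OF assms(1) length_proj_segment_le(1)[OF assms(1) nz]]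
      length_proj_segment_le(2)[OF assms(1) nz] unfolding vw by simp
qed

lemma curve_exists:
  assumes c: "c > 0" and p: "p \<in> topspace proj_topology" and q: "q \<in> topspace proj_topology"
  shows "\<exists>\<gamma>. curve_between (proj_line c) p q \<gamma>"
proof -
  have curve: "\<exists>\<gamma>. curve_between (proj_line c) p q \<gamma>"
    if "p = proj_point v" "q = proj_point w" "\<And>t. (seg (fst v) (fst w) t, seg (snd v) (snd w) t) \<noteq> (0, 0)" for v w
    using proj_segment_curve[OF c that(3)] that(1,2) by blast
  show ?thesis
    using p
  proof (cases rule: aff_cases)
    case p: (1 z)
    show ?thesis using q
    proof (cases rule: aff_cases)
      case (1 z')
      show ?thesis
        by (rule curve[of "(z, 1)" "(z', 1)"]) (simp_all add: p 1 aff0_def seg_def)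
    next
      case 2
      show ?thesis
        by (rule curve[of "(z, 1)" "(1, 0)"]) (auto simp: p 2 aff0_def aff1_def seg_def)
    qed
  next
    case p: 2
    show ?thesis using q
    proof (cases rule: aff_cases)
      case (1 z')
      show ?thesis
        by (rule curve[of "(1, 0)" "(z', 1)"]) (auto simp: p 1 aff0_def aff1_def seg_def)
    next
      case 2
      show ?thesis
        by (rule curve[of "(1, 0)" "(1, 0)"]) (simp_all add: p 2 aff1_def seg_def)
    qed
  qed
qed

lemma dist_sphere_le_riemannian_dist:
  assumes "c > 0" "p \<in> topspace proj_topology" "q \<in> topspace proj_topology"
  shows "dist (sphere_map p) (sphere_map q) \<le> sqrt c * riemannian_dist (proj_line c) p q"
proof -
  have "dist (sphere_map p) (sphere_map q) / sqrt c \<le> riemannian_dist (proj_line c) p q"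
    unfolding riemannian_dist_def
  proof (rule cINF_greatest)
    \<comment> \<open>The infimum of the empty set of reals is an unspecified number.\<close>
    show "{\<gamma>. curve_between (proj_line c) p q \<gamma>} \<noteq> {}" using curve_exists[OF assms] by simp
    fix \<gamma> assume "\<gamma> \<in> {\<gamma>. curve_between (proj_line c) p q \<gamma>}"
    then have "dist (sphere_map p) (sphere_map q) \<le> sqrt c * integral {0..1} (speed (proj_line c) \<gamma>)"
      using dist_sphere_le_length[OF assms(1)] by blast
    then show "dist (sphere_map p) (sphere_map q) / sqrt c \<le> integral {0..1} (speed (proj_line c) \<gamma>)"
      using assms by (simp add: divide_le_eq mult.commute)
  qed
  then show ?thesis using assms(1) by (simp add: divide_le_eq mult.commute)
qed

text \<open>The Riemannian distance dominates the chordal distance up to the factor \<open>\<surd>c\<close>, so a Cauchy sequence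
  converges on the sphere, which is closed. In a chart around the limit the Riemannian distance is
  dominated by the distance of the coordinates, so the sequence also converges for it.\<close>

lemma complete_proj_line:
  assumes c: "c > 0"
  shows "complete_manifold (proj_line c)"
  unfolding complete_manifold_def
proof (intro allI impI)
  fix \<sigma> :: "nat \<Rightarrow> (complex \<times> complex) set"
  assume "range \<sigma> \<subseteq> pts (proj_line c)"
    and cauchy: "\<forall>\<epsilon>>0. \<exists>k. \<forall>m\<ge>k. \<forall>n\<ge>k. riemannian_dist (proj_line c) (\<sigma> m) (\<sigma> n) < \<epsilon>"
  then have \<sigma>: "\<sigma> n \<in> topspace proj_topology" for n unfolding tops_proj_line by blast
  have "Cauchy (\<lambda>n. sphere_map (\<sigma> n))"
  proof (rule metric_CauchyI)
    fix e :: real assume "e > 0"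
    then have "e / sqrt c > 0" using c by simp
    then obtain k where k: "\<And>m n. m \<ge> k \<Longrightarrow> n \<ge> k \<Longrightarrow> riemannian_dist (proj_line c) (\<sigma> m) (\<sigma> n) < e / sqrt c"
      using cauchy by meson
    have "dist (sphere_map (\<sigma> m)) (sphere_map (\<sigma> n)) < e" if "m \<ge> k" "n \<ge> k" for m n
    proof -
      have "sqrt c * riemannian_dist (proj_line c) (\<sigma> m) (\<sigma> n) < e"
        using k[OF that] c by (simp add: less_divide_eq mult.commute)
      then show ?thesis using dist_sphere_le_riemannian_dist[OF c \<sigma>[of m] \<sigma>[of n]] by linarith
    qed
    then show "\<exists>M. \<forall>m\<ge>M. \<forall>n\<ge>M. dist (sphere_map (\<sigma> m)) (sphere_map (\<sigma> n)) < e" by blast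
  qed
  then obtain s where s: "(\<lambda>n. sphere_map (\<sigma> n)) \<longlonglongrightarrow> s"
    using Cauchy_convergent convergent_def by blast
  have "sphere_map (\<sigma> n) \<in> sphere 0 1" for n using sphere_map_image \<sigma> by blast
  then have "s \<in> sphere 0 1"
    by (intro Lim_in_closed_set[OF closed_sphere _ _ s] always_eventually allI) simp_all
  then obtain l where l: "l \<in> topspace proj_topology" "s = sphere_map l"
    using sphere_map_image by blast
  obtain U \<phi> where U: "(U, \<phi>) \<in> atlas (proj_line c)" "l \<in> U"
    by (rule proj_line_charts_cover[OF l(1)])
  obtain a V st H' where a: "U = range a" "\<And>w. \<phi> (a w) = w"
    and V: "open V" "\<And>l. l \<in> topspace proj_topology \<Longrightarrow> sphere_map l \<in> V \<longleftrightarrow> l \<in> U"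
    and st: "\<And>s. s \<in> V \<Longrightarrow> st differentiable (at s)" "\<And>w. st (sphere_map (a w)) = w"
    and "\<And>w. ((\<lambda>w. sphere_map (a w)) has_derivative H' w) (at w)"
    and "\<And>w v. norm (H' w v) = 2 * cmod v / (1 + (cmod w)\<^sup>2)" and aff: "a = aff0 \<or> a = aff1"
    by (rule proj_chart_data[OF U(1)]) (rule that)
  obtain z where z: "l = a z" using U(2) a(1) by blast
  have "s \<in> V" using V(2)[OF l(1)] U(2) l(2) by simp
  then have ev: "\<forall>\<^sub>F n in sequentially. sphere_map (\<sigma> n) \<in> V"
    by (rule topological_tendstoD[OF s V(1)])
  have "isCont st s"
    using st(1)[OF \<open>s \<in> V\<close>] by (rule differentiable_imp_continuous_within)
  then have "(\<lambda>n. st (sphere_map (\<sigma> n))) \<longlonglongrightarrow> st s"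
    using s by (rule isCont_tendsto_compose)
  moreover have "st s = z" unfolding l(2) z by (rule st(2))
  ultimately have "(\<lambda>n. st (sphere_map (\<sigma> n)) - z) \<longlonglongrightarrow> z - z"
    by (intro tendsto_diff tendsto_const) simp
  then have "(\<lambda>n. 2 / sqrt c * cmod (st (sphere_map (\<sigma> n)) - z)) \<longlonglongrightarrow> 2 / sqrt c * cmod (z - z)"
    by (intro tendsto_mult tendsto_const tendsto_norm)
  then have upper: "(\<lambda>n. 2 / sqrt c * cmod (st (sphere_map (\<sigma> n)) - z)) \<longlonglongrightarrow> 0"
    by simp
  have "(\<lambda>n. riemannian_dist (proj_line c) (\<sigma> n) l) \<longlonglongrightarrow> 0"
  proof (rule tendsto_sandwich[OF _ _ tendsto_const upper])
    show "\<forall>\<^sub>F n in sequentially. 0 \<le> riemannian_dist (proj_line c) (\<sigma> n) l"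
    proof (intro always_eventually allI)
      fix n
      have "0 \<le> sqrt c * riemannian_dist (proj_line c) (\<sigma> n) l"
        using dist_sphere_le_riemannian_dist[OF c \<sigma>[of n] l(1)] by (rule order_trans[OF zero_le_dist])
      then show "0 \<le> riemannian_dist (proj_line c) (\<sigma> n) l"
        using c by (simp add: zero_le_mult_iff)
    qed
    show "\<forall>\<^sub>F n in sequentially. riemannian_dist (proj_line c) (\<sigma> n) l \<le> 2 / sqrt c * cmod (st (sphere_map (\<sigma> n)) - z)"
      using ev
    proof (rule eventually_mono)
      fix n assume "sphere_map (\<sigma> n) \<in> V"
      then obtain w where w: "\<sigma> n = a w" using V(2)[OF \<sigma>[of n]] a(1) by blast
      show "riemannian_dist (proj_line c) (\<sigma> n) l \<le> 2 / sqrt c * cmod (st (sphere_map (\<sigma> n)) - z)"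
        unfolding w z st(2) by (rule riemannian_dist_aff_le[OF c aff])
    qed
  qed
  then show "\<exists>l\<in>pts (proj_line c). (\<lambda>n. riemannian_dist (proj_line c) (\<sigma> n) l) \<longlonglongrightarrow> 0"
    using l(1) unfolding tops_proj_line by blast
qed

lemma real_analytic_metric_proj_line: "real_analytic_metric (proj_line c)"
  unfolding real_analytic_metric_def
proof safe
  fix U \<phi> u v assume U: "(U, \<phi>) \<in> atlas (proj_line c)"
  show "real_analytic_on (\<lambda>z. loc_met (proj_line c) U \<phi> z u v) (\<phi> ` U)"
    unfolding loc_met_proj_line[OF U] by (rule real_analytic_on_fubini_study)
qed

section \<open>Exponential sums and positive solutions of a differential equation\<close>

text \<open>Exponential functions are linearly independent: dividing by one of them and differentiating removes
  it from the relation.\<close>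

lemma exp_sum_eq_0_imp_coeff_0:
  fixes c :: "real \<Rightarrow> real"
  assumes "finite A" "\<And>x. (\<Sum>\<alpha>\<in>A. c \<alpha> * exp (\<alpha> * x)) = 0" "\<alpha> \<in> A"
  shows "c \<alpha> = 0"
  using assms
proof (induction A arbitrary: c \<alpha> rule: finite_induct)
  case (insert \<beta> A)
  have "c \<alpha> = 0" if \<alpha>: "\<alpha> \<in> A" for \<alpha>
  proof -
    have zero: "(\<Sum>\<alpha>\<in>A. (c \<alpha> * (\<alpha> - \<beta>)) * exp (\<alpha> * x)) = 0" for x
    proof -
      have "c \<beta> + (\<Sum>\<alpha>\<in>A. c \<alpha> * exp ((\<alpha> - \<beta>) * x)) = 0" for x
      proof -
        have "0 = exp (- \<beta> * x) * (\<Sum>\<alpha>\<in>insert \<beta> A. c \<alpha> * exp (\<alpha> * x))"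
          using insert.prems(1) by simp
        also have "\<dots> = (\<Sum>\<alpha>\<in>insert \<beta> A. c \<alpha> * exp ((\<alpha> - \<beta>) * x))"
          unfolding sum_distrib_left
        proof (rule sum.cong[OF refl])
          fix \<alpha>
          have "exp ((\<alpha> - \<beta>) * x) = exp (- \<beta> * x) * exp (\<alpha> * x)"
            by (simp add: left_diff_distrib flip: exp_add)
          then show "exp (- \<beta> * x) * (c \<alpha> * exp (\<alpha> * x)) = c \<alpha> * exp ((\<alpha> - \<beta>) * x)"
            by simp
        qed
        also have "\<dots> = c \<beta> + (\<Sum>\<alpha>\<in>A. c \<alpha> * exp ((\<alpha> - \<beta>) * x))"
          using insert.hyps by simp
        finally show ?thesis by simp
      qed
      then have const: "(\<lambda>x. c \<beta> + (\<Sum>\<alpha>\<in>A. c \<alpha> * exp ((\<alpha> - \<beta>) * x))) = (\<lambda>x. 0)"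
        by (rule ext)
      have "((\<lambda>x. c \<beta> + (\<Sum>\<alpha>\<in>A. c \<alpha> * exp ((\<alpha> - \<beta>) * x))) has_real_derivative
          (\<Sum>\<alpha>\<in>A. c \<alpha> * (exp ((\<alpha> - \<beta>) * x) * (\<alpha> - \<beta>)))) (at x)"
        by (auto intro!: derivative_eq_intros sum.cong)
      then have "(\<Sum>\<alpha>\<in>A. c \<alpha> * (exp ((\<alpha> - \<beta>) * x) * (\<alpha> - \<beta>))) = 0"
        unfolding const using DERIV_const DERIV_unique by blast
      then have "0 = exp (\<beta> * x) * (\<Sum>\<alpha>\<in>A. c \<alpha> * (exp ((\<alpha> - \<beta>) * x) * (\<alpha> - \<beta>)))"
        by simp
      also have "\<dots> = (\<Sum>\<alpha>\<in>A. (c \<alpha> * (\<alpha> - \<beta>)) * exp (\<alpha> * x))"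
        unfolding sum_distrib_left
      proof (rule sum.cong[OF refl])
        fix \<alpha>
        have "exp (\<alpha> * x) = exp (\<beta> * x) * exp ((\<alpha> - \<beta>) * x)"
          by (simp add: left_diff_distrib flip: exp_add)
        then show "exp (\<beta> * x) * (c \<alpha> * (exp ((\<alpha> - \<beta>) * x) * (\<alpha> - \<beta>))) = c \<alpha> * (\<alpha> - \<beta>) * exp (\<alpha> * x)"
          by simp
      qed
      finally show ?thesis by simp
    qed
    have "c \<alpha> * (\<alpha> - \<beta>) = 0"
      by (rule insert.IH[of "\<lambda>\<alpha>. c \<alpha> * (\<alpha> - \<beta>)", OF zero \<alpha>])
    moreover have "\<alpha> \<noteq> \<beta>" using \<alpha> insert.hyps by auto
    ultimately show ?thesis by simp
  qed
  moreover from this have "c \<beta> = 0"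
    using insert.prems(1)[of 0] insert.hyps by simp
  ultimately show ?case using insert.prems(2) by auto
qed simp

text \<open>The recurrence propagates the support of \<open>V\<close> downwards from \<open>\<epsilon>\<close> unless \<open>\<epsilon> = 0\<close>, and upwards unless
  \<open>\<epsilon> = \<kappa>\<close>. As the support is finite, both exceptions occur: every point of the support is a natural
  number, and so is \<open>\<kappa>\<close>.\<close>

lemma binomial_recurrence:
  fixes V :: "real \<Rightarrow> real"
  assumes fin: "finite {\<epsilon>. V \<epsilon> \<noteq> 0}" and nz: "V \<epsilon>\<^sub>0 \<noteq> 0" and \<rho>: "\<rho> > 0"
    and rec: "\<And>\<epsilon>. (\<epsilon> + 1) * V (\<epsilon> + 1) = \<rho> * (\<kappa> - \<epsilon>) * V \<epsilon>"
  obtains n :: nat where "\<kappa> = real n" "{\<epsilon>. V \<epsilon> \<noteq> 0} = real ` {0..n}"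
    "\<And>j. V (real j) = V 0 * real (n choose j) * \<rho> ^ j" "V 0 \<noteq> 0"
proof -
  have nat: "\<exists>k. \<epsilon> = real k" if V: "V \<epsilon> \<noteq> 0" for \<epsilon>
  proof (rule ccontr)
    assume no: "\<nexists>k. \<epsilon> = real k"
    have "V (\<epsilon> - real k) \<noteq> 0" for k
    proof (induction k)
      case (Suc k)
      have "\<epsilon> - real k \<noteq> 0" using no by auto
      with Suc rec[of "\<epsilon> - real (Suc k)"] show ?case by auto
    qed (use V in simp)
    then have "range (\<lambda>k. \<epsilon> - real k) \<subseteq> {\<epsilon>. V \<epsilon> \<noteq> 0}" by blast
    moreover have "infinite (range (\<lambda>k. \<epsilon> - real k))"
      by (rule range_inj_infinite) (auto simp: inj_on_def)
    ultimately show False using fin finite_subset by blast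
  qed
  obtain j\<^sub>0 where j\<^sub>0: "\<epsilon>\<^sub>0 = real j\<^sub>0" using nat[OF nz] by blast
  have "\<exists>k. \<kappa> = \<epsilon>\<^sub>0 + real k"
  proof (rule ccontr)
    assume no: "\<nexists>k. \<kappa> = \<epsilon>\<^sub>0 + real k"
    have "V (\<epsilon>\<^sub>0 + real k) \<noteq> 0" for k
    proof (induction k)
      case (Suc k)
      have "\<kappa> - (\<epsilon>\<^sub>0 + real k) \<noteq> 0" using no by auto
      with Suc \<rho> have "\<rho> * (\<kappa> - (\<epsilon>\<^sub>0 + real k)) * V (\<epsilon>\<^sub>0 + real k) \<noteq> 0" by simp
      with rec[of "\<epsilon>\<^sub>0 + real k"] show ?case by (auto simp: add_ac)
    qed (use nz in simp)
    then have "range (\<lambda>k. \<epsilon>\<^sub>0 + real k) \<subseteq> {\<epsilon>. V \<epsilon> \<noteq> 0}" by blast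
    moreover have "infinite (range (\<lambda>k. \<epsilon>\<^sub>0 + real k))"
      by (rule range_inj_infinite) (auto simp: inj_on_def)
    ultimately show False using fin finite_subset by blast
  qed
  then obtain k where "\<kappa> = \<epsilon>\<^sub>0 + real k" by blast
  define n where "n = j\<^sub>0 + k"
  have \<kappa>: "\<kappa> = real n" using \<open>\<kappa> = \<epsilon>\<^sub>0 + real k\<close> j\<^sub>0 by (simp add: n_def)
  have V: "V (real j) = V 0 * real (n choose j) * \<rho> ^ j" for j
  proof (induction j)
    case (Suc j)
    have "real (Suc j) * V (real (Suc j)) = \<rho> * (real n - real j) * V (real j)"
      using rec[of "real j"] by (simp add: \<kappa> add.commute)
    also have "\<dots> = V 0 * ((real n - real j) * real (n choose j)) * \<rho> ^ Suc j"
      by (simp add: Suc)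
    also have "(real n - real j) * real (n choose j) = real (Suc j) * real (n choose Suc j)"
    proof (cases "j \<le> n")
      case True
      have "Suc j * (n choose Suc j) = (n - j) * (n choose j)"
        by (metis Suc_times_binomial_eq binomial_absorb_comp mult.commute times_binomial_minus1_eq binomial_absorption diff_Suc_1 zero_less_Suc)
      then have "real (Suc j * (n choose Suc j)) = real ((n - j) * (n choose j))" by (rule arg_cong)
      then show ?thesis by (simp only: of_nat_mult of_nat_diff[OF True])
    qed (simp add: binomial_eq_0)
    finally have "real (Suc j) * V (real (Suc j)) = real (Suc j) * (V 0 * real (n choose Suc j) * \<rho> ^ Suc j)"
      by (simp only: mult_ac)
    then show ?case by (simp only: mult_cancel_left of_nat_eq_0_iff nat.distinct simp_thms)
  qed simp
  have V0: "V 0 \<noteq> 0" using nz V[of j\<^sub>0] j\<^sub>0 by auto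
  have "{\<epsilon>. V \<epsilon> \<noteq> 0} = real ` {0..n}"
  proof (intro equalityI subsetI)
    fix \<epsilon> assume "\<epsilon> \<in> {\<epsilon>. V \<epsilon> \<noteq> 0}"
    then obtain j where j: "\<epsilon> = real j" "V (real j) \<noteq> 0" using nat by auto
    then have "j \<le> n" using V[of j] by (auto simp: binomial_eq_0_iff not_less)
    then show "\<epsilon> \<in> real ` {0..n}" using j by auto
  next
    fix \<epsilon> assume "\<epsilon> \<in> real ` {0..n}"
    then obtain j where "\<epsilon> = real j" "j \<le> n" by auto
    then show "\<epsilon> \<in> {\<epsilon>. V \<epsilon> \<noteq> 0}" using V[of j] V0 \<rho> by (simp add: binomial_eq_0_iff)
  qed
  then show ?thesis using that \<kappa> V V0 by blast
qed

text \<open>The hypothesis is the differential equation of \<open>exp (\<beta> x) (P exp (a x) + Q exp (- a x)) powr \<kappa>\<close>. After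
  multiplication by \<open>exp (a x)\<close>, comparing the coefficients of the exponentials turns it into the
  binomial recurrence for the weights at the exponents \<open>\<beta> - \<kappa> a + 2 a \<epsilon>\<close>.\<close>

lemma exp_sum_binomial:
  fixes W :: "real \<Rightarrow> real"
  assumes fin: "finite A" and ne: "A \<noteq> {}" and W: "\<And>\<alpha>. \<alpha> \<in> A \<Longrightarrow> W \<alpha> > 0"
    and pos: "a > 0" "P > 0" "Q > 0"
    and ode: "\<And>x. (\<Sum>\<alpha>\<in>A. \<alpha> * W \<alpha> * exp (\<alpha> * x)) * (P * exp (a * x) + Q * exp (- a * x)) =
      (\<Sum>\<alpha>\<in>A. W \<alpha> * exp (\<alpha> * x)) * (\<kappa> * (a * (P * exp (a * x) - Q * exp (- a * x)))
        + \<beta> * (P * exp (a * x) + Q * exp (- a * x)))"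
  obtains n w where "\<kappa> = real n" "A = (\<lambda>j. \<beta> - \<kappa> * a + 2 * a * real j) ` {0..n}" "w > 0"
    "\<And>j. j \<le> n \<Longrightarrow> W (\<beta> - \<kappa> * a + 2 * a * real j) = w * real (n choose j) * (P / Q) ^ j"
proof -
  define w where "w \<alpha> = (if \<alpha> \<in> A then W \<alpha> else 0)" for \<alpha>
  define B where "B = A \<union> (\<lambda>\<alpha>. \<alpha> + 2 * a) ` A"
  \<comment> \<open>The coefficient of \<open>exp (\<gamma> x)\<close>: one contribution from the exponent \<open>\<gamma> - 2 a\<close>, shifted by the factor
    \<open>exp (2 a x)\<close>, and one from \<open>\<gamma>\<close> itself.\<close>
  define c where "c \<gamma> = (\<gamma> - 2 * a - \<kappa> * a - \<beta>) * P * w (\<gamma> - 2 * a) + (\<gamma> + \<kappa> * a - \<beta>) * Q * w \<gamma>" for \<gamma>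
  have finB: "finite B" using fin by (simp add: B_def)
  have "(\<Sum>\<gamma>\<in>B. c \<gamma> * exp (\<gamma> * x)) = 0" for x
  proof -
    have 1: "(\<Sum>\<gamma>\<in>B. (\<gamma> - 2 * a - \<kappa> * a - \<beta>) * P * w (\<gamma> - 2 * a) * exp (\<gamma> * x)) =
        (\<Sum>\<alpha>\<in>A. (\<alpha> - \<kappa> * a - \<beta>) * P * W \<alpha> * exp ((\<alpha> + 2 * a) * x))"
    proof -
      have "(\<Sum>\<gamma>\<in>B. (\<gamma> - 2 * a - \<kappa> * a - \<beta>) * P * w (\<gamma> - 2 * a) * exp (\<gamma> * x)) =
          (\<Sum>\<gamma>\<in>(\<lambda>\<alpha>. \<alpha> + 2 * a) ` A. (\<gamma> - 2 * a - \<kappa> * a - \<beta>) * P * w (\<gamma> - 2 * a) * exp (\<gamma> * x))"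
      proof (rule sum.mono_neutral_right[OF finB])
        show "\<forall>\<gamma>\<in>B - (\<lambda>\<alpha>. \<alpha> + 2 * a) ` A. (\<gamma> - 2 * a - \<kappa> * a - \<beta>) * P * w (\<gamma> - 2 * a) * exp (\<gamma> * x) = 0"
        proof
          fix \<gamma> assume "\<gamma> \<in> B - (\<lambda>\<alpha>. \<alpha> + 2 * a) ` A"
          then have "\<gamma> - 2 * a \<notin> A" by (auto simp: image_iff)
          then show "(\<gamma> - 2 * a - \<kappa> * a - \<beta>) * P * w (\<gamma> - 2 * a) * exp (\<gamma> * x) = 0"
            by (simp add: w_def)
        qed
      qed (auto simp: B_def)
      also have "\<dots> = (\<Sum>\<alpha>\<in>A. (\<alpha> - \<kappa> * a - \<beta>) * P * W \<alpha> * exp ((\<alpha> + 2 * a) * x))"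
        by (subst sum.reindex) (auto simp: inj_on_def w_def intro!: sum.cong)
      finally show ?thesis .
    qed
    have 2: "(\<Sum>\<gamma>\<in>B. (\<gamma> + \<kappa> * a - \<beta>) * Q * w \<gamma> * exp (\<gamma> * x)) =
        (\<Sum>\<alpha>\<in>A. (\<alpha> + \<kappa> * a - \<beta>) * Q * W \<alpha> * exp (\<alpha> * x))"
    proof -
      have "(\<Sum>\<gamma>\<in>B. (\<gamma> + \<kappa> * a - \<beta>) * Q * w \<gamma> * exp (\<gamma> * x)) =
          (\<Sum>\<gamma>\<in>A. (\<gamma> + \<kappa> * a - \<beta>) * Q * w \<gamma> * exp (\<gamma> * x))"
        by (rule sum.mono_neutral_right[OF finB]) (auto simp: B_def w_def)
      then show ?thesis by (simp add: w_def)
    qed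
    have e2: "exp ((\<alpha> + 2 * a) * x) = exp (\<alpha> * x) * (exp (a * x) * exp (a * x))" for \<alpha>
      by (simp add: algebra_simps flip: exp_add)
    have e0: "exp (\<alpha> * x) = exp (\<alpha> * x) * (exp (a * x) * exp (- a * x))" for \<alpha>
      by (simp flip: exp_add)
    have "(\<Sum>\<gamma>\<in>B. c \<gamma> * exp (\<gamma> * x)) =
      (\<Sum>\<alpha>\<in>A. (\<alpha> - \<kappa> * a - \<beta>) * P * W \<alpha> * exp ((\<alpha> + 2 * a) * x)) +
      (\<Sum>\<alpha>\<in>A. (\<alpha> + \<kappa> * a - \<beta>) * Q * W \<alpha> * exp (\<alpha> * x))"
      unfolding 1[symmetric] 2[symmetric] c_def by (simp only: distrib_right sum.distrib)
    also have "\<dots> = (\<Sum>\<alpha>\<in>A. exp (a * x) *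
        (\<alpha> * W \<alpha> * exp (\<alpha> * x) * (P * exp (a * x) + Q * exp (- a * x)) -
         W \<alpha> * exp (\<alpha> * x) * (\<kappa> * (a * (P * exp (a * x) - Q * exp (- a * x)))
           + \<beta> * (P * exp (a * x) + Q * exp (- a * x)))))"
      unfolding sum.distrib[symmetric]
    proof (rule sum.cong[OF refl])
      fix \<alpha>
      define u v t where "u = exp (a * x)" and "v = exp (- a * x)" and "t = exp (\<alpha> * x)"
      have "(\<alpha> + \<kappa> * a - \<beta>) * Q * W \<alpha> * t = (\<alpha> + \<kappa> * a - \<beta>) * Q * W \<alpha> * (t * (u * v))"
        using e0[of \<alpha>] by (simp add: u_def v_def t_def)
      then show "(\<alpha> - \<kappa> * a - \<beta>) * P * W \<alpha> * exp ((\<alpha> + 2 * a) * x) +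
          (\<alpha> + \<kappa> * a - \<beta>) * Q * W \<alpha> * exp (\<alpha> * x) = exp (a * x) *
        (\<alpha> * W \<alpha> * exp (\<alpha> * x) * (P * exp (a * x) + Q * exp (- a * x)) -
         W \<alpha> * exp (\<alpha> * x) * (\<kappa> * (a * (P * exp (a * x) - Q * exp (- a * x)))
           + \<beta> * (P * exp (a * x) + Q * exp (- a * x))))"
        unfolding e2 u_def[symmetric] v_def[symmetric] t_def[symmetric] by algebra
    qed
    also have "\<dots> = exp (a * x) *
        ((\<Sum>\<alpha>\<in>A. \<alpha> * W \<alpha> * exp (\<alpha> * x)) * (P * exp (a * x) + Q * exp (- a * x)) -
         (\<Sum>\<alpha>\<in>A. W \<alpha> * exp (\<alpha> * x)) * (\<kappa> * (a * (P * exp (a * x) - Q * exp (- a * x)))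
           + \<beta> * (P * exp (a * x) + Q * exp (- a * x))))"
      by (simp only: sum_distrib_left[symmetric] sum_distrib_right[symmetric] sum_subtractf)
    also have "\<dots> = 0" using ode[of x] by (simp only: diff_self mult_zero_right)
    finally show ?thesis .
  qed
  then have c_B: "c \<gamma> = 0" if "\<gamma> \<in> B" for \<gamma>
    using exp_sum_eq_0_imp_coeff_0[OF finB _ that, of c] by blast
  have c_0: "c \<gamma> = 0" for \<gamma>
  proof (cases "\<gamma> \<in> B")
    case False
    then have "\<gamma> \<notin> A" "\<gamma> - 2 * a \<notin> A"
      unfolding B_def by (auto simp: image_iff)
    then show ?thesis by (simp add: c_def w_def)
  qed (rule c_B)
  define V where "V \<epsilon> = w (\<beta> - \<kappa> * a + 2 * a * \<epsilon>)" for \<epsilon>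
  have rec: "(\<epsilon> + 1) * V (\<epsilon> + 1) = P / Q * (\<kappa> - \<epsilon>) * V \<epsilon>" for \<epsilon>
  proof -
    have "c (\<beta> - \<kappa> * a + 2 * a * (\<epsilon> + 1)) = 2 * a * ((\<epsilon> - \<kappa>) * P * V \<epsilon> + (\<epsilon> + 1) * Q * V (\<epsilon> + 1))"
    proof -
      have arg: "\<beta> - \<kappa> * a + 2 * a * (\<epsilon> + 1) - 2 * a = \<beta> - \<kappa> * a + 2 * a * \<epsilon>" by algebra
      show ?thesis unfolding c_def V_def arg by algebra
    qed
    then have "(\<epsilon> - \<kappa>) * P * V \<epsilon> + (\<epsilon> + 1) * Q * V (\<epsilon> + 1) = 0" using c_0 pos by simp
    then show ?thesis using pos by (simp add: field_simps) algebra?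
  qed
  have supp: "{\<alpha>. w \<alpha> \<noteq> 0} = A" using W by (force simp: w_def)
  have supp_V: "A = (\<lambda>\<epsilon>. \<beta> - \<kappa> * a + 2 * a * \<epsilon>) ` {\<epsilon>. V \<epsilon> \<noteq> 0}"
  proof (intro equalityI subsetI)
    fix \<alpha> assume \<alpha>: "\<alpha> \<in> A"
    have eq: "\<alpha> = \<beta> - \<kappa> * a + 2 * a * ((\<alpha> - \<beta> + \<kappa> * a) / (2 * a))" using pos by simp
    moreover have "V ((\<alpha> - \<beta> + \<kappa> * a) / (2 * a)) \<noteq> 0"
      unfolding V_def eq[symmetric] using \<alpha> supp by blast
    ultimately show "\<alpha> \<in> (\<lambda>\<epsilon>. \<beta> - \<kappa> * a + 2 * a * \<epsilon>) ` {\<epsilon>. V \<epsilon> \<noteq> 0}" by blast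
  next
    fix \<alpha> assume "\<alpha> \<in> (\<lambda>\<epsilon>. \<beta> - \<kappa> * a + 2 * a * \<epsilon>) ` {\<epsilon>. V \<epsilon> \<noteq> 0}"
    then show "\<alpha> \<in> A" using supp unfolding V_def by blast
  qed
  have "inj_on (\<lambda>\<epsilon>. \<beta> - \<kappa> * a + 2 * a * \<epsilon>) {\<epsilon>. V \<epsilon> \<noteq> 0}"
    using pos by (auto simp: inj_on_def)
  then have finV: "finite {\<epsilon>. V \<epsilon> \<noteq> 0}"
    using fin supp_V finite_imageD by metis
  obtain \<epsilon>\<^sub>0 where \<epsilon>\<^sub>0: "V \<epsilon>\<^sub>0 \<noteq> 0" using ne supp_V by auto
  have PQ: "P / Q > 0" using pos by simp
  obtain n :: nat where n: "\<kappa> = real n" "{\<epsilon>. V \<epsilon> \<noteq> 0} = real ` {0..n}"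
    "\<And>j. V (real j) = V 0 * real (n choose j) * (P / Q) ^ j" "V 0 \<noteq> 0"
    using binomial_recurrence[OF finV \<epsilon>\<^sub>0 PQ rec] by blast
  have A: "A = (\<lambda>j. \<beta> - \<kappa> * a + 2 * a * real j) ` {0..n}"
    unfolding supp_V n(2) image_image ..
  have Vw: "W (\<beta> - \<kappa> * a + 2 * a * real j) = V (real j)" if "j \<le> n" for j
    using that unfolding V_def w_def A by auto
  have "W (\<beta> - \<kappa> * a + 2 * a * real 0) > 0"
    by (rule W, unfold A, rule imageI) simp
  then have "V 0 > 0" using Vw[of 0] by simp
  then show ?thesis
    using that[of n "V 0"] n(1,3) A Vw by simp
qed

text \<open>Otherwise \<open>f\<close> grows at least linearly.\<close>

lemma bounded_imp_small_derivative:
  fixes f :: "real \<Rightarrow> real"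
  assumes der: "\<And>x. (f has_real_derivative f' x) (at x)" and bound: "\<And>x. \<bar>f x\<bar> \<le> B"
    and "\<delta> > 0"
  obtains x where "x > 0" "f' x < \<delta>"
proof (rule ccontr)
  assume "\<not> thesis"
  then have ge: "f' x \<ge> \<delta>" if "x > 0" for x using that \<open>\<And>x. _ \<Longrightarrow> _ \<Longrightarrow> thesis\<close> by force
  define L where "L = (2 * B + 1) / \<delta>"
  have B: "B \<ge> 0" using bound[of 0] by linarith
  then have "L > 0" using \<open>\<delta> > 0\<close> by (simp add: L_def)
  then obtain \<xi> where \<xi>: "\<xi> > 0" "f L - f 0 = (L - 0) * f' \<xi>"
    using MVT2[of 0 L f f'] der by auto
  have "L * \<delta> \<le> L * f' \<xi>" using ge[OF \<xi>(1)] \<open>L > 0\<close> by simp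
  then have "2 * B + 1 \<le> f L - f 0" using \<xi>(2) \<open>\<delta> > 0\<close> by (simp add: L_def)
  then show False using bound[of L] bound[of 0] by linarith
qed

text \<open>Boundedness of \<open>f\<close> forces \<open>r\<close> to be unbounded on both half-lines. If \<open>\<mu> \<le> 0\<close>, then \<open>r\<close> is concave, and a
  positive concave function on the line is constant. If \<open>\<mu> = a\<^sup>2\<close> with \<open>a > 0\<close>, then \<open>r' + a r\<close> and \<open>r' - a r\<close>
  are multiples of \<open>exp (a x)\<close> and \<open>exp (- a x)\<close>, and a coefficient \<open>P \<le> 0\<close> or \<open>Q \<le> 0\<close> would make \<open>r\<close>
  bounded on a half-line.\<close>

lemma positive_ode_solution:
  fixes r :: "real \<Rightarrow> real"
  assumes r: "\<And>x. r x > 0" and r': "\<And>x. (r has_real_derivative r1 x) (at x)"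
    and r'': "\<And>x. (r1 has_real_derivative \<mu> * r x) (at x)"
    and f: "\<And>x. (f has_real_derivative 1 / (r x)\<^sup>2) (at x)" and bound: "\<And>x. \<bar>f x\<bar> \<le> B"
  obtains a P Q where "a > 0" "P > 0" "Q > 0" "\<And>x. r x = P * exp (a * x) + Q * exp (- a * x)"
    "\<And>x. r1 x = a * (P * exp (a * x) - Q * exp (- a * x))" "\<mu> = a\<^sup>2"
proof -
  have f': "((\<lambda>x. - f (- x)) has_real_derivative 1 / (r (- x))\<^sup>2) (at x)" for x
    using DERIV_minus[OF DERIV_mirror[THEN iffD1, OF f[of "- x"]]] by simp
  have bound': "\<bar>- f (- x)\<bar> \<le> B" for x using bound[of "- x"] by simp
  have no_bound: "\<exists>x>0. r x > R" "\<exists>x<0. r x > R" for R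
  proof -
    define R' where "R' = \<bar>R\<bar> + 1"
    have R': "1 / R'\<^sup>2 > 0" "R' > 0" by (simp_all add: R'_def add_nonneg_pos zero_less_power)
    have gt: "r x > R" if "1 / (r x)\<^sup>2 < 1 / R'\<^sup>2" for x
    proof (rule ccontr)
      assume "\<not> r x > R"
      then have "r x \<le> R'" by (simp add: R'_def)
      then have "(r x)\<^sup>2 \<le> R'\<^sup>2" using r[of x] by (simp add: power_mono)
      then have "1 / R'\<^sup>2 \<le> 1 / (r x)\<^sup>2" using r[of x] by (simp add: frac_le)
      with that show False by simp
    qed
    show "\<exists>x>0. r x > R"
      using bounded_imp_small_derivative[OF f bound R'(1)] gt by blast
    obtain x where "x > 0" "1 / (r (- x))\<^sup>2 < 1 / R'\<^sup>2"
      using bounded_imp_small_derivative[OF f' bound' R'(1)] by blast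
    then show "\<exists>x<0. r x > R" using gt by (intro exI[of _ "- x"]) simp
  qed
  have "\<mu> > 0"
  proof (rule ccontr)
    assume "\<not> \<mu> > 0"
    then have \<mu>: "\<mu> * r x \<le> 0" for x using r[of x] by (simp add: mult_nonpos_nonneg)
    have anti: "r1 y \<le> r1 x" if "x \<le> y" for x y
      by (rule DERIV_nonpos_imp_nonincreasing[OF that]) (use r'' \<mu> in blast)
    have tangent: "r y \<le> r x + r1 x * (y - x)" for x y
    proof (cases x y rule: linorder_cases)
      case less
      then obtain \<xi> where "x < \<xi>" "\<xi> < y" "r y - r x = (y - x) * r1 \<xi>"
        using MVT2[of x y r r1] r' by auto
      moreover from this have "(y - x) * r1 \<xi> \<le> (y - x) * r1 x"
        using anti[of x \<xi>] less by (intro mult_left_mono) auto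
      ultimately show ?thesis by (simp add: algebra_simps)
    next
      case greater
      then obtain \<xi> where "y < \<xi>" "\<xi> < x" "r x - r y = (x - y) * r1 \<xi>"
        using MVT2[of y x r r1] r' by auto
      moreover from this have "(x - y) * r1 x \<le> (x - y) * r1 \<xi>"
        using anti[of \<xi> x] greater by (intro mult_left_mono) auto
      ultimately show ?thesis by (simp add: algebra_simps)
    qed simp
    have zero: "r1 x = 0" for x
    proof (rule ccontr)
      assume "r1 x \<noteq> 0"
      then have "r (x - r x / r1 x) \<le> 0" using tangent[of "x - r x / r1 x" x] by simp
      then show False using r[of "x - r x / r1 x"] by simp
    qed
    have "r x \<le> r 0" for x using tangent[of x 0] zero by simp
    with no_bound(1)[of "r 0"] show False by (auto simp: not_less[symmetric])
  qed
  define a where "a = sqrt \<mu>"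
  have a: "a > 0" "\<mu> = a * a" using \<open>\<mu> > 0\<close> by (simp_all add: a_def)
  have const: "u x = u 0 * exp (b * x)" if u: "\<And>x. (u has_real_derivative b * u x) (at x)" for u :: "real \<Rightarrow> real" and b x
  proof -
    have "((\<lambda>x. u x * exp (- b * x)) has_real_derivative 0) (at x)" for x
      by (rule derivative_eq_intros u refl | simp)+
    then have "u x * exp (- b * x) = u 0 * exp (- b * 0)"
      using DERIV_isconst_all[of "\<lambda>x. u x * exp (- b * x)"] by blast
    then have "u x * (exp (- b * x) * exp (b * x)) = u 0 * exp (b * x)"
      by (simp add: mult.assoc[symmetric])
    then show ?thesis by (simp flip: exp_add)
  qed
  have u: "r1 x + a * r x = (r1 0 + a * r 0) * exp (a * x)" for x
  proof (rule const[of "\<lambda>x. r1 x + a * r x" a])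
    show "((\<lambda>x. r1 x + a * r x) has_real_derivative a * (r1 x + a * r x)) (at x)" for x
      by (rule DERIV_cong[OF DERIV_add[OF r'' DERIV_cmult[OF r']]]) (simp add: a(2) algebra_simps)
  qed
  have v: "r1 x - a * r x = (r1 0 - a * r 0) * exp (- a * x)" for x
  proof (rule const[of "\<lambda>x. r1 x - a * r x" "- a"])
    show "((\<lambda>x. r1 x - a * r x) has_real_derivative - a * (r1 x - a * r x)) (at x)" for x
      by (rule DERIV_cong[OF DERIV_diff[OF r'' DERIV_cmult[OF r']]]) (simp add: a(2) algebra_simps)
  qed
  define P Q where "P = (r1 0 + a * r 0) / (2 * a)" and "Q = - (r1 0 - a * r 0) / (2 * a)"
  have PQ: "r1 0 + a * r 0 = 2 * a * P" "r1 0 - a * r 0 = - (2 * a * Q)" using a by (simp_all add: P_def Q_def)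
  have r_eq: "r x = P * exp (a * x) + Q * exp (- a * x)" for x
  proof -
    have "2 * a * r x = 2 * a * (P * exp (a * x) + Q * exp (- a * x))"
      using u[of x] v[of x] unfolding PQ by (simp add: algebra_simps)
    then show ?thesis using a by simp
  qed
  have r1_eq: "r1 x = a * (P * exp (a * x) - Q * exp (- a * x))" for x
    using u[of x] v[of x] unfolding PQ by (simp add: algebra_simps)
  have "P > 0"
  proof (rule ccontr)
    assume "\<not> P > 0"
    then have le: "r x \<le> Q * exp (- a * x)" for x
      using r_eq[of x] mult_nonpos_nonneg[of P "exp (a * x)"] by simp
    then have "Q > 0" using r[of 0] le[of 0] by simp
    have "r x \<le> Q" if "x > 0" for x
    proof -
      have "exp (- a * x) \<le> 1" using that a by simp
      then have "Q * exp (- a * x) \<le> Q * 1" using \<open>Q > 0\<close> by (intro mult_left_mono) auto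
      then show ?thesis using le[of x] by simp
    qed
    with no_bound(1)[of Q] show False by force
  qed
  moreover have "Q > 0"
  proof (rule ccontr)
    assume "\<not> Q > 0"
    then have le: "r x \<le> P * exp (a * x)" for x
      using r_eq[of x] mult_nonpos_nonneg[of Q "exp (- a * x)"] by simp
    have "r x \<le> P" if "x < 0" for x
    proof -
      have "exp (a * x) \<le> 1" using that a by (simp add: mult_nonneg_nonpos)
      then have "P * exp (a * x) \<le> P * 1" using \<open>P > 0\<close> by (intro mult_left_mono) auto
      then show ?thesis using le[of x] by simp
    qed
    with no_bound(2)[of P] show False by force
  qed
  ultimately show ?thesis
    using that[OF a(1)] r_eq r1_eq a(2) by (simp add: power2_eq_square)
qed

section \<open>Hamiltonian Killing fields\<close>

text \<open>An inner product on a complex line for which multiplication by \<open>\<i>\<close> is orthogonal is determined by the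
  length of one vector.\<close>

lemma (in kahler_manifold) met_conformal:
  assumes "(U, \<phi>) \<in> atlas M" "p \<in> U"
  shows "met M \<phi> p u v = met M \<phi> p 1 1 * (u \<bullet> v)"
proof -
  note bil = met_bilinear[OF assms]
  have ii: "met M \<phi> p \<i> \<i> = met M \<phi> p 1 1"
    using met_hermitian[OF assms, of 1 1] by simp
  have "met M \<phi> p 1 \<i> = met M \<phi> p \<i> (- 1)"
    using met_hermitian[OF assms, of 1 \<i>] by simp
  also have "\<dots> = - met M \<phi> p 1 \<i>"
    using bilinear_rneg[OF bil, of \<i> 1] met_sym[OF assms, of \<i> 1] by simp
  finally have i1: "met M \<phi> p 1 \<i> = 0" "met M \<phi> p \<i> 1 = 0"
    using met_sym[OF assms, of \<i> 1] by simp_all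
  have dec: "z = Re z *\<^sub>R 1 + Im z *\<^sub>R \<i>" for z by (simp add: complex_eq_iff)
  have "met M \<phi> p u v = met M \<phi> p (Re u *\<^sub>R 1 + Im u *\<^sub>R \<i>) (Re v *\<^sub>R 1 + Im v *\<^sub>R \<i>)"
    using dec[of u] dec[of v] by simp
  also have "\<dots> = met M \<phi> p 1 1 * (u \<bullet> v)"
    unfolding bilinear_ladd[OF bil] bilinear_radd[OF bil] bilinear_lmul[OF bil] bilinear_rmul[OF bil] i1 ii
    by (simp add: inner_complex_def algebra_simps)
  finally show ?thesis .
qed

text \<open>The field \<open>- \<i> grad f / \<rho>\<close>. By the next lemma it is the Hamiltonian vector field of \<open>f\<close> for the Kaehler form
  of the metric \<open>\<rho> |dz|\<^sup>2\<close>.\<close>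

definition hamiltonian :: "(complex \<Rightarrow> real) \<Rightarrow> (complex \<Rightarrow> real) \<Rightarrow> complex \<Rightarrow> complex" where
  "hamiltonian \<rho> f z = Complex (frechet_derivative f (at z) \<i> / \<rho> z) (- frechet_derivative f (at z) 1 / \<rho> z)"

lemma hamiltonian_eq_iff:
  assumes "f differentiable (at z)" "\<rho> z \<noteq> 0"
  shows "x = hamiltonian \<rho> f z \<longleftrightarrow> (\<forall>v. \<rho> z * ((\<i> * x) \<bullet> v) = frechet_derivative f (at z) v)"
proof
  have L: "linear (frechet_derivative f (at z))"
    using assms(1) by (rule linear_frechet_derivative)
  show "\<forall>v. \<rho> z * ((\<i> * x) \<bullet> v) = frechet_derivative f (at z) v" if x: "x = hamiltonian \<rho> f z"
  proof
    fix v
    have "\<rho> z * ((\<i> * x) \<bullet> v) = Re v * frechet_derivative f (at z) 1 + Im v * frechet_derivative f (at z) \<i>"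
      using assms(2) by (simp add: x hamiltonian_def inner_complex_def field_simps)
    then show "\<rho> z * ((\<i> * x) \<bullet> v) = frechet_derivative f (at z) v"
      using linear_complex_real[OF L, of v] by simp
  qed
  assume *: "\<forall>v. \<rho> z * ((\<i> * x) \<bullet> v) = frechet_derivative f (at z) v"
  have "- (\<rho> z * Im x) = frechet_derivative f (at z) 1" "\<rho> z * Re x = frechet_derivative f (at z) \<i>"
    using *[rule_format, of 1] *[rule_format, of \<i>] by (simp_all add: inner_complex_def)
  then show "x = hamiltonian \<rho> f z"
    using assms(2) by (simp add: hamiltonian_def complex_eq_iff field_simps)
qed

text \<open>Here \<open>l\<close> is the conformal factor at \<open>w\<close> and \<open>d\<close> its derivative in the direction of the field. The Killing
  equation says that the symmetric part of \<open>DX\<close> is a multiple of the identity, which means that \<open>DX\<close> is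
  complex linear.\<close>

lemma killing_imp_holomorphic:
  fixes X :: "complex \<Rightarrow> complex"
  assumes X: "(X has_derivative DX) (at w)" and "l > 0"
    and killing: "\<And>u v. d * (u \<bullet> v) + l * (DX u \<bullet> v) + l * (u \<bullet> DX v) = 0"
  shows "(X has_field_derivative DX 1) (at w)" "d + 2 * l * Re (DX 1) = 0"
proof -
  have 1: "d + 2 * l * Re (DX 1) = 0"
    using killing[of 1 1] by (simp add: inner_complex_def)
  have 2: "d + 2 * l * Im (DX \<i>) = 0"
    using killing[of \<i> \<i>] by (simp add: inner_complex_def)
  have "l * (Im (DX 1) + Re (DX \<i>)) = 0"
    using killing[of 1 \<i>] by (simp add: inner_complex_def algebra_simps)
  then have "Re (DX \<i>) = - Im (DX 1)" using \<open>l > 0\<close> by simp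
  moreover have "Im (DX \<i>) = Re (DX 1)"
  proof -
    have "2 * l * Re (DX 1) = 2 * l * Im (DX \<i>)" using 1 2 by linarith
    then show ?thesis using \<open>l > 0\<close> by simp
  qed
  ultimately have i: "DX \<i> = \<i> * DX 1" by (simp add: complex_eq_iff)
  have lin: "linear DX" using X by (rule has_derivative_linear)
  have "DX v = DX 1 * v" for v
  proof -
    have "v = Re v *\<^sub>R 1 + Im v *\<^sub>R \<i>" by (simp add: complex_eq_iff)
    then have "DX v = DX (Re v *\<^sub>R 1 + Im v *\<^sub>R \<i>)" by simp
    also have "\<dots> = Re v *\<^sub>R DX 1 + Im v *\<^sub>R DX \<i>"
      by (simp add: linear_add[OF lin] linear_scale[OF lin])
    also have "\<dots> = DX 1 * v"
      unfolding i by (simp add: complex_eq_iff algebra_simps)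
    finally show ?thesis .
  qed
  then have "DX = (*) (DX 1)" by (rule ext)
  then show "(X has_field_derivative DX 1) (at w)"
    using X by (simp add: has_field_derivative_def)
  show "d + 2 * l * Re (DX 1) = 0" by (rule 1)
qed

text \<open>The map \<open>g\<close> is a local holomorphic isometry from \<open>h (Re z) |dz|\<^sup>2\<close> to \<open>\<rho> |dw|\<^sup>2\<close>. The Hamiltonian field \<open>Y\<close>
  of \<open>F = f \<circ> g\<close> is therefore the pullback \<open>(X \<circ> g) / g'\<close> of the field \<open>X\<close> of \<open>f\<close>, hence holomorphic, and
  the Killing equation for \<open>X\<close> becomes the one for \<open>Y\<close>.\<close>

lemma hamiltonian_pullback:
  fixes \<rho> f :: "complex \<Rightarrow> real" and h :: "real \<Rightarrow> real"
  assumes W: "open W" "z\<^sub>0 \<in> W" and g: "g holomorphic_on W" "\<And>z. z \<in> W \<Longrightarrow> deriv g z \<noteq> 0" "\<And>z. z \<in> W \<Longrightarrow> g z \<in> V"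
    and f: "\<And>w. w \<in> V \<Longrightarrow> f differentiable (at w)"
    and \<rho>: "\<And>w. w \<in> V \<Longrightarrow> \<rho> w > 0" "(\<rho> has_derivative D\<rho>) (at (g z\<^sub>0))"
    and X: "(hamiltonian \<rho> f has_field_derivative X') (at (g z\<^sub>0))"
    and killing: "D\<rho> (hamiltonian \<rho> f (g z\<^sub>0)) + 2 * \<rho> (g z\<^sub>0) * Re X' = 0"
    and h: "\<And>z. z \<in> W \<Longrightarrow> h (Re z) = \<rho> (g z) * (cmod (deriv g z))\<^sup>2" "(h has_real_derivative h') (at (Re z\<^sub>0))"
    and F: "\<And>z. z \<in> W \<Longrightarrow> F z = f (g z)"
  defines "Y \<equiv> hamiltonian (\<lambda>z. h (Re z)) F"
  shows "F differentiable (at z\<^sub>0)"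
    "\<exists>Y'. (Y has_field_derivative Y') (at z\<^sub>0) \<and> h' * Re (Y z\<^sub>0) + 2 * h (Re z\<^sub>0) * Re Y' = 0"
proof -
  have gd: "(g has_derivative (*) (deriv g z)) (at z)" if "z \<in> W" for z
    using holomorphic_derivI[OF g(1) W(1) that] by (simp add: has_field_derivative_def)
  have FD: "(F has_derivative (\<lambda>v. frechet_derivative f (at (g z)) (deriv g z * v))) (at z)" if z: "z \<in> W" for z
  proof (rule has_derivative_transform_within_open[OF _ W(1) z])
    have "(f has_derivative frechet_derivative f (at (g z))) (at (g z))"
      using f[OF g(3)[OF z]] by (simp add: frechet_derivative_works)
    from diff_chain_at[OF gd[OF z] this]
    show "(f \<circ> g has_derivative (\<lambda>v. frechet_derivative f (at (g z)) (deriv g z * v))) (at z)"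
      by (simp add: o_def)
  qed (simp add: F)
  then show "F differentiable (at z\<^sub>0)" using W(2) by (auto simp: differentiable_def)
  have hpos: "h (Re z) > 0" if z: "z \<in> W" for z
    using h(1)[OF z] \<rho>(1)[OF g(3)[OF z]] g(2)[OF z] by simp
  define X where "X = hamiltonian \<rho> f"
  have Y: "X (g z) / deriv g z = Y z" if z: "z \<in> W" for z
    unfolding Y_def
  proof (subst hamiltonian_eq_iff)
    show "F differentiable (at z)" using FD[OF z] by (auto simp: differentiable_def)
    show "h (Re z) \<noteq> 0" using hpos[OF z] by simp
    show "\<forall>v. h (Re z) * ((\<i> * (X (g z) / deriv g z)) \<bullet> v) = frechet_derivative F (at z) v"
    proof
      fix v
      have "h (Re z) * ((\<i> * (X (g z) / deriv g z)) \<bullet> v) =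
          \<rho> (g z) * ((cmod (deriv g z))\<^sup>2 * ((\<i> * (X (g z) / deriv g z)) \<bullet> v))"
        unfolding h(1)[OF z] by (rule mult.assoc)
      also have "(cmod (deriv g z))\<^sup>2 * ((\<i> * (X (g z) / deriv g z)) \<bullet> v) =
          (deriv g z * (\<i> * (X (g z) / deriv g z))) \<bullet> (deriv g z * v)"
        by (rule inner_mult_complex[symmetric])
      also have "deriv g z * (\<i> * (X (g z) / deriv g z)) = \<i> * X (g z)"
        using g(2)[OF z] by simp
      also have "\<rho> (g z) * ((\<i> * X (g z)) \<bullet> (deriv g z * v)) = frechet_derivative f (at (g z)) (deriv g z * v)"
        using hamiltonian_eq_iff[of f "g z" \<rho> "X (g z)"] f[OF g(3)[OF z]] \<rho>(1)[OF g(3)[OF z]] by (simp add: X_def)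
      also have "\<dots> = frechet_derivative F (at z) v"
        by (rule fun_cong[OF frechet_derivative_at[OF FD[OF z]]])
      finally show "h (Re z) * ((\<i> * (X (g z) / deriv g z)) \<bullet> v) = frechet_derivative F (at z) v" .
    qed
  qed
  define a b where "a = deriv g z\<^sub>0" and "b = deriv (deriv g) z\<^sub>0"
  have a: "a \<noteq> 0" using g(2)[OF W(2)] by (simp add: a_def)
  have g1: "(g has_field_derivative a) (at z\<^sub>0)"
    unfolding a_def by (rule holomorphic_derivI[OF g(1) W])
  have g2: "(deriv g has_field_derivative b) (at z\<^sub>0)"
    unfolding b_def by (rule holomorphic_derivI[OF holomorphic_deriv[OF g(1) W(1)] W])
  define y where "y = Y z\<^sub>0"
  have Xy: "X (g z\<^sub>0) = a * y" using Y[OF W(2)] a by (simp add: y_def a_def field_simps)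
  have "((\<lambda>z. X (g z)) has_field_derivative X' * a) (at z\<^sub>0)"
    using DERIV_chain2[OF X[folded X_def] g1] .
  from DERIV_divide[OF this g2] a
  have "((\<lambda>z. X (g z) / deriv g z) has_field_derivative (X' * a * a - a * y * b) / (a * a)) (at z\<^sub>0)"
    unfolding a_def[symmetric] Xy by simp
  moreover have "(X' * a * a - a * y * b) / (a * a) = X' - y * b / a"
    using a by (simp add: field_simps)
  ultimately have Y1: "(Y has_field_derivative X' - y * b / a) (at z\<^sub>0)"
    using has_field_derivative_transform_within_open[OF _ W(1) W(2), of "\<lambda>z. X (g z) / deriv g z" _ Y] Y by simp
  have hR: "((\<lambda>z. h (Re z)) has_derivative (\<lambda>v. Re v * h')) (at z\<^sub>0)"
  proof -
    have "(h has_derivative (\<lambda>v. v * h')) (at (Re z\<^sub>0))"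
      using h(2) by (simp add: has_field_derivative_def mult_commute_abs)
    from diff_chain_at[OF bounded_linear_imp_has_derivative[OF bounded_linear_Re] this]
    show ?thesis by (simp add: o_def)
  qed
  have "((\<lambda>z. \<rho> (g z) * (deriv g z \<bullet> deriv g z)) has_derivative
      (\<lambda>v. \<rho> (g z\<^sub>0) * (a \<bullet> (b * v) + (b * v) \<bullet> a) + D\<rho> (a * v) * (a \<bullet> a))) (at z\<^sub>0)"
  proof -
    have 1: "((\<lambda>z. \<rho> (g z)) has_derivative (\<lambda>v. D\<rho> (a * v))) (at z\<^sub>0)"
      using diff_chain_at[OF g1[unfolded has_field_derivative_def] \<rho>(2)] by (simp add: o_def)
    have 2: "(deriv g has_derivative (\<lambda>v. b * v)) (at z\<^sub>0)"
      using g2 by (simp add: has_field_derivative_def)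
    show ?thesis
      using has_derivative_mult[OF 1 has_derivative_inner[OF 2 2]] by (simp add: a_def)
  qed
  then have "((\<lambda>z. h (Re z)) has_derivative
      (\<lambda>v. \<rho> (g z\<^sub>0) * (a \<bullet> (b * v) + (b * v) \<bullet> a) + D\<rho> (a * v) * (a \<bullet> a))) (at z\<^sub>0)"
    by (rule has_derivative_transform_within_open[OF _ W]) (simp add: h(1) dot_square_norm)
  from has_derivative_unique[OF hR this]
  have "Re y * h' = \<rho> (g z\<^sub>0) * (a \<bullet> (b * y) + (b * y) \<bullet> a) + D\<rho> (a * y) * (a \<bullet> a)"
    by (rule fun_cong)
  also have "D\<rho> (a * y) = - 2 * \<rho> (g z\<^sub>0) * Re X'"
    using killing unfolding X_def[symmetric] Xy by linarith
  finally have e1: "Re y * h' = 2 * \<rho> (g z\<^sub>0) * (a \<bullet> (b * y)) - 2 * \<rho> (g z\<^sub>0) * Re X' * (cmod a)\<^sup>2"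
    by (simp add: inner_commute[of "b * y"] dot_square_norm)
  have "Re (y * b / a) * (cmod a)\<^sup>2 = a \<bullet> (b * y)"
  proof -
    have "y * b = (y * b / a) * a" using a by simp
    then have "a \<bullet> (b * y) = (a * 1) \<bullet> (a * (y * b / a))" by (simp add: mult.commute)
    also have "\<dots> = (cmod a)\<^sup>2 * (1 \<bullet> (y * b / a))" by (rule inner_mult_complex)
    finally show ?thesis by (simp add: inner_complex_def)
  qed
  note Re_a = this
  have "2 * h (Re z\<^sub>0) * Re (X' - y * b / a) = 2 * \<rho> (g z\<^sub>0) * Re X' * (cmod a)\<^sup>2 - 2 * \<rho> (g z\<^sub>0) * (a \<bullet> (b * y))"
    unfolding h(1)[OF W(2)] a_def[symmetric] minus_complex.sel Re_a[symmetric] by algebra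
  with e1 have "h' * Re (Y z\<^sub>0) + 2 * h (Re z\<^sub>0) * Re (X' - y * b / a) = 0"
    by (simp add: y_def mult.commute)
  with Y1 show "\<exists>Y'. (Y has_field_derivative Y') (at z\<^sub>0) \<and> h' * Re (Y z\<^sub>0) + 2 * h (Re z\<^sub>0) * Re Y' = 0"
    by blast
qed

text \<open>The Killing equation says that \<open>\<surd>h Re Y\<close> does not depend on \<open>Re z\<close>, so that \<open>Re Y = k (Im z) r (Re z)\<close> with
  \<open>r = 1 / \<surd>h\<close>. The function \<open>k\<close> is not zero, since \<open>h Re Y\<close> is the derivative of \<open>F\<close> in the imaginary
  direction. As \<open>Y\<close> is entire, \<open>Re Y\<close> is harmonic, and separation of variables gives \<open>r'' = \<mu> r\<close>.
  Geometrically, a second Killing field besides the translations forces constant curvature, which is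
  \<open>\<mu> r\<^sup>2 - r'\<^sup>2\<close>.\<close>

lemma killing_field_imp_ode:
  fixes h :: "real \<Rightarrow> real" and F :: "complex \<Rightarrow> real"
  assumes hpos: "\<And>x. h x > 0" and h': "\<And>x. (h has_real_derivative h' x) (at x)"
    and F: "\<And>z. F differentiable (at z)"
    and Y: "\<And>z. \<exists>Y'. (hamiltonian (\<lambda>z. h (Re z)) F has_field_derivative Y') (at z) \<and>
      h' (Re z) * Re (hamiltonian (\<lambda>z. h (Re z)) F z) + 2 * h (Re z) * Re Y' = 0"
    and noninv: "F (Complex x\<^sub>0 y\<^sub>1) \<noteq> F (Complex x\<^sub>0 y\<^sub>2)"
  obtains \<mu> r1 where "\<And>x. ((\<lambda>x. 1 / sqrt (h x)) has_real_derivative r1 x) (at x)"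
    "\<And>x. (r1 has_real_derivative \<mu> * (1 / sqrt (h x))) (at x)"
proof -
  define Y0 where "Y0 = hamiltonian (\<lambda>z. h (Re z)) F"
  have d0: "(Y0 has_field_derivative deriv Y0 z) (at z)"
    and killing: "h' (Re z) * Re (Y0 z) + 2 * h (Re z) * Re (deriv Y0 z) = 0" for z
    using Y[of z] DERIV_imp_deriv unfolding Y0_def by (metis, metis)
  have hol: "Y0 holomorphic_on UNIV"
    using d0 by (auto simp: holomorphic_on_def field_differentiable_def)
  have d1: "(deriv Y0 has_field_derivative deriv (deriv Y0) z) (at z)" for z
    by (rule holomorphic_derivI[OF holomorphic_deriv[OF hol open_UNIV] open_UNIV UNIV_I])
  have C: "Complex x y = of_real x + \<i> * of_real y" for x y by (simp add: complex_eq_iff)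
  have dx: "((\<lambda>x. f (Complex x y)) has_vector_derivative f') (at x)"
    if "(f has_field_derivative f') (at (Complex x y))" for f :: "complex \<Rightarrow> complex" and f' x y
  proof -
    have "((\<lambda>x. Complex x y) has_vector_derivative 1) (at x)"
      unfolding C by (auto intro!: derivative_eq_intros)
    from field_vector_diff_chain_at[OF this that] show ?thesis by (simp add: o_def)
  qed
  have dy: "((\<lambda>y. f (Complex x y)) has_vector_derivative \<i> * f') (at y)"
    if "(f has_field_derivative f') (at (Complex x y))" for f :: "complex \<Rightarrow> complex" and f' x y
  proof -
    have "((\<lambda>y. Complex x y) has_vector_derivative \<i>) (at y)"
      unfolding C by (auto intro!: derivative_eq_intros)
    from field_vector_diff_chain_at[OF this that] show ?thesis by (simp add: o_def)
  qed
  have ReD: "((\<lambda>x. Re (f x)) has_real_derivative Re f') (at x)" and ImD: "((\<lambda>x. Im (f x)) has_real_derivative Im f') (at x)"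
    if "(f has_vector_derivative f') (at x)" for f :: "real \<Rightarrow> complex" and f' x
    using bounded_linear.has_vector_derivative[OF bounded_linear_Re that]
      bounded_linear.has_vector_derivative[OF bounded_linear_Im that]
    by (simp_all add: has_real_derivative_iff_has_vector_derivative)
  have const: "sqrt (h x) * Re (Y0 (Complex x y)) = sqrt (h 0) * Re (Y0 (Complex 0 y))" for x y
  proof -
    have "((\<lambda>x. sqrt (h x) * Re (Y0 (Complex x y))) has_real_derivative 0) (at x)" for x
    proof -
      define s where "s = sqrt (h x)"
      have s: "s > 0" "h x = s * s" using hpos[of x] by (simp_all add: s_def)
      have "((\<lambda>x. sqrt (h x)) has_real_derivative h' x * (inverse s / 2)) (at x)"
        unfolding s_def using DERIV_chain2[OF DERIV_real_sqrt[OF hpos[of x]] h'[of x]] by (simp add: mult.commute)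
      from DERIV_mult[OF this ReD[OF dx[OF d0[of "Complex x y"]]]]
      have "((\<lambda>x. sqrt (h x) * Re (Y0 (Complex x y))) has_real_derivative
          h' x * (inverse s / 2) * Re (Y0 (Complex x y)) + Re (deriv Y0 (Complex x y)) * s) (at x)"
        by (simp add: s_def)
      moreover have "h' x * (inverse s / 2) * Re (Y0 (Complex x y)) + Re (deriv Y0 (Complex x y)) * s =
          inverse s / 2 * (h' x * Re (Y0 (Complex x y)) + 2 * h x * Re (deriv Y0 (Complex x y)))"
        using s by (simp add: field_simps)
      ultimately show ?thesis using killing[of "Complex x y"] by (simp only: complex.sel mult_zero_right)
    qed
    then show ?thesis
      using DERIV_isconst_all[of "\<lambda>x. sqrt (h x) * Re (Y0 (Complex x y))" x 0] by blast
  qed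
  have "\<exists>y. Re (Y0 (Complex x\<^sub>0 y)) \<noteq> 0"
  proof (rule ccontr)
    assume no: "\<nexists>y. Re (Y0 (Complex x\<^sub>0 y)) \<noteq> 0"
    have "((\<lambda>y. F (Complex x\<^sub>0 y)) has_real_derivative 0) (at y)" for y
    proof -
      define z where "z = Complex x\<^sub>0 y"
      have FD: "(F has_derivative frechet_derivative F (at z)) (at z)"
        using F[of z] by (simp add: frechet_derivative_works)
      have "((\<lambda>y. Complex x\<^sub>0 y) has_derivative (\<lambda>t. t *\<^sub>R \<i>)) (at y)"
        unfolding C by (auto intro!: derivative_eq_intros simp: scaleR_conv_of_real)
      from diff_chain_at[OF this FD[unfolded z_def]]
      have "((\<lambda>y. F (Complex x\<^sub>0 y)) has_derivative (\<lambda>t. frechet_derivative F (at z) (t *\<^sub>R \<i>))) (at y)"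
        by (simp add: o_def z_def)
      moreover have "frechet_derivative F (at z) (t *\<^sub>R \<i>) = 0" for t
      proof -
        have "\<forall>v. h (Re z) * ((\<i> * Y0 z) \<bullet> v) = frechet_derivative F (at z) v"
          using hamiltonian_eq_iff[of F z "\<lambda>z. h (Re z)" "Y0 z"] F[of z] hpos[of "Re z"] by (simp add: Y0_def)
        from this[rule_format, of "t *\<^sub>R \<i>"]
        have "frechet_derivative F (at z) (t *\<^sub>R \<i>) = h (Re z) * ((\<i> * Y0 z) \<bullet> (t *\<^sub>R \<i>))"
          by (rule sym)
        also have "\<dots> = 0" using no by (simp add: inner_complex_def z_def)
        finally show ?thesis .
      qed
      ultimately have "((\<lambda>y. F (Complex x\<^sub>0 y)) has_derivative (\<lambda>t. 0)) (at y)"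
        by simp
      then show ?thesis
        unfolding has_field_derivative_def by (rule has_derivative_eq_rhs) auto
    qed
    then have "F (Complex x\<^sub>0 y\<^sub>1) = F (Complex x\<^sub>0 y\<^sub>2)"
      using DERIV_isconst_all[of "\<lambda>y. F (Complex x\<^sub>0 y)" y\<^sub>1 y\<^sub>2] by blast
    with noninv show False by simp
  qed
  then obtain y\<^sub>0 where y\<^sub>0: "Re (Y0 (Complex x\<^sub>0 y\<^sub>0)) \<noteq> 0" by blast
  define r where "r x = 1 / sqrt (h x)" for x
  have r: "r x > 0" for x using hpos[of x] by (simp add: r_def)
  have sep: "Re (Y0 (Complex x y)) = Re (Y0 (Complex 0 y)) * (r x / r 0)" for x y
    using const[of x y] hpos[of x] hpos[of 0] by (simp add: r_def field_simps)
  define k where "k = Re (Y0 (Complex 0 y\<^sub>0)) / r 0"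
  have k: "k \<noteq> 0" using y\<^sub>0 sep[of x\<^sub>0 y\<^sub>0] r[of 0] by (auto simp: k_def)
  have r_eq: "r x = Re (Y0 (Complex x y\<^sub>0)) / k" for x
    using sep[of x y\<^sub>0] k by (simp add: k_def field_simps)
  define r1 where "r1 x = Re (deriv Y0 (Complex x y\<^sub>0)) / k" for x
  have r1: "(r has_real_derivative r1 x) (at x)" for x
    unfolding r_eq[abs_def] r1_def by (intro DERIV_cdivide ReD[OF dx[OF d0]])
  have r2: "(r1 has_real_derivative Re (deriv (deriv Y0) (Complex x y\<^sub>0)) / k) (at x)" for x
    unfolding r1_def[abs_def] by (intro DERIV_cdivide ReD[OF dx[OF d1]])
  have Im_eq: "Im (deriv Y0 (Complex x y)) = Im (deriv Y0 (Complex 0 y)) * (r x / r 0)" for x y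
  proof -
    have "((\<lambda>y. Re (Y0 (Complex x y))) has_real_derivative Re (\<i> * deriv Y0 (Complex x y))) (at y)"
      by (rule ReD[OF dy[OF d0]])
    moreover have "((\<lambda>y. Re (Y0 (Complex x y))) has_real_derivative Re (\<i> * deriv Y0 (Complex 0 y)) * (r x / r 0)) (at y)"
      unfolding sep[of x] by (rule DERIV_cmult_right[OF ReD[OF dy[OF d0]]])
    ultimately have "Re (\<i> * deriv Y0 (Complex x y)) = Re (\<i> * deriv Y0 (Complex 0 y)) * (r x / r 0)"
      by (rule DERIV_unique)
    then show ?thesis by simp
  qed
  have Re_eq: "Re (deriv (deriv Y0) (Complex x y)) = Re (deriv (deriv Y0) (Complex 0 y)) * (r x / r 0)" for x y
  proof -
    have "((\<lambda>y. Im (deriv Y0 (Complex x y))) has_real_derivative Im (\<i> * deriv (deriv Y0) (Complex x y))) (at y)"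
      by (rule ImD[OF dy[OF d1]])
    moreover have "((\<lambda>y. Im (deriv Y0 (Complex x y))) has_real_derivative Im (\<i> * deriv (deriv Y0) (Complex 0 y)) * (r x / r 0)) (at y)"
      unfolding Im_eq[of x] by (rule DERIV_cmult_right[OF ImD[OF dy[OF d1]]])
    ultimately have "Im (\<i> * deriv (deriv Y0) (Complex x y)) = Im (\<i> * deriv (deriv Y0) (Complex 0 y)) * (r x / r 0)"
      by (rule DERIV_unique)
    then show ?thesis by simp
  qed
  \<comment> \<open>Along vertical lines the second derivative of \<open>Re Y\<close> is minus the real part of the second complex
    derivative; comparing \<open>Re z = x\<close> with \<open>Re z = 0\<close> gives the eigenvalue.\<close>
  define \<mu> where "\<mu> = Re (deriv (deriv Y0) (Complex 0 y\<^sub>0)) / (r 0 * k)"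
  have "(r1 has_real_derivative \<mu> * r x) (at x)" for x
    using r2[of x] unfolding Re_eq[of x] \<mu>_def by (simp add: mult.commute)
  then show ?thesis
    using that[of r1 \<mu>] r1 unfolding r_def[abs_def] by simp
qed

section \<open>Quotients by a parallel lattice\<close>

lemma open_preimage_continuous_map:
  assumes "continuous_map euclidean Y f" "openin Y U"
  shows "open {z. f z \<in> U}"
proof -
  have "openin euclidean {z \<in> topspace euclidean. f z \<in> U}"
    using assms by (rule openin_continuous_map_preimage)
  then show ?thesis by (simp only: open_openin topspace_euclidean UNIV_I simp_thms)
qed

text \<open>The affine coordinate identifies \<open>M\<close> with the real line and its tangent bundle with the complex plane.
  The lattice generated by the parallel field with coefficient \<open>b\<close> acts by the translations by integer
  multiples of \<open>\<i> b\<close>.\<close>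

locale lattice_quotient_of_line =
  fixes M :: "'m dually_flat" and X :: "'m \<Rightarrow> real" and b :: real
  assumes inj: "inj_on (coord M) (dpts M)" and surj: "coord M ` dpts M = UNIV"
    and X_const: "\<And>p. p \<in> dpts M \<Longrightarrow> X p = b" and b_nz: "b \<noteq> 0"
begin

definition pt :: "real \<Rightarrow> 'm" where "pt = inv_into (dpts M) (coord M)"

text \<open>The quotient map in the coordinate \<open>z\<close> of the tangent bundle.\<close>

definition orb :: "complex \<Rightarrow> ('m \<times> real) set" where
  "orb z = lattice_proj X (pt (Re z), Im z)"

lemma pt [simp]: "pt x \<in> dpts M" "coord M (pt x) = x"
  using surj unfolding pt_def by (auto intro: inv_into_into f_inv_into_f)

lemma pt_coord [simp]: "p \<in> dpts M \<Longrightarrow> pt (coord M p) = p"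
  unfolding pt_def by (rule inv_into_f_f[OF inj])

lemma pt_eq_iff [simp]: "pt x = pt y \<longleftrightarrow> x = y"
  using pt(2) by metis

lemma orb_def': "orb z = {(pt (Re z), Im z + of_int k * b) |k :: int. True}"
  by (simp add: orb_def lattice_proj_def X_const)

lemma orb_eq_iff: "orb z = orb z' \<longleftrightarrow> (\<exists>k :: int. z' = z + of_int k * (\<i> * of_real b))"
proof
  assume "orb z = orb z'"
  moreover have "(pt (Re z'), Im z' + of_int 0 * b) \<in> orb z'"
    unfolding orb_def' by blast
  ultimately have "(pt (Re z'), Im z' + of_int 0 * b) \<in> orb z" by simp
  then obtain k :: int where "pt (Re z') = pt (Re z)" "Im z' = Im z + of_int k * b"
    unfolding orb_def' by auto
  then have "z' = z + of_int k * (\<i> * of_real b)"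
    by (simp add: complex_eq_iff)
  then show "\<exists>k :: int. z' = z + of_int k * (\<i> * of_real b)" ..
next
  assume "\<exists>k :: int. z' = z + of_int k * (\<i> * of_real b)"
  then obtain k :: int where k: "z' = z + of_int k * (\<i> * of_real b)" ..
  have "Im z' + of_int l * b = Im z + of_int (l + k) * b" "Im z + of_int l * b = Im z' + of_int (l - k) * b" for l
    by (simp_all add: k algebra_simps)
  moreover have "Re z' = Re z" by (simp add: k)
  ultimately show "orb z = orb z'"
    unfolding orb_def' by (auto; metis)
qed

lemma topspace_tangent_bundle: "topspace (tops (tangent_bundle M)) = dpts M \<times> UNIV"
  by (simp add: tangent_bundle_def topspace_pullback_topology)

lemma homeomorphic_maps_tangent_bundle:
  "homeomorphic_maps euclidean (tops (tangent_bundle M)) (\<lambda>z. (pt (Re z), Im z)) (tcoord M)"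
  unfolding homeomorphic_maps_def
proof (intro conjI ballI)
  have tc: "tcoord M \<circ> (\<lambda>z. (pt (Re z), Im z)) = id"
    by (auto simp: tcoord_def complex_eq_iff)
  show "continuous_map euclidean (tops (tangent_bundle M)) (\<lambda>z. (pt (Re z), Im z))"
    unfolding tangent_bundle_def hermitian.select_convs
    by (rule continuous_map_pullback') (auto simp: tc id_def)
  show "continuous_map (tops (tangent_bundle M)) euclidean (tcoord M)"
    unfolding tangent_bundle_def hermitian.select_convs
    using continuous_map_pullback[OF continuous_map_id, of "dpts M \<times> UNIV" "tcoord M"] by (simp add: o_def id_def)
qed (auto simp: tcoord_def topspace_tangent_bundle complex_eq_iff)

lemma quotient_map_orb: "quotient_map euclidean (tops (lattice_quotient M X)) orb"
proof -
  have "quotient_map euclidean (tops (tangent_bundle M)) (\<lambda>z. (pt (Re z), Im z))"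
    using homeomorphic_maps_tangent_bundle homeomorphic_map_maps unfolding homeomorphic_map_def by blast
  moreover have "quotient_map (tops (tangent_bundle M)) (tops (lattice_quotient M X)) (lattice_proj X)"
    unfolding lattice_quotient_def hermitian.select_convs by (rule quotient_map_quotient_topology)
  ultimately have "quotient_map euclidean (tops (lattice_quotient M X)) (lattice_proj X \<circ> (\<lambda>z. (pt (Re z), Im z)))"
    by (rule quotient_map_compose)
  then show ?thesis by (simp add: o_def orb_def[abs_def])
qed

lemma pts_lattice_quotient: "pts (lattice_quotient M X) = range orb"
  using quotient_map_orb by (simp add: quotient_map_def)

lemma lattice_quotient_chart:
  assumes "(V, \<phi>) \<in> atlas (lattice_quotient M X)"
  shows "\<exists>S. open S \<and> inj_on orb S \<and> V = orb ` S \<and> (\<forall>z\<in>S. \<phi> (orb z) = z)"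
proof -
  obtain U where U: "openin (tops (tangent_bundle M)) U" "inj_on (lattice_proj X) U"
    and V: "V = lattice_proj X ` U" "\<phi> = tcoord M \<circ> inv_into U (lattice_proj X)"
    using assms unfolding lattice_quotient_def by auto
  have sub: "U \<subseteq> dpts M \<times> UNIV"
    using openin_subset[OF U(1)] topspace_tangent_bundle by simp
  define S where "S = {z. (pt (Re z), Im z) \<in> U}"
  have "open S"
    unfolding S_def using homeomorphic_maps_tangent_bundle U(1) unfolding homeomorphic_maps_def
    by (elim conjE) (rule open_preimage_continuous_map)
  have U_eq: "U = (\<lambda>z. (pt (Re z), Im z)) ` S"
  proof (intro equalityI subsetI)
    fix x assume x: "x \<in> U"
    then obtain p a where pa: "x = (p, a)" "p \<in> dpts M" using sub by auto
    then have "x = (\<lambda>z. (pt (Re z), Im z)) (Complex (coord M p) a)" by simp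
    moreover from this have "Complex (coord M p) a \<in> S" using x by (simp add: S_def)
    ultimately show "x \<in> (\<lambda>z. (pt (Re z), Im z)) ` S" by (rule image_eqI)
  qed (auto simp: S_def)
  have \<phi>: "\<phi> (orb z) = z" if "z \<in> S" for z
  proof -
    have "(pt (Re z), Im z) \<in> U" using that by (simp add: S_def)
    from inv_into_f_f[OF U(2) this] show ?thesis
      unfolding V orb_def by (simp add: tcoord_def)
  qed
  show ?thesis
  proof (intro exI[of _ S] conjI ballI \<phi> \<open>open S\<close>)
    show "V = orb ` S" unfolding V U_eq image_image orb_def ..
    show "inj_on orb S" using \<phi> by (metis inj_onI)
  qed
qed

lemma lattice_quotient_chartI:
  assumes "open S" "inj_on orb S"
  obtains \<phi> where "(orb ` S, \<phi>) \<in> atlas (lattice_quotient M X)" "\<And>z. z \<in> S \<Longrightarrow> \<phi> (orb z) = z"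
proof -
  define U where "U = (\<lambda>z. (pt (Re z), Im z)) ` S"
  have "openin (tops (tangent_bundle M)) U"
    unfolding U_def using homeomorphic_maps_tangent_bundle assms(1)
    by (metis homeomorphic_map_maps homeomorphic_map_openness_eq open_openin subset_UNIV topspace_euclidean)
  moreover have inj: "inj_on (lattice_proj X) U"
    using assms(2) unfolding U_def orb_def[abs_def] inj_on_def by auto
  ultimately have "(lattice_proj X ` U, tcoord M \<circ> inv_into U (lattice_proj X)) \<in> atlas (lattice_quotient M X)"
    unfolding lattice_quotient_def by auto
  moreover have "lattice_proj X ` U = orb ` S" unfolding U_def image_image orb_def ..
  moreover have "(tcoord M \<circ> inv_into U (lattice_proj X)) (orb z) = z" if "z \<in> S" for z
  proof -
    have "(pt (Re z), Im z) \<in> U" using that by (auto simp: U_def)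
    from inv_into_f_f[OF inj this] show ?thesis unfolding orb_def by (simp add: tcoord_def)
  qed
  ultimately show ?thesis using that by metis
qed

lemma inj_on_orb_ball: "inj_on orb (ball z (\<bar>b\<bar> / 2))"
proof (rule inj_onI)
  fix u v assume u: "u \<in> ball z (\<bar>b\<bar> / 2)" and v: "v \<in> ball z (\<bar>b\<bar> / 2)" and "orb u = orb v"
  then obtain k :: int where k: "v = u + of_int k * (\<i> * of_real b)" by (auto simp: orb_eq_iff)
  have "dist u v < \<bar>b\<bar>"
    using u v dist_triangle_half_r[of z u "\<bar>b\<bar>" v] by simp
  moreover have "u - v = - (of_int k * (\<i> * of_real b))" by (simp add: k)
  then have "dist u v = \<bar>real_of_int k\<bar> * \<bar>b\<bar>"
    unfolding dist_norm by (simp add: norm_mult)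
  ultimately have "\<bar>real_of_int k\<bar> * \<bar>b\<bar> < 1 * \<bar>b\<bar>" by simp
  then have "\<bar>real_of_int k\<bar> < 1" by (rule mult_right_less_imp_less) simp
  then have "k = 0" by linarith
  then show "u = v" using k by simp
qed

lemma met_lattice_quotient: "met (lattice_quotient M X) \<phi> (orb z) u v = hmet M (pt (Re z)) * (u \<bullet> v)"
proof -
  have "(pt (Re z), Im z + of_int 0 * b) \<in> orb z" unfolding orb_def' by blast
  then have "(SOME x. x \<in> orb z) \<in> orb z" by (rule someI)
  then have "fst (SOME x. x \<in> orb z) = pt (Re z)" unfolding orb_def' by auto
  then show ?thesis by (simp add: lattice_quotient_def tangent_bundle_def)
qed

lemma lattice_action_orb: "lattice_action X t (orb z) = orb (z + of_real t * (\<i> * of_real b))"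
proof -
  have "lattice_action X t (orb z) = {(pt (Re z), Im z + of_int k * b + t * b) |k :: int. True}"
    unfolding lattice_action_def orb_def' by (auto simp: X_const image_iff)
  then show ?thesis unfolding orb_def' by (simp add: algebra_simps)
qed

lemma loc_map_orb:
  assumes "inj_on orb S" "V = orb ` S" "\<And>z. z \<in> S \<Longrightarrow> \<phi> (orb z) = z" "z \<in> S"
  shows "loc_map V \<phi> \<psi> G z = \<psi> (G (orb z))"
proof -
  have "inj_on \<phi> V" unfolding assms(2) using assms(3) by (auto intro!: inj_onI)
  moreover have "orb z \<in> V" using assms(2,4) by blast
  ultimately have "inv_into V \<phi> (\<phi> (orb z)) = orb z" by (rule inv_into_f_f)
  then show ?thesis using assms(3,4) by (simp add: loc_map_def)
qed

end

section \<open>The projective line as a torification\<close>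

lemma open_aff0_image:
  assumes "open D" shows "openin proj_topology (aff0 ` D)"
proof -
  have ch: "(range aff0, proj_coord0) \<in> atlas (proj_line 1)" by (simp add: atlas_proj_line)
  have o: "openin proj_topology (range aff0)"
    and h: "homeomorphic_map (subtopology proj_topology (range aff0)) (top_of_set (proj_coord0 ` range aff0)) proj_coord0"
    using proj_line_chart[OF ch] by auto
  have "openin (subtopology proj_topology (range aff0)) (aff0 ` D)"
    unfolding homeomorphic_map_openness_eq[OF h] proj_coord_range
    using assms by (auto simp: openin_open)
  then show ?thesis using o openin_trans_full by blast
qed

lemma open_exp_image:
  assumes "open D" "a \<noteq> (0 :: complex)"
  shows "open ((\<lambda>z. exp (a * z - s)) ` D)"
proof -
  have inj: "inj (\<lambda>z. a * z - s)" using assms(2) by (auto simp: inj_on_def)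
  have "open ((\<lambda>z. a * z - s) ` D)"
    by (rule open_mapping_thm3[OF _ assms(1)]) (auto intro!: holomorphic_intros inj_on_subset[OF inj])
  moreover have "open (exp ` D')" if "open D'" for D' :: "complex set"
  proof (rule open_mapping_thm2[of exp UNIV])
    fix X :: "complex set" assume X: "open X" "X \<noteq> {}"
    show "\<not> exp constant_on X"
    proof
      assume "exp constant_on X"
      then obtain c where c: "\<And>x. x \<in> X \<Longrightarrow> exp x = c" by (auto simp: constant_on_def)
      obtain x where x: "x \<in> X" using X by blast
      have "((\<lambda>_. c) has_field_derivative exp x) (at x)"
        by (rule has_field_derivative_transform_within_open[OF DERIV_exp X(1) x]) (simp add: c)
      then have "exp x = 0" using DERIV_const DERIV_unique by blast
      then show False by simp
    qed
  qed (use that in \<open>auto intro: holomorphic_intros\<close>)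
  ultimately have "open (exp ` (\<lambda>z. a * z - s) ` D)" by blast
  then show ?thesis by (simp add: image_image)
qed

text \<open>The Fubini-Study metric in the coordinate \<open>ln w\<close>, whose real part is \<open>t\<close>.\<close>

lemma cosh_stereographic: "4 * (exp t)\<^sup>2 / (1 + (exp t)\<^sup>2)\<^sup>2 = 1 / (cosh t)\<^sup>2" for t :: real
proof -
  define e where "e = exp t"
  have e: "e > 0" by (simp add: e_def)
  have "cosh t = (1 + e\<^sup>2) / (2 * e)"
    using e by (simp add: cosh_field_def exp_minus e_def[symmetric] field_simps power2_eq_square)
  moreover have "1 + e\<^sup>2 > 0" using e by (simp add: add_pos_pos)
  ultimately show ?thesis
    using e unfolding e_def[symmetric] by (simp add: power_divide power_mult_distrib)
qed

text \<open>The map \<open>z \<mapsto> [exp (a z - s), 1]\<close> from the tangent bundle to the projective line is holomorphic with period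
  \<open>\<i> b\<close>, where \<open>b = 2 pi / a\<close>, its image is the free part of the action, and it turns the translations by
  \<open>\<i> b t\<close> into the rotations of the action. By the formula for the Fubini-Study metric in the coordinate
  \<open>ln w\<close> it is isometric exactly for the given \<open>h\<close>.\<close>

lemma regular_torification_proj_line:
  fixes M :: "'m dually_flat" and a s c :: real
  assumes M: "dually_flat_manifold M" and surj: "coord M ` dpts M = UNIV" and a: "a > 0" and c: "c > 0"
    and h: "\<And>x. hmet M (inv_into (dpts M) (coord M) x) = a\<^sup>2 / c / (cosh (a * x - s))\<^sup>2"
  shows "regular_torification M (proj_line c) proj_action"
proof -
  define b where "b = 2 * pi / a"
  define X where "X = (\<lambda>p :: 'm. b)"
  have b: "b \<noteq> 0" using a by (simp add: b_def)
  interpret lattice_quotient_of_line M X b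
    by unfold_locales (use dually_flat_manifold.inj_coord[OF M] surj b in \<open>auto simp: X_def\<close>)
  define E :: "complex \<Rightarrow> complex" where "E z = exp (of_real a * z - of_real s)" for z
  have E_nz: "E z \<noteq> 0" for z by (simp add: E_def)
  have E_eq: "E z = E z' \<longleftrightarrow> orb z = orb z'" for z z'
  proof -
    have "E z' = E z \<longleftrightarrow> (\<exists>n :: int. of_real a * z' - of_real s = of_real a * z - of_real s + of_real (of_int (2 * n) * pi) * \<i>)"
      unfolding E_def by (rule exp_eq)
    also have "\<dots> \<longleftrightarrow> (\<exists>k :: int. z' = z + of_int k * (\<i> * of_real b))"
    proof -
      have "of_real a * z' - of_real s = of_real a * z - of_real s + of_real (of_int (2 * n) * pi) * \<i> \<longleftrightarrow>
          z' = z + of_int n * (\<i> * of_real b)" for n :: int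
      proof -
        have cancel: "x - u = y - u + v \<longleftrightarrow> x = y + v" for x y u v :: complex
          by (simp add: diff_eq_eq)
        have period: "of_real (of_int (2 * n) * pi) * \<i> = of_real a * (of_int n * (\<i> * of_real b))"
          using a by (simp add: b_def)
        have "of_real a * z' - of_real s = of_real a * z - of_real s + of_real (of_int (2 * n) * pi) * \<i> \<longleftrightarrow>
            of_real a * z' = of_real a * (z + of_int n * (\<i> * of_real b))"
          unfolding cancel period distrib_left ..
        also have "\<dots> \<longleftrightarrow> z' = z + of_int n * (\<i> * of_real b)"
          using a by simp
        finally show ?thesis .
      qed
      then show ?thesis by simp
    qed
    also have "\<dots> \<longleftrightarrow> orb z = orb z'" by (rule orb_eq_iff[symmetric])
    finally show ?thesis by auto
  qed
  have E_surj: "\<exists>z. w = E z" if "w \<noteq> 0" for w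
    using a that by (intro exI[of _ "(Ln w + of_real s) / of_real a"]) (simp add: E_def)
  have E_der: "(E has_field_derivative of_real a * E z) (at z)" for z
    unfolding E_def[abs_def] by (auto intro!: derivative_eq_intros)
  have E_hol: "E holomorphic_on S" for S
    unfolding E_def[abs_def] by (intro holomorphic_intros)
  define G where "G y = aff0 (E (SOME z. orb z = y))" for y
  have G: "G (orb z) = aff0 (E z)" for z
  proof -
    have "orb (SOME z'. orb z' = orb z) = orb z" by (rule someI[of "\<lambda>z'. orb z' = orb z" z]) simp
    then show ?thesis unfolding G_def E_eq[symmetric] by simp
  qed
  define S\<^sub>0 where "S\<^sub>0 = free_points (proj_line c) proj_action"
  have S\<^sub>0: "S\<^sub>0 = aff0 ` (-{0})" unfolding S\<^sub>0_def by (rule free_points_proj_action)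
  have G_S\<^sub>0: "G (orb z) \<in> S\<^sub>0" for z unfolding G S\<^sub>0 using E_nz by blast
  let ?L = "lattice_quotient M X" and ?N = "open_submanifold (proj_line c) S\<^sub>0"
  have tops_N: "tops ?N = subtopology proj_topology S\<^sub>0"
    by (simp add: open_submanifold_def tops_proj_line)
  have "homeomorphic_map (tops ?L) (tops ?N) G"
  proof (rule bijective_open_imp_homeomorphic_map)
    show "continuous_map (tops ?L) (tops ?N) G"
    proof (rule continuous_compose_quotient_map[OF quotient_map_orb])
      have "continuous_map euclidean proj_topology (\<lambda>z. aff0 (E z))"
        unfolding aff0_def E_def by (rule continuous_map_proj_point) (auto intro!: continuous_intros)
      moreover have "(\<lambda>z. aff0 (E z)) ` topspace euclidean \<subseteq> S\<^sub>0" unfolding S\<^sub>0 using E_nz by blast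
      ultimately show "continuous_map euclidean (tops ?N) (G \<circ> orb)"
        unfolding tops_N o_def G by (auto simp: continuous_map_in_subtopology)
    qed
    show "open_map (tops ?L) (tops ?N) G"
      unfolding open_map_def
    proof (intro allI impI)
      fix U assume U: "openin (tops ?L) U"
      then have sub: "U \<subseteq> range orb" using openin_subset pts_lattice_quotient by metis
      have "open {z. orb z \<in> U}"
        by (rule open_preimage_continuous_map[OF quotient_imp_continuous_map[OF quotient_map_orb] U])
      then have "open (E ` {z. orb z \<in> U})"
        unfolding E_def[abs_def] by (rule open_exp_image) (use a in simp)
      then have "openin proj_topology (aff0 ` E ` {z. orb z \<in> U})" by (rule open_aff0_image)
      moreover have GU: "G ` U = aff0 ` E ` {z. orb z \<in> U}"
      proof (intro equalityI subsetI)
        fix l assume "l \<in> G ` U"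
        then obtain z where "orb z \<in> U" "l = G (orb z)" using sub by blast
        then show "l \<in> aff0 ` E ` {z. orb z \<in> U}" unfolding G by blast
      next
        fix l assume "l \<in> aff0 ` E ` {z. orb z \<in> U}"
        then obtain z where "orb z \<in> U" "l = aff0 (E z)" by blast
        then show "l \<in> G ` U" unfolding G[symmetric] by blast
      qed
      moreover have "G ` U \<subseteq> S\<^sub>0" using sub G_S\<^sub>0 by blast
      ultimately show "openin (tops ?N) (G ` U)"
        unfolding tops_N by (simp add: subset_openin_subtopology)
    qed
    have "S\<^sub>0 \<subseteq> topspace proj_topology" unfolding S\<^sub>0 by auto
    then have "topspace (tops ?N) = S\<^sub>0" unfolding tops_N topspace_subtopology by (rule Int_absorb1)
    moreover have "G ` range orb = S\<^sub>0"
    proof (intro equalityI subsetI)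
      fix l assume "l \<in> S\<^sub>0"
      then obtain w where w: "w \<noteq> 0" "l = aff0 w" unfolding S\<^sub>0 by auto
      obtain z where "w = E z" using E_surj[OF w(1)] by blast
      then have "l = G (orb z)" unfolding G w by simp
      then show "l \<in> G ` range orb" by blast
    qed (use G_S\<^sub>0 in blast)
    ultimately show "G ` topspace (tops ?L) = topspace (tops ?N)"
      unfolding pts_lattice_quotient by simp
    show "inj_on G (topspace (tops ?L))"
      unfolding pts_lattice_quotient by (auto intro!: inj_onI simp: G E_eq)
  qed
  then obtain G' where G': "homeomorphic_maps (tops ?L) (tops ?N) G G'"
    using homeomorphic_map_maps by blast
  have G'_G: "G' (G (orb z)) = orb z" for z
    using G' pts_lattice_quotient unfolding homeomorphic_maps_def by blast
  \<comment> \<open>In the chart \<open>\<psi>\<close> the map \<open>G\<close> is represented by \<open>f\<close>, which is \<open>E\<close> or its reciprocal.\<close>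
  have N_chart: "\<exists>f. (\<forall>z. \<psi> (G (orb z)) = f z) \<and> (\<forall>z. G (orb z) \<in> V) \<and> inj_on \<psi> V \<and> f holomorphic_on UNIV \<and>
      (\<forall>z z'. f z = f z' \<longrightarrow> orb z = orb z') \<and> (\<forall>p\<in>V. \<exists>z. p = G (orb z)) \<and>
      (\<forall>z. 4 / (c * (1 + (cmod (f z))\<^sup>2)\<^sup>2) * (cmod (deriv f z))\<^sup>2 = hmet M (pt (Re z)))"
    if V: "(V, \<psi>) \<in> atlas ?N" for V \<psi>
  proof -
    have E_met: "4 / (c * (1 + (cmod (E z))\<^sup>2)\<^sup>2) * (cmod (of_real a * E z))\<^sup>2 = hmet M (pt (Re z))" for z
    proof -
      have "cmod (E z) = exp (a * Re z - s)" by (simp add: E_def)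
      then have "4 / (c * (1 + (cmod (E z))\<^sup>2)\<^sup>2) * (cmod (of_real a * E z))\<^sup>2 =
          a\<^sup>2 / c * (4 * (exp (a * Re z - s))\<^sup>2 / (1 + (exp (a * Re z - s))\<^sup>2)\<^sup>2)"
        by (simp add: norm_mult power_mult_distrib)
      then show ?thesis
        unfolding cosh_stereographic using h[of "Re z"] by (simp add: pt_def)
    qed
    consider "V = range aff0 \<inter> S\<^sub>0" "\<psi> = proj_coord0" | "V = range aff1 \<inter> S\<^sub>0" "\<psi> = proj_coord1"
      using V unfolding open_submanifold_def hermitian.select_convs atlas_proj_line by auto
    then show ?thesis
    proof cases
      case 1
      show ?thesis
      proof (intro exI[of _ E] conjI allI ballI impI)
        show "\<psi> (G (orb z)) = E z" "G (orb z) \<in> V" for z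
          using G_S\<^sub>0[of z] unfolding 1 by (simp_all add: G)
        show "inj_on \<psi> V" unfolding 1 by (auto intro!: inj_onI)
        show "E holomorphic_on UNIV" by (rule E_hol)
        show "orb z = orb z'" if "E z = E z'" for z z' using that E_eq by simp
        show "\<exists>z. p = G (orb z)" if "p \<in> V" for p
          using that E_surj unfolding 1 S\<^sub>0 G by auto
        show "4 / (c * (1 + (cmod (E z))\<^sup>2)\<^sup>2) * (cmod (deriv E z))\<^sup>2 = hmet M (pt (Re z))" for z
          unfolding DERIV_imp_deriv[OF E_der] by (rule E_met)
      qed
    next
      case 2
      show ?thesis
      proof (intro exI[of _ "\<lambda>z. inverse (E z)"] conjI allI ballI impI)
        show "\<psi> (G (orb z)) = inverse (E z)" "G (orb z) \<in> V" for z
          using G_S\<^sub>0[of z] unfolding 2 by (simp_all add: G aff0_conv_aff1[OF E_nz])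
        show "inj_on \<psi> V" unfolding 2 by (auto intro!: inj_onI)
        show "(\<lambda>z. inverse (E z)) holomorphic_on UNIV" by (intro holomorphic_intros E_hol E_nz)
        show "orb z = orb z'" if "inverse (E z) = inverse (E z')" for z z' using that E_eq by simp
        show "\<exists>z. p = G (orb z)" if "p \<in> V" for p
          using that E_surj unfolding 2 S\<^sub>0 G by auto
        have "((\<lambda>z. inverse (E z)) has_field_derivative - (inverse (E z) * (of_real a * E z) * inverse (E z))) (at z)" for z
          by (rule DERIV_inverse'[OF E_der E_nz])
        note DERIV_imp_deriv[OF this]
        then have d: "deriv (\<lambda>z. inverse (E z)) z = - (of_real a * inverse (E z))" for z
          by (simp add: E_nz)
        show "4 / (c * (1 + (cmod (inverse (E z)))\<^sup>2)\<^sup>2) * (cmod (deriv (\<lambda>z. inverse (E z)) z))\<^sup>2 = hmet M (pt (Re z))" for z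
        proof -
          have n: "(cmod (E z))\<^sup>2 \<noteq> 0" using E_nz by simp
          have "(cmod (inverse (E z)))\<^sup>2 = 1 / (cmod (E z))\<^sup>2"
            by (simp add: norm_inverse power_inverse divide_inverse)
          then have "1 + (cmod (inverse (E z)))\<^sup>2 = (1 + (cmod (E z))\<^sup>2) / (cmod (E z))\<^sup>2"
            using n by (simp add: add_divide_distrib)
          moreover have "(k * inverse e)\<^sup>2 = (k * e)\<^sup>2 / (e\<^sup>2)\<^sup>2" if "e \<noteq> 0" for k e :: real
            using that by (simp add: power2_eq_square field_simps)
          then have "(cmod (deriv (\<lambda>z. inverse (E z)) z))\<^sup>2 = (cmod (of_real a * E z))\<^sup>2 / ((cmod (E z))\<^sup>2)\<^sup>2"
            unfolding d norm_minus_cancel norm_mult norm_inverse using E_nz by simp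
          ultimately show ?thesis
            unfolding E_met[symmetric] using n by (simp add: power_divide)
        qed
      qed
    qed
  qed
  have "kahler_iso ?L ?N G"
    unfolding kahler_iso_def
  proof (intro conjI exI[of _ G'])
    show "homeomorphic_maps (tops ?L) (tops ?N) G G'" by (rule G')
    show "holomorphic_map ?L ?N G"
    proof (rule holomorphic_mapI)
      show "continuous_map (tops ?L) (tops ?N) G" using G' by (simp add: homeomorphic_maps_def)
      fix U \<phi> V \<psi> assume U: "(U, \<phi>) \<in> atlas ?L" and V: "(V, \<psi>) \<in> atlas ?N"
      from lattice_quotient_chart[OF U]
      obtain S where S': "open S \<and> inj_on orb S \<and> U = orb ` S \<and> (\<forall>z\<in>S. \<phi> (orb z) = z)" ..
      note S = S'[THEN conjunct1] S'[THEN conjunct2, THEN conjunct1] S'[THEN conjunct2, THEN conjunct2, THEN conjunct1]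
        S'[THEN conjunct2, THEN conjunct2, THEN conjunct2, THEN bspec]
      from N_chart[OF V] obtain f where f': "(\<forall>z. \<psi> (G (orb z)) = f z) \<and> (\<forall>z. G (orb z) \<in> V) \<and> inj_on \<psi> V \<and> f holomorphic_on UNIV \<and>
        (\<forall>z z'. f z = f z' \<longrightarrow> orb z = orb z') \<and> (\<forall>p\<in>V. \<exists>z. p = G (orb z)) \<and>
        (\<forall>z. 4 / (c * (1 + (cmod (f z))\<^sup>2)\<^sup>2) * (cmod (deriv f z))\<^sup>2 = hmet M (pt (Re z)))" ..
      note f = f'[THEN conjunct1, rule_format] holomorphic_on_subset[OF f'[THEN conjunct2, THEN conjunct2, THEN conjunct2, THEN conjunct1] subset_UNIV]
      have "f holomorphic_on S" by (rule f(2))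
      then have "loc_map U \<phi> \<psi> G holomorphic_on S"
        by (rule holomorphic_transform) (simp add: loc_map_orb[OF S(2-4)] f(1))
      moreover have "\<phi> ` {p \<in> U. G p \<in> V} \<subseteq> S" unfolding S(3) using S(4) by auto
      ultimately show "loc_map U \<phi> \<psi> G holomorphic_on \<phi> ` {p \<in> U. G p \<in> V}"
        by (rule holomorphic_on_subset)
    qed
    show "holomorphic_map ?N ?L G'"
    proof (rule holomorphic_mapI)
      show "continuous_map (tops ?N) (tops ?L) G'" using G' by (simp add: homeomorphic_maps_def)
      fix V \<psi> U \<phi> assume V: "(V, \<psi>) \<in> atlas ?N" and U: "(U, \<phi>) \<in> atlas ?L"
      from lattice_quotient_chart[OF U]
      obtain S where S': "open S \<and> inj_on orb S \<and> U = orb ` S \<and> (\<forall>z\<in>S. \<phi> (orb z) = z)" ..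
      note S = S'[THEN conjunct1] S'[THEN conjunct2, THEN conjunct1] S'[THEN conjunct2, THEN conjunct2, THEN conjunct1]
        S'[THEN conjunct2, THEN conjunct2, THEN conjunct2, THEN bspec]
      from N_chart[OF V] obtain f where f': "(\<forall>z. \<psi> (G (orb z)) = f z) \<and> (\<forall>z. G (orb z) \<in> V) \<and> inj_on \<psi> V \<and> f holomorphic_on UNIV \<and>
        (\<forall>z z'. f z = f z' \<longrightarrow> orb z = orb z') \<and> (\<forall>p\<in>V. \<exists>z. p = G (orb z)) \<and>
        (\<forall>z. 4 / (c * (1 + (cmod (f z))\<^sup>2)\<^sup>2) * (cmod (deriv f z))\<^sup>2 = hmet M (pt (Re z)))" ..
      note f = f'[THEN conjunct1, rule_format] f'[THEN conjunct2, THEN conjunct1, rule_format] f'[THEN conjunct2, THEN conjunct2, THEN conjunct1] holomorphic_on_subset[OF f'[THEN conjunct2, THEN conjunct2, THEN conjunct2, THEN conjunct1] subset_UNIV]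
        f'[THEN conjunct2, THEN conjunct2, THEN conjunct2, THEN conjunct2, THEN conjunct1, rule_format] f'[THEN conjunct2, THEN conjunct2, THEN conjunct2, THEN conjunct2, THEN conjunct2, THEN conjunct1, rule_format]
      have "inj_on f S" using f(5) S(2) by (meson inj_on_def)
      then obtain g where g: "g holomorphic_on f ` S" "\<And>z. z \<in> S \<Longrightarrow> g (f z) = z"
        using holomorphic_has_inverse[OF f(4) S(1)] by metis
      have dom: "\<exists>z\<in>S. w = f z \<and> loc_map V \<psi> \<phi> G' w = z" if w: "w \<in> \<psi> ` {p \<in> V. G' p \<in> U}" for w
      proof -
        obtain p where p: "p \<in> V" "G' p \<in> U" "w = \<psi> p" using w by blast
        obtain z' where z': "p = G (orb z')" using f(6)[OF p(1)] by blast
        have "orb z' \<in> orb ` S" using p(2) unfolding z' G'_G S(3) .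
        then obtain z where z: "z \<in> S" "orb z' = orb z" by blast
        have "w = f z" unfolding p(3) z' z(2) by (rule f(1))
        moreover have "loc_map V \<psi> \<phi> G' w = z"
          unfolding loc_map_def p(3) inv_into_f_f[OF f(3) p(1)] unfolding z' G'_G z(2) by (rule S(4)[OF z(1)])
        ultimately show ?thesis using z(1) by blast
      qed
      have "\<psi> ` {p \<in> V. G' p \<in> U} \<subseteq> f ` S" using dom by blast
      with g(1) have "g holomorphic_on \<psi> ` {p \<in> V. G' p \<in> U}" by (rule holomorphic_on_subset)
      then show "loc_map V \<psi> \<phi> G' holomorphic_on \<psi> ` {p \<in> V. G' p \<in> U}"
        by (rule holomorphic_transform) (use dom g(2) in fastforce)
    qed
    show "isometric_map ?L ?N G"
    proof (rule isometric_mapI)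
      fix U \<phi> V \<psi> p u v
      assume U: "(U, \<phi>) \<in> atlas ?L" and V: "(V, \<psi>) \<in> atlas ?N" and p: "p \<in> U" "G p \<in> V"
      from lattice_quotient_chart[OF U]
      obtain S where S': "open S \<and> inj_on orb S \<and> U = orb ` S \<and> (\<forall>z\<in>S. \<phi> (orb z) = z)" ..
      note S = S'[THEN conjunct1] S'[THEN conjunct2, THEN conjunct1] S'[THEN conjunct2, THEN conjunct2, THEN conjunct1]
        S'[THEN conjunct2, THEN conjunct2, THEN conjunct2, THEN bspec]
      obtain z where z: "z \<in> S" "p = orb z" using p(1) S(3) by blast
      from N_chart[OF V] obtain f where f': "(\<forall>z. \<psi> (G (orb z)) = f z) \<and> (\<forall>z. G (orb z) \<in> V) \<and> inj_on \<psi> V \<and> f holomorphic_on UNIV \<and>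
        (\<forall>z z'. f z = f z' \<longrightarrow> orb z = orb z') \<and> (\<forall>p\<in>V. \<exists>z. p = G (orb z)) \<and>
        (\<forall>z. 4 / (c * (1 + (cmod (f z))\<^sup>2)\<^sup>2) * (cmod (deriv f z))\<^sup>2 = hmet M (pt (Re z)))" ..
      note f = f'[THEN conjunct1, rule_format] holomorphic_on_subset[OF f'[THEN conjunct2, THEN conjunct2, THEN conjunct2, THEN conjunct1] subset_UNIV] and f_met = f'[THEN conjunct2, THEN conjunct2, THEN conjunct2, THEN conjunct2, THEN conjunct2, THEN conjunct2, rule_format]
      have "(f has_field_derivative deriv f z) (at z)"
        by (rule holomorphic_derivI[OF f(2) open_UNIV UNIV_I])
      then have "(loc_map U \<phi> \<psi> G has_field_derivative deriv f z) (at z)"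
        by (rule has_field_derivative_transform_within_open[OF _ S(1) z(1)]) (simp add: loc_map_orb[OF S(2-4)] f(1))
      then have d: "deriv (loc_map U \<phi> \<psi> G) (\<phi> p) = deriv f z"
        unfolding z(2) S(4)[OF z(1)] by (rule DERIV_imp_deriv)
      have "met ?N \<psi> (G p) (deriv f z * u) (deriv f z * v) =
          4 / (c * (1 + (cmod (f z))\<^sup>2)\<^sup>2) * (cmod (deriv f z))\<^sup>2 * (u \<bullet> v)"
        unfolding open_submanifold_def hermitian.select_convs met_proj_line inner_mult_complex z(2) f(1)
        by (rule mult.assoc[symmetric])
      then show "met ?N \<psi> (G p) (deriv (loc_map U \<phi> \<psi> G) (\<phi> p) * u) (deriv (loc_map U \<phi> \<psi> G) (\<phi> p) * v) = met ?L \<phi> p u v"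
        unfolding d unfolding f_met z(2) met_lattice_quotient .
    qed
  qed
  moreover have "G (lattice_action X t y) = proj_action t (G y)" if y: "y \<in> pts ?L" for t y
  proof -
    from y obtain z where z: "y = orb z" unfolding pts_lattice_quotient by (rule rangeE)
    have "of_real a * (z + of_real t * (\<i> * of_real b)) - of_real s =
        2 * \<i> * of_real pi * of_real t + (of_real a * z - of_real s)"
      using a by (simp add: b_def algebra_simps)
    then have "E (z + of_real t * (\<i> * of_real b)) = rot t * E z"
      unfolding E_def by (simp only: exp_add)
    then show ?thesis
      unfolding z lattice_action_orb G proj_action_aff by simp
  qed
  moreover have "parallel_frame M X"
    unfolding parallel_frame_def X_def using b by (simp add: o_def)
  ultimately have "torification M (proj_line c) proj_action"
    unfolding torification_def tops_proj_line S\<^sub>0_def[symmetric]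
    by (intro conjI exI[of _ X] exI[of _ G] allI ballI M connected_proj_topology torus_action_proj_line[OF c])
  then show ?thesis
    unfolding regular_torification_def tops_proj_line
    using simply_connected_proj_topology complete_proj_line[OF c] real_analytic_metric_proj_line by blast
qed

section \<open>Kaehler functions on a torification\<close>

lemma (in kahler_manifold) loc_met_conformal:
  assumes "(V, \<psi>) \<in> atlas M" "w \<in> \<psi> ` V"
  shows "loc_met M V \<psi> w u v = loc_met M V \<psi> w 1 1 * (u \<bullet> v)"
  unfolding loc_met_def by (rule met_conformal[OF assms(1) inv_into_into[OF assms(2)]])

lemma (in kahler_manifold) loc_met_pos:
  assumes "(V, \<psi>) \<in> atlas M" "w \<in> \<psi> ` V"
  shows "loc_met M V \<psi> w 1 1 > 0"
  unfolding loc_met_def by (rule met_pos[OF assms(1) inv_into_into[OF assms(2)]]) simp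

lemma (in kahler_manifold) ham_field_conv_hamiltonian:
  assumes V: "(V, \<psi>) \<in> atlas M" "w \<in> \<psi> ` V" and f: "f \<circ> inv_into V \<psi> differentiable (at w)"
  shows "ham_field M V \<psi> f w = hamiltonian (\<lambda>w. loc_met M V \<psi> w 1 1) (f \<circ> inv_into V \<psi>) w"
  unfolding ham_field_def
proof (rule the_equality)
  have form: "loc_form M V \<psi> w x v = loc_met M V \<psi> w 1 1 * ((\<i> * x) \<bullet> v)" for x v
    unfolding loc_form_def by (rule loc_met_conformal[OF V])
  have iff: "x = hamiltonian (\<lambda>w. loc_met M V \<psi> w 1 1) (f \<circ> inv_into V \<psi>) w \<longleftrightarrow>
      (\<forall>v. loc_form M V \<psi> w x v = frechet_derivative (f \<circ> inv_into V \<psi>) (at w) v)" for x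
    unfolding form by (rule hamiltonian_eq_iff[OF f]) (use loc_met_pos[OF V] in simp)
  show "\<forall>v. loc_form M V \<psi> w (hamiltonian (\<lambda>w. loc_met M V \<psi> w 1 1) (f \<circ> inv_into V \<psi>) w) v =
      frechet_derivative (f \<circ> inv_into V \<psi>) (at w) v"
    unfolding iff[symmetric] ..
  show "x = hamiltonian (\<lambda>w. loc_met M V \<psi> w 1 1) (f \<circ> inv_into V \<psi>) w"
    if "\<forall>v. loc_form M V \<psi> w x v = frechet_derivative (f \<circ> inv_into V \<psi>) (at w) v" for x
    using that unfolding iff[symmetric] .
qed

lemma kahler_functionsD:
  assumes "f \<in> kahler_functions M" "(V, \<psi>) \<in> atlas M"
  shows "smooth_on (f \<circ> inv_into V \<psi>) (\<psi> ` V)"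
    "\<And>w u v. w \<in> \<psi> ` V \<Longrightarrow> lie_deriv_met M V \<psi> (ham_field M V \<psi> f) w u v = 0"
proof -
  have "\<forall>(U, \<phi>)\<in>atlas M. smooth_on (f \<circ> inv_into U \<phi>) (\<phi> ` U) \<and>
      (\<forall>z\<in>\<phi> ` U. \<forall>u v. lie_deriv_met M U \<phi> (ham_field M U \<phi> f) z u v = 0)"
    using assms(1) unfolding kahler_functions_def by (rule CollectD)
  note * = bspec[OF this assms(2), unfolded prod.case]
  show "smooth_on (f \<circ> inv_into V \<psi>) (\<psi> ` V)"
    by (rule conjunct1[OF *])
  show "lie_deriv_met M V \<psi> (ham_field M V \<psi> f) w u v = 0" if "w \<in> \<psi> ` V" for w u v
    using conjunct2[OF *] that by blast
qed

text \<open>The Killing equation in a chart, for the conformal factor \<open>l\<close> of the metric: the Hamiltonian field of a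
  Kaehler function is holomorphic there.\<close>

lemma (in kahler_manifold) kahler_function_killing:
  fixes V \<psi> f
  defines "l \<equiv> \<lambda>w. loc_met M V \<psi> w 1 1" and "f' \<equiv> f \<circ> inv_into V \<psi>"
  assumes f: "f \<in> kahler_functions M" and V: "(V, \<psi>) \<in> atlas M" and w: "w \<in> \<psi> ` V"
  obtains Dl X' where "(l has_derivative Dl) (at w)" "(hamiltonian l f' has_field_derivative X') (at w)"
    "Dl (hamiltonian l f' w) + 2 * l w * Re X' = 0"
proof -
  have oV: "open (\<psi> ` V)" using chart[OF V] by blast
  have smooth: "Ck_on k f' (\<psi> ` V)" for k
    using kahler_functionsD(1)[OF f V] by (simp add: smooth_on_def f'_def)
  have lsmooth: "Ck_on k l (\<psi> ` V)" for k
    using met_smooth[OF V, of 1 1] by (simp add: smooth_on_def l_def)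
  have fd: "f' differentiable (at w)" if "w \<in> \<psi> ` V" for w
    by (rule Ck_on_Suc_differentiable[OF smooth that])
  have fdd: "(\<lambda>w. frechet_derivative f' (at w) v) differentiable (at w)" for v
    by (rule Ck_on_Suc_differentiable[OF Ck_on_Suc_frechet_derivative[OF smooth] w])
  have ld: "l differentiable (at w)" by (rule Ck_on_Suc_differentiable[OF lsmooth w])
  define Dl where "Dl = frechet_derivative l (at w)"
  have Dl: "(l has_derivative Dl) (at w)" using ld by (simp add: Dl_def frechet_derivative_works)
  have lpos: "l w > 0" if "w \<in> \<psi> ` V" for w unfolding l_def by (rule loc_met_pos[OF V that])
  have ham: "ham_field M V \<psi> f w = hamiltonian l f' w" if "w \<in> \<psi> ` V" for w
    unfolding l_def f'_def by (rule ham_field_conv_hamiltonian[OF V that fd[OF that, unfolded f'_def]])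
  have "hamiltonian l f' differentiable (at w)"
  proof -
    have eq: "hamiltonian l f' = (\<lambda>w. (frechet_derivative f' (at w) \<i> * inverse (l w)) *\<^sub>R 1
        + ((- frechet_derivative f' (at w) 1) * inverse (l w)) *\<^sub>R \<i>)"
      by (rule ext) (simp add: hamiltonian_def complex_eq_iff divide_inverse)
    show ?thesis
      unfolding eq
      by (intro differentiable_add differentiable_scaleR differentiable_mult differentiable_minus differentiable_inverse
            differentiable_const fdd ld less_imp_neq[OF lpos[OF w], symmetric])
  qed
  then obtain DX where DX: "(hamiltonian l f' has_derivative DX) (at w)" by (auto simp: differentiable_def)
  have "(ham_field M V \<psi> f has_derivative DX) (at w)"
    by (rule has_derivative_transform_within_open[OF DX oV w]) (simp add: ham)
  then have DX_eq: "frechet_derivative (ham_field M V \<psi> f) (at w) = DX"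
    by (rule frechet_derivative_at[symmetric])
  have met_eq: "frechet_derivative (\<lambda>w. loc_met M V \<psi> w u v) (at w) = (\<lambda>x. Dl x * (u \<bullet> v))" for u v
  proof -
    have "((\<lambda>w. loc_met M V \<psi> w u v) has_derivative (\<lambda>x. Dl x * (u \<bullet> v))) (at w)"
    proof (rule has_derivative_transform_within_open[OF has_derivative_mult_left[OF Dl] oV w])
      show "l w * (u \<bullet> v) = loc_met M V \<psi> w u v" if "w \<in> \<psi> ` V" for w
        unfolding l_def by (rule loc_met_conformal[OF V that, symmetric])
    qed
    then show ?thesis by (rule frechet_derivative_at[symmetric])
  qed
  have killing: "Dl (hamiltonian l f' w) * (u \<bullet> v) + l w * (DX u \<bullet> v) + l w * (u \<bullet> DX v) = 0" for u v
  proof -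
    have "lie_deriv_met M V \<psi> (ham_field M V \<psi> f) w u v =
        Dl (hamiltonian l f' w) * (u \<bullet> v) + l w * (DX u \<bullet> v) + l w * (u \<bullet> DX v)"
      unfolding lie_deriv_met_def met_eq DX_eq ham[OF w]
        loc_met_conformal[OF V w, of "DX u" v] loc_met_conformal[OF V w, of u "DX v"] l_def ..
    then show ?thesis using kahler_functionsD(2)[OF f V w, of u v] by simp
  qed
  show ?thesis
    using that[OF Dl] killing_imp_holomorphic[OF DX lpos[OF w] killing] by blast
qed

text \<open>Two points of one torus orbit in the free part are separated by some Kaehler function \<open>f\<close>. Pulled back to
  the tangent bundle by the equivariant isometry \<open>G\<close>, it becomes a function \<open>F\<close> on the complex plane that
  is not constant in the imaginary direction, and whose Hamiltonian field is an entire Killing field of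
  the metric \<open>h (Re z) |dz|\<^sup>2\<close>.\<close>

lemma torification_separating_imp_ode:
  fixes M :: "'m dually_flat"
  assumes tor: "torification M N \<Phi>" and surj: "coord M ` dpts M = UNIV"
    and sep: "separates_points (pts N) (kahler_functions N)"
  obtains \<mu> r1 where "\<And>x. ((\<lambda>x. 1 / sqrt (hmet M (inv_into (dpts M) (coord M) x))) has_real_derivative r1 x) (at x)"
    "\<And>x. (r1 has_real_derivative \<mu> * (1 / sqrt (hmet M (inv_into (dpts M) (coord M) x)))) (at x)"
proof -
  obtain X G where M: "dually_flat_manifold M" and N: "torus_action N \<Phi>" and X: "parallel_frame M X"
    and G: "kahler_iso (lattice_quotient M X) (open_submanifold N (free_points N \<Phi>)) G"
    using tor unfolding torification_def by blast
  define S where "S = free_points N \<Phi>"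
  interpret M: dually_flat_manifold M by (rule M)
  interpret N: kahler_manifold N using N by (rule torus_action.axioms(1))
  define b where "b = X (inv_into (dpts M) (coord M) 0)"
  have in_M: "inv_into (dpts M) (coord M) x \<in> dpts M" for x
    by (rule inv_into_into) (simp add: surj)
  have X_der: "((X \<circ> inv_into (dpts M) (coord M)) has_real_derivative 0) (at x)" for x
    using X surj unfolding parallel_frame_def by blast
  have X_const: "X p = b" if "p \<in> dpts M" for p
    using DERIV_isconst_all[of "X \<circ> inv_into (dpts M) (coord M)" "coord M p" 0] X_der
      inv_into_f_f[OF M.inj_coord that] by (simp add: b_def)
  have b: "b \<noteq> 0" using X in_M unfolding parallel_frame_def b_def by blast
  interpret lattice_quotient_of_line M X b
    by unfold_locales (use M.inj_coord surj X_const b in auto)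
  define h where "h x = hmet M (pt x)" for x
  have hpos: "h x > 0" for x unfolding h_def by (rule M.hmet_pos) simp
  have "Ck_on (Suc 0) h UNIV"
    using M.hmet_smooth unfolding smooth_on_def surj by (simp only: o_def pt_def[symmetric] h_def[abs_def])
  then have h': "(h has_real_derivative deriv h x) (at x)" for x
    by (simp add: DERIV_deriv_iff_real_differentiable)
  let ?L = "lattice_quotient M X" and ?N = "open_submanifold N S"
  obtain G' where G': "homeomorphic_maps (tops ?L) (tops ?N) G G'"
    and hol: "holomorphic_map ?L ?N G" and iso: "isometric_map ?L ?N G"
    using G unfolding kahler_iso_def S_def by blast
  have tops_N: "tops ?N = subtopology (tops N) S" by (simp add: open_submanifold_def)
  have G_cont: "continuous_map (tops ?L) (tops N) G"
    and G_S: "\<And>y. y \<in> pts ?L \<Longrightarrow> G y \<in> S"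
    and G_inj: "\<And>y y'. y \<in> pts ?L \<Longrightarrow> y' \<in> pts ?L \<Longrightarrow> G y = G y' \<Longrightarrow> y = y'"
    using G' unfolding homeomorphic_maps_def tops_N continuous_map_in_subtopology by (blast, blast, metis)
  have orb_in: "orb z \<in> pts ?L" for z unfolding pts_lattice_quotient by simp
  have "G (orb 0) \<noteq> G (orb (\<i> * of_real (b / 2)))"
  proof
    assume "G (orb 0) = G (orb (\<i> * of_real (b / 2)))"
    then have "orb 0 = orb (\<i> * of_real (b / 2))" by (rule G_inj[OF orb_in orb_in])
    then obtain k :: int where k: "\<i> * of_real (b / 2) = 0 + of_int k * (\<i> * of_real b)"
      unfolding orb_eq_iff by blast
    then have "b / 2 = of_int k * b" by (simp add: complex_eq_iff)
    then have "of_int (2 * k) = (1 :: real)" using b by simp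
    then have "2 * k = 1" by linarith
    then show False by presburger
  qed
  moreover have G_pts: "G (orb z) \<in> pts N" for z
    using G_cont orb_in unfolding continuous_map_def by blast
  ultimately obtain f where f: "f \<in> kahler_functions N" "f (G (orb 0)) \<noteq> f (G (orb (\<i> * of_real (b / 2))))"
    using sep unfolding separates_points_def by blast
  define F where "F z = f (G (orb z))" for z
  have local: "F differentiable (at z\<^sub>0) \<and> (\<exists>Y'. (hamiltonian (\<lambda>z. h (Re z)) F has_field_derivative Y') (at z\<^sub>0) \<and>
      deriv h (Re z\<^sub>0) * Re (hamiltonian (\<lambda>z. h (Re z)) F z\<^sub>0) + 2 * h (Re z\<^sub>0) * Re Y' = 0)" for z\<^sub>0
  proof -
    obtain V \<psi> where V: "(V, \<psi>) \<in> atlas N" "G (orb z\<^sub>0) \<in> V"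
      using G_pts[of z\<^sub>0] unfolding N.cover by blast
    have oV: "openin (tops N) V" and o\<psi>: "open (\<psi> ` V)"
      and homeo: "homeomorphic_map (subtopology (tops N) V) (top_of_set (\<psi> ` V)) \<psi>"
      using N.chart[OF V(1)] by auto
    have "topspace (subtopology (tops N) V) = V"
      using openin_subset[OF oV] unfolding topspace_subtopology by (rule Int_absorb1)
    then have inj: "inj_on \<psi> V" using homeomorphic_imp_injective_map[OF homeo] by simp
    have V': "(V \<inter> S, \<psi>) \<in> atlas ?N"
      using V(1) unfolding open_submanifold_def hermitian.select_convs by (rule rev_image_eqI) simp
    define B where "B = ball z\<^sub>0 (\<bar>b\<bar> / 2)"
    have B: "open B" "z\<^sub>0 \<in> B" "inj_on orb B" using b inj_on_orb_ball by (auto simp: B_def)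
    obtain \<phi> where \<phi>: "(orb ` B, \<phi>) \<in> atlas ?L" "\<And>z. z \<in> B \<Longrightarrow> \<phi> (orb z) = z"
      by (rule lattice_quotient_chartI[OF B(1,3)]) (rule that)
    define W where "W = {z \<in> B. G (orb z) \<in> V}"
    have "continuous_map euclidean (tops N) (G \<circ> orb)"
      by (rule continuous_map_compose[OF quotient_imp_continuous_map[OF quotient_map_orb] G_cont])
    from open_preimage_continuous_map[OF this oV] have "open {z. G (orb z) \<in> V}"
      by (simp only: o_apply)
    then have W: "open W" "z\<^sub>0 \<in> W"
      using B V(2) unfolding W_def by (simp_all add: open_Int Collect_conj_eq)
    define g where "g z = \<psi> (G (orb z))" for z
    have loc: "loc_map (orb ` B) \<phi> \<psi> G z = g z" if "z \<in> B" for z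
      unfolding g_def by (rule loc_map_orb[OF B(3) refl \<phi>(2) that])
    have W_sub: "W \<subseteq> \<phi> ` {p \<in> orb ` B. G p \<in> V \<inter> S}"
    proof
      fix z assume z: "z \<in> W"
      then have "orb z \<in> {p \<in> orb ` B. G p \<in> V \<inter> S}" using G_S[OF orb_in] by (auto simp: W_def)
      moreover have "z = \<phi> (orb z)" using z \<phi>(2) by (simp add: W_def)
      ultimately show "z \<in> \<phi> ` {p \<in> orb ` B. G p \<in> V \<inter> S}" by (rule rev_image_eqI)
    qed
    have "loc_map (orb ` B) \<phi> \<psi> G holomorphic_on W"
      using holomorphic_mapD[OF hol \<phi>(1) V'] W_sub by (rule holomorphic_on_subset)
    then have g_hol: "g holomorphic_on W"
      by (rule holomorphic_transform) (auto simp: W_def loc)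
    define l where "l w = loc_met N V \<psi> w 1 1" for w
    have gV: "g z \<in> \<psi> ` V" and inv_g: "inv_into V \<psi> (g z) = G (orb z)" if "z \<in> W" for z
      using that inv_into_f_f[OF inj] by (auto simp: g_def W_def)
    have h_eq: "h (Re z) = l (g z) * (cmod (deriv g z))\<^sup>2" if z: "z \<in> W" for z
    proof -
      have zB: "z \<in> B" and GV: "G (orb z) \<in> V \<inter> S" using z G_S[OF orb_in] by (auto simp: W_def)
      have "(g has_field_derivative deriv g z) (at z)" by (rule holomorphic_derivI[OF g_hol W(1) z])
      then have "(loc_map (orb ` B) \<phi> \<psi> G has_field_derivative deriv g z) (at z)"
        by (rule has_field_derivative_transform_within_open[OF _ B(1) zB]) (simp add: loc)
      then have d: "deriv (loc_map (orb ` B) \<phi> \<psi> G) (\<phi> (orb z)) = deriv g z"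
        unfolding \<phi>(2)[OF zB] by (rule DERIV_imp_deriv)
      have "met N \<psi> (G (orb z)) (deriv g z) (deriv g z) = h (Re z)"
        using isometric_mapD[OF iso \<phi>(1) V' imageI[OF zB] GV, of 1 1] unfolding d met_lattice_quotient h_def
        by (simp add: open_submanifold_def inner_complex_def)
      moreover have "met N \<psi> (G (orb z)) (deriv g z) (deriv g z) = l (g z) * (cmod (deriv g z))\<^sup>2"
        unfolding l_def loc_met_def inv_g[OF z]
        using N.met_conformal[OF V(1), of "G (orb z)" "deriv g z" "deriv g z"] GV by (simp add: dot_square_norm)
      ultimately show ?thesis by simp
    qed
    have lpos: "l w > 0" if "w \<in> \<psi> ` V" for w unfolding l_def by (rule N.loc_met_pos[OF V(1) that])
    have g_nz: "deriv g z \<noteq> 0" if z: "z \<in> W" for z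
      using h_eq[OF z] hpos[of "Re z"] by auto
    have fd: "f \<circ> inv_into V \<psi> differentiable (at w)" if "w \<in> \<psi> ` V" for w
    proof -
      have "Ck_on (Suc 0) (f \<circ> inv_into V \<psi>) (\<psi> ` V)"
        using kahler_functionsD(1)[OF f(1) V(1)] unfolding smooth_on_def by (rule spec)
      then show ?thesis using that by (rule Ck_on_Suc_differentiable)
    qed
    obtain Dl X' where K: "(l has_derivative Dl) (at (g z\<^sub>0))"
      "(hamiltonian l (f \<circ> inv_into V \<psi>) has_field_derivative X') (at (g z\<^sub>0))"
      "Dl (hamiltonian l (f \<circ> inv_into V \<psi>) (g z\<^sub>0)) + 2 * l (g z\<^sub>0) * Re X' = 0"
      unfolding l_def[abs_def] by (rule N.kahler_function_killing[OF f(1) V(1) gV[OF W(2)]])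
    have F_eq: "F z = (f \<circ> inv_into V \<psi>) (g z)" if "z \<in> W" for z
      using inv_g[OF that] by (simp add: F_def)
    show ?thesis
      using hamiltonian_pullback[OF W g_hol g_nz gV fd lpos K h_eq h' F_eq] by blast
  qed
  have C0: "Complex 0 0 = 0" "Complex 0 (b / 2) = \<i> * of_real (b / 2)" by (simp_all add: complex_eq_iff)
  have "F (Complex 0 0) = f (G (orb 0))" "F (Complex 0 (b / 2)) = f (G (orb (\<i> * of_real (b / 2))))"
    by (simp_all only: F_def C0)
  with f(2) have noninv: "F (Complex 0 0) \<noteq> F (Complex 0 (b / 2))" by metis
  have F_diff: "F differentiable (at z)" for z
    by (rule conjunct1[OF local])
  have F_killing: "\<exists>Y'. (hamiltonian (\<lambda>z. h (Re z)) F has_field_derivative Y') (at z) \<and>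
      deriv h (Re z) * Re (hamiltonian (\<lambda>z. h (Re z)) F z) + 2 * h (Re z) * Re Y' = 0" for z
    by (rule conjunct2[OF local])
  show ?thesis
  proof (rule killing_field_imp_ode[of h "deriv h" F 0 0 "b / 2", OF hpos h' F_diff F_killing noninv])
    fix \<mu> r1
    assume "\<And>x. ((\<lambda>x. 1 / sqrt (h x)) has_real_derivative r1 x) (at x)"
      and "\<And>x. (r1 has_real_derivative \<mu> * (1 / sqrt (h x))) (at x)"
    then show ?thesis
      unfolding h_def pt_def by (rule that)
  qed
qed

section \<open>Exponential families\<close>

lemma exp_pdf_reparametrize:
  assumes fin: "finite \<Omega>" "\<Omega> \<noteq> {}"
    and eq: "\<And>x. x \<in> \<Omega> \<Longrightarrow> C x + \<theta> * F x = c + (C' x + \<theta>' * F' x)"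
  shows "exp_pdf \<Omega> C F \<theta> = exp_pdf \<Omega> C' F' \<theta>'"
proof -
  have "(\<Sum>x\<in>\<Omega>. exp (C x + \<theta> * F x)) = exp c * (\<Sum>x\<in>\<Omega>. exp (C' x + \<theta>' * F' x))"
    unfolding sum_distrib_left by (rule sum.cong) (simp_all add: eq exp_add)
  moreover have "(\<Sum>x\<in>\<Omega>. exp (C' x + \<theta>' * F' x)) > 0"
    by (rule sum_pos[OF fin]) simp
  ultimately have "log_partition \<Omega> C F \<theta> = c + log_partition \<Omega> C' F' \<theta>'"
    unfolding log_partition_def by (simp add: ln_mult)
  then show ?thesis
    unfolding exp_pdf_def using eq by (intro restrict_ext) simp
qed

lemma sorted_list_of_set_image_strict_mono:
  fixes f :: "nat \<Rightarrow> 'a::linorder"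
  assumes "strict_mono f"
  shows "sorted_list_of_set (f ` {0..n}) = map f [0..<Suc n]"
proof -
  have "sorted_wrt (<) (map f [0..<Suc n])"
    unfolding sorted_wrt_map by (rule sorted_wrt_mono_rel[OF _ sorted_wrt_upt]) (use assms in \<open>auto dest: strict_monoD\<close>)
  moreover have "set (map f [0..<Suc n]) = f ` {0..n}"
    by (simp only: set_map set_upt atLeastLessThanSuc_atLeastAtMost)
  moreover have "card (f ` {0..n}) = Suc n"
    using card_image[OF inj_on_subset[OF strict_mono_imp_inj_on[OF assms] subset_UNIV], of "{0..n}"] by simp
  ultimately show ?thesis
    using sorted_list_of_set_unique[of "f ` {0..n}" "map f [0..<Suc n]"] by simp
qed

subsection \<open>The log-partition function\<close>

text \<open>The functions \<open>Z\<close> and \<open>Z1\<close> are the partition function and its derivative, so \<open>Z1 / Z\<close> is the mean of \<open>F\<close>;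
  \<open>weight \<alpha>\<close> is the weight that the reduced family gives to the value \<open>\<alpha>\<close>.\<close>

locale exponential_family =
  fixes \<Omega> :: "'x set" and C F :: "'x \<Rightarrow> real"
  assumes finite: "finite \<Omega>" and nonconst: "\<exists>x\<in>\<Omega>. \<exists>y\<in>\<Omega>. F x \<noteq> F y"
begin

definition Z :: "real \<Rightarrow> real" where "Z \<theta> = (\<Sum>x\<in>\<Omega>. exp (C x + \<theta> * F x))"
definition Z1 :: "real \<Rightarrow> real" where "Z1 \<theta> = (\<Sum>x\<in>\<Omega>. F x * exp (C x + \<theta> * F x))"
definition weight :: "real \<Rightarrow> real" where "weight \<alpha> = (\<Sum>x\<in>{x \<in> \<Omega>. F x = \<alpha>}. exp (C x))"

lemma nonempty: "\<Omega> \<noteq> {}" using nonconst by blast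

lemma Z_pos: "Z \<theta> > 0"
  unfolding Z_def by (rule sum_pos[OF finite nonempty]) simp

lemma Z_derivative: "(Z has_real_derivative Z1 \<theta>) (at \<theta>)"
  unfolding Z_def[abs_def] Z1_def by (auto intro!: derivative_eq_intros sum.cong simp: mult.commute)

lemma Z1_differentiable: "Z1 differentiable (at \<theta>)"
proof -
  have "(Z1 has_real_derivative (\<Sum>x\<in>\<Omega>. F x * (exp (C x + \<theta> * F x) * F x))) (at \<theta>)"
    unfolding Z1_def[abs_def] by (auto intro!: derivative_eq_intros sum.cong)
  then show ?thesis using real_differentiable_def by blast
qed

lemma log_partition_derivative: "(log_partition \<Omega> C F has_real_derivative Z1 \<theta> / Z \<theta>) (at \<theta>)"
proof -
  have "log_partition \<Omega> C F = (\<lambda>\<theta>. ln (Z \<theta>))"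
    by (rule ext) (simp add: log_partition_def Z_def)
  moreover have "((\<lambda>\<theta>. ln (Z \<theta>)) has_real_derivative 1 / Z \<theta> * Z1 \<theta>) (at \<theta>)"
    by (rule DERIV_chain2[OF DERIV_ln_divide[OF Z_pos] Z_derivative])
  ultimately show ?thesis by simp
qed

lemma deriv_log_partition: "deriv (log_partition \<Omega> C F) = (\<lambda>\<theta>. Z1 \<theta> / Z \<theta>)"
  by (rule ext) (rule DERIV_imp_deriv[OF log_partition_derivative])

lemma log_partition_second_derivative:
  "((\<lambda>\<theta>. Z1 \<theta> / Z \<theta>) has_real_derivative deriv (deriv (log_partition \<Omega> C F)) \<theta>) (at \<theta>)"
proof -
  have "Z differentiable (at \<theta>)" using Z_derivative real_differentiable_def by blast
  then have "(\<lambda>\<theta>. Z1 \<theta> / Z \<theta>) differentiable (at \<theta>)"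
    using Z1_differentiable Z_pos[of \<theta>] by (intro differentiable_divide) auto
  then show ?thesis
    unfolding deriv_log_partition DERIV_deriv_iff_real_differentiable .
qed

lemma mean_bounded: "\<bar>Z1 \<theta> / Z \<theta>\<bar> \<le> (\<Sum>x\<in>\<Omega>. \<bar>F x\<bar>)"
proof -
  have "\<bar>Z1 \<theta>\<bar> \<le> (\<Sum>x\<in>\<Omega>. \<bar>F x * exp (C x + \<theta> * F x)\<bar>)"
    unfolding Z1_def by (rule sum_abs)
  also have "\<dots> \<le> (\<Sum>x\<in>\<Omega>. (\<Sum>y\<in>\<Omega>. \<bar>F y\<bar>) * exp (C x + \<theta> * F x))"
    unfolding abs_mult abs_exp_cancel
    by (intro sum_mono mult_right_mono member_le_sum) (use finite in auto)
  also have "\<dots> = (\<Sum>x\<in>\<Omega>. \<bar>F x\<bar>) * Z \<theta>"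
    unfolding Z_def by (rule sum_distrib_left[symmetric])
  finally show ?thesis using Z_pos[of \<theta>] by (simp add: divide_le_eq)
qed

lemma weight_pos: "\<alpha> \<in> F ` \<Omega> \<Longrightarrow> weight \<alpha> > 0"
  unfolding weight_def by (rule sum_pos) (use finite in auto)

lemma Z_conv_weight:
  "Z \<theta> = (\<Sum>\<alpha>\<in>F ` \<Omega>. weight \<alpha> * exp (\<alpha> * \<theta>))" "Z1 \<theta> = (\<Sum>\<alpha>\<in>F ` \<Omega>. \<alpha> * weight \<alpha> * exp (\<alpha> * \<theta>))"
proof -
  have "Z \<theta> = (\<Sum>\<alpha>\<in>F ` \<Omega>. \<Sum>x\<in>{x \<in> \<Omega>. F x = \<alpha>}. exp (C x + \<theta> * F x))"
    unfolding Z_def by (rule sum.image_gen[OF finite])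
  also have "\<dots> = (\<Sum>\<alpha>\<in>F ` \<Omega>. weight \<alpha> * exp (\<alpha> * \<theta>))"
    unfolding weight_def sum_distrib_right by (intro sum.cong refl) (auto simp: exp_add mult.commute)
  finally show "Z \<theta> = (\<Sum>\<alpha>\<in>F ` \<Omega>. weight \<alpha> * exp (\<alpha> * \<theta>))" .
  have "Z1 \<theta> = (\<Sum>\<alpha>\<in>F ` \<Omega>. \<Sum>x\<in>{x \<in> \<Omega>. F x = \<alpha>}. F x * exp (C x + \<theta> * F x))"
    unfolding Z1_def by (rule sum.image_gen[OF finite])
  also have "\<dots> = (\<Sum>\<alpha>\<in>F ` \<Omega>. \<alpha> * weight \<alpha> * exp (\<alpha> * \<theta>))"
    unfolding weight_def sum_distrib_right sum_distrib_left by (intro sum.cong refl) (auto simp: exp_add mult_ac)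
  finally show "Z1 \<theta> = (\<Sum>\<alpha>\<in>F ` \<Omega>. \<alpha> * weight \<alpha> * exp (\<alpha> * \<theta>))" .
qed

subsection \<open>The coordinate\<close>

lemma inj_exp_pdf: "inj (exp_pdf \<Omega> C F)"
proof (rule injI)
  fix \<theta> \<theta>' assume eq: "exp_pdf \<Omega> C F \<theta> = exp_pdf \<Omega> C F \<theta>'"
  obtain x y where xy: "x \<in> \<Omega>" "y \<in> \<Omega>" "F x \<noteq> F y" using nonconst by blast
  have "C z + \<theta> * F z - log_partition \<Omega> C F \<theta> = C z + \<theta>' * F z - log_partition \<Omega> C F \<theta>'" if "z \<in> \<Omega>" for z
    using fun_cong[OF eq, of z] that by (simp add: exp_pdf_def)
  from this[OF xy(1)] this[OF xy(2)] have "(\<theta> - \<theta>') * (F x - F y) = 0"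
    by (simp add: algebra_simps)
  then show "\<theta> = \<theta>'" using xy(3) by simp
qed

lemma coord_exp_pdf [simp]: "coord (exp_manifold \<Omega> C F) (exp_pdf \<Omega> C F \<theta>) = \<theta>"
  by (simp add: exp_manifold_def inv_f_f[OF inj_exp_pdf])

lemma dpts_exp_manifold: "dpts (exp_manifold \<Omega> C F) = range (exp_pdf \<Omega> C F)"
  by (simp add: exp_manifold_def exp_family_def)

lemma coord_surj: "coord (exp_manifold \<Omega> C F) ` dpts (exp_manifold \<Omega> C F) = UNIV"
  unfolding dpts_exp_manifold image_image by simp

lemma inv_coord: "inv_into (dpts (exp_manifold \<Omega> C F)) (coord (exp_manifold \<Omega> C F)) \<theta> = exp_pdf \<Omega> C F \<theta>"
  by (rule inv_into_f_eq) (auto simp: dpts_exp_manifold intro!: inj_onI)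

lemma hmet_exp_manifold:
  "hmet (exp_manifold \<Omega> C F) (exp_pdf \<Omega> C F \<theta>) = deriv (deriv (log_partition \<Omega> C F)) \<theta>"
  by (simp add: exp_manifold_def inv_f_f[OF inj_exp_pdf])

subsection \<open>Constant curvature\<close>

text \<open>The mean \<open>Z1 / Z = \<psi>'\<close> is bounded, so \<open>r = 1 / \<surd>\<psi>''\<close> equals \<open>P exp (a x) + Q exp (- a x)\<close> with positive
  coefficients. Since \<open>a\<^sup>2 r\<^sup>2 - r'\<^sup>2 = 4 a\<^sup>2 P Q\<close>, the functions \<open>\<psi>\<close> and \<open>\<kappa> ln r\<close> with \<open>\<kappa> = 1 / (4 a\<^sup>2 P Q)\<close> have the
  same second derivative. Hence \<open>Z = exp \<psi>\<close> satisfies the differential equation that characterizes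
  binomial weights.\<close>

lemma binomial_if_constant_curvature:
  assumes hpos: "\<And>\<theta>. deriv (deriv (log_partition \<Omega> C F)) \<theta> > 0"
    and r1: "\<And>\<theta>. ((\<lambda>\<theta>. 1 / sqrt (deriv (deriv (log_partition \<Omega> C F)) \<theta>)) has_real_derivative r1 \<theta>) (at \<theta>)"
    and r2: "\<And>\<theta>. (r1 has_real_derivative \<mu> * (1 / sqrt (deriv (deriv (log_partition \<Omega> C F)) \<theta>))) (at \<theta>)"
  obtains a \<alpha>\<^sub>0 w \<rho> where "a > 0" "w > 0" "\<rho> > 0" "F ` \<Omega> = (\<lambda>j. \<alpha>\<^sub>0 + 2 * a * real j) ` {0..red_dim \<Omega> F}"
    "\<And>j. j \<le> red_dim \<Omega> F \<Longrightarrow> weight (\<alpha>\<^sub>0 + 2 * a * real j) = w * real (red_dim \<Omega> F choose j) * \<rho> ^ j"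
    "\<And>\<theta>. deriv (deriv (log_partition \<Omega> C F)) \<theta> = real (red_dim \<Omega> F) * a\<^sup>2 / (cosh (a * \<theta> + ln \<rho> / 2))\<^sup>2"
proof -
  define h where "h = deriv (deriv (log_partition \<Omega> C F))"
  define r where "r \<theta> = 1 / sqrt (h \<theta>)" for \<theta>
  have rpos: "r \<theta> > 0" for \<theta> using hpos[of \<theta>] by (simp add: r_def h_def)
  have h_r: "h \<theta> = 1 / (r \<theta>)\<^sup>2" for \<theta> using hpos[of \<theta>] by (simp add: r_def h_def power_divide)
  have r1': "(r has_real_derivative r1 \<theta>) (at \<theta>)" for \<theta> using r1 unfolding r_def[abs_def] h_def .
  have r2': "(r1 has_real_derivative \<mu> * r \<theta>) (at \<theta>)" for \<theta> using r2 unfolding r_def h_def .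
  have mean': "((\<lambda>\<theta>. Z1 \<theta> / Z \<theta>) has_real_derivative 1 / (r \<theta>)\<^sup>2) (at \<theta>)" for \<theta>
    using log_partition_second_derivative[of \<theta>] unfolding h_def[symmetric] h_r .
  obtain a P Q where pos: "a > 0" "P > 0" "Q > 0"
    and r_eq: "\<And>x. r x = P * exp (a * x) + Q * exp (- a * x)"
    and r1_eq: "\<And>x. r1 x = a * (P * exp (a * x) - Q * exp (- a * x))" and \<mu>: "\<mu> = a\<^sup>2"
    using positive_ode_solution[OF rpos r1' r2' mean' mean_bounded] by blast
  define \<kappa> where "\<kappa> = 1 / (4 * a\<^sup>2 * P * Q)"
  have curv: "\<mu> * (r x)\<^sup>2 - (r1 x)\<^sup>2 = 4 * a\<^sup>2 * P * Q" for x
  proof -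
    have "exp (a * x) * exp (- a * x) = 1" by (simp flip: exp_add)
    moreover have "\<mu> * (r x)\<^sup>2 - (r1 x)\<^sup>2 = 4 * a\<^sup>2 * P * Q * (exp (a * x) * exp (- a * x))"
      unfolding \<mu> r_eq r1_eq by algebra
    ultimately show ?thesis by simp
  qed
  have der0: "((\<lambda>x. Z1 x / Z x - \<kappa> * (r1 x / r x)) has_real_derivative 0) (at x)" for x
  proof -
    have "((\<lambda>x. r1 x / r x) has_real_derivative (\<mu> * r x * r x - r1 x * r1 x) / (r x * r x)) (at x)"
      by (rule DERIV_divide[OF r2' r1']) (use rpos[of x] in simp)
    then have "((\<lambda>x. Z1 x / Z x - \<kappa> * (r1 x / r x)) has_real_derivative
        1 / (r x)\<^sup>2 - \<kappa> * ((\<mu> * r x * r x - r1 x * r1 x) / (r x * r x))) (at x)"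
      by (intro DERIV_diff mean' DERIV_cmult)
    moreover have "\<mu> * r x * r x - r1 x * r1 x = 4 * a\<^sup>2 * P * Q"
      using curv[of x] by (simp add: power2_eq_square mult.assoc)
    moreover have "1 / (r x)\<^sup>2 - \<kappa> * (4 * a\<^sup>2 * P * Q / (r x * r x)) = 0"
      using pos rpos[of x] by (simp add: \<kappa>_def power2_eq_square)
    ultimately show ?thesis by simp
  qed
  define \<beta> where "\<beta> = Z1 0 / Z 0 - \<kappa> * (r1 0 / r 0)"
  have mean_eq: "Z1 x / Z x = \<kappa> * (r1 x / r x) + \<beta>" for x
    using DERIV_isconst_all[of "\<lambda>x. Z1 x / Z x - \<kappa> * (r1 x / r x)" x 0] der0 unfolding \<beta>_def by fastforce
  have ode: "Z1 x * r x = Z x * (\<kappa> * r1 x + \<beta> * r x)" for x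
    using mean_eq[of x] Z_pos[of x] rpos[of x] by (simp add: field_simps)
  obtain n w where n: "\<kappa> = real n" and A: "F ` \<Omega> = (\<lambda>j. \<beta> - \<kappa> * a + 2 * a * real j) ` {0..n}" and w: "w > 0"
    and W: "\<And>j. j \<le> n \<Longrightarrow> weight (\<beta> - \<kappa> * a + 2 * a * real j) = w * real (n choose j) * (P / Q) ^ j"
  proof (rule exp_sum_binomial[of "F ` \<Omega>" weight a P Q \<kappa> \<beta>])
    show "(\<Sum>\<alpha>\<in>F ` \<Omega>. \<alpha> * weight \<alpha> * exp (\<alpha> * x)) * (P * exp (a * x) + Q * exp (- a * x)) =
      (\<Sum>\<alpha>\<in>F ` \<Omega>. weight \<alpha> * exp (\<alpha> * x)) * (\<kappa> * (a * (P * exp (a * x) - Q * exp (- a * x)))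
        + \<beta> * (P * exp (a * x) + Q * exp (- a * x)))" for x
      using ode[of x] unfolding Z_conv_weight r_eq r1_eq .
  qed (use finite nonempty weight_pos pos in auto)
  have "inj_on (\<lambda>j. \<beta> - \<kappa> * a + 2 * a * real j) {0..n}"
    using pos by (auto simp: inj_on_def)
  then have "card (F ` \<Omega>) = Suc n" unfolding A by (simp add: card_image)
  then have dim: "red_dim \<Omega> F = n" by (simp add: red_dim_def)
  define \<rho> where "\<rho> = P / Q"
  have \<rho>: "\<rho> > 0" using pos by (simp add: \<rho>_def)
  have h_eq: "h x = real n * a\<^sup>2 / (cosh (a * x + ln \<rho> / 2))\<^sup>2" for x
  proof -
    define e q where "e = exp (a * x)" and "q = exp (ln \<rho> / 2)"
    have eq: "e > 0" "q > 0" by (simp_all add: e_def q_def)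
    have q2: "q * q = \<rho>" using \<rho> unfolding q_def exp_add[symmetric] by simp
    have "exp (a * x + ln \<rho> / 2) = e * q" by (simp only: exp_add e_def q_def)
    then have cosh_eq: "cosh (a * x + ln \<rho> / 2) = (e * q + inverse (e * q)) / 2"
      unfolding cosh_field_def exp_minus by simp
    have "((u + inverse u) / 2)\<^sup>2 = (u * u + 1)\<^sup>2 / (4 * (u * u))" if "u > 0" for u :: real
      using that by (simp add: power2_eq_square field_simps)
    from this[of "e * q"] have "(cosh (a * x + ln \<rho> / 2))\<^sup>2 = ((e * q) * (e * q) + 1)\<^sup>2 / (4 * ((e * q) * (e * q)))"
      unfolding cosh_eq using eq by simp
    also have "(e * q) * (e * q) = e * e * (q * q)" by algebra
    also have "(e * e * (q * q) + 1)\<^sup>2 / (4 * (e * e * (q * q))) = (e * e * (q * q) + 1)\<^sup>2 / (4 * (e * e) * (q * q))"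
      by (simp only: mult.assoc)
    also have "\<dots> = (P * (e * e) + Q)\<^sup>2 / (4 * (e * e) * P * Q)"
      unfolding q2 \<rho>_def using pos eq by (simp add: power2_eq_square field_simps)
    finally have cosh: "(cosh (a * x + ln \<rho> / 2))\<^sup>2 = (P * (e * e) + Q)\<^sup>2 / (4 * (e * e) * P * Q)" .
    have "r x = (P * (e * e) + Q) / e"
      unfolding r_eq using eq by (simp add: e_def exp_minus field_simps)
    then have "h x = (e * e) / (P * (e * e) + Q)\<^sup>2"
      unfolding h_r using eq by (simp add: power_divide power2_eq_square)
    moreover have "real n * a\<^sup>2 = 1 / (4 * P * Q)" unfolding n[symmetric] \<kappa>_def using pos by simp
    ultimately show ?thesis
      unfolding cosh using pos eq by simp
  qed
  show ?thesis
    by (rule that[of a w \<rho> "\<beta> - \<kappa> * a"]) (use pos w \<rho> A W h_eq in \<open>auto simp: dim h_def \<rho>_def\<close>)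
qed

end

section \<open>Toric exponential families with separating Kaehler functions\<close>

text \<open>Up to the affine change of parameter \<open>\<theta> \<mapsto> 2 a \<theta> + ln \<rho>\<close>, equally spaced values with geometrically
  weighted binomial coefficients define the binomial family; the constants \<open>w\<close> and \<open>\<alpha>\<^sub>0\<close> are absorbed by the
  normalization.\<close>

lemma binomial_family_equiv:
  fixes p :: nat
  assumes a: "a > 0" and w: "w > 0" and \<rho>: "\<rho> > 0" and p: "p = red_dim \<Omega> F"
    and A: "F ` \<Omega> = (\<lambda>j. \<alpha>\<^sub>0 + 2 * a * real j) ` {0..p}"
    and W: "\<And>j. j \<le> p \<Longrightarrow> (\<Sum>x\<in>{x \<in> \<Omega>. F x = \<alpha>\<^sub>0 + 2 * a * real j}. exp (C x)) = w * real (p choose j) * \<rho> ^ j"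
  shows "exp_family_equiv {0..p} (red_C \<Omega> C F) (red_F \<Omega> F) (binom_C p) real"
proof -
  have mono: "strict_mono (\<lambda>j. \<alpha>\<^sub>0 + 2 * a * real j)"
    using a by (auto intro!: strict_monoI)
  have redF: "red_F \<Omega> F k = \<alpha>\<^sub>0 + 2 * a * real k" if "k \<le> p" for k
    unfolding red_F_def A sorted_list_of_set_image_strict_mono[OF mono] using that
    by (simp del: upt_Suc)
  have redC: "red_C \<Omega> C F k = ln w + (binom_C p k + real k * ln \<rho>)" if k: "k \<le> p" for k
  proof -
    have "real (p choose k) > 0" using k by simp
    then show ?thesis
      unfolding red_C_def redF[OF k] W[OF k] binom_C_def using w \<rho> by (simp add: ln_mult ln_realpow)
  qed
  have pdf: "exp_pdf {0..p} (red_C \<Omega> C F) (red_F \<Omega> F) \<theta> = exp_pdf {0..p} (binom_C p) real (2 * a * \<theta> + ln \<rho>)" for \<theta>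
    by (rule exp_pdf_reparametrize[where c="ln w + \<theta> * \<alpha>\<^sub>0"]) (auto simp: redF redC algebra_simps)
  have "range (\<lambda>\<theta>. 2 * a * \<theta> + ln \<rho>) = UNIV"
  proof (intro surjI)
    show "2 * a * ((x - ln \<rho>) / (2 * a)) + ln \<rho> = x" for x using a by simp
  qed
  then have "range (exp_pdf {0..p} (binom_C p) real) = range (exp_pdf {0..p} (binom_C p) real \<circ> (\<lambda>\<theta>. 2 * a * \<theta> + ln \<rho>))"
    by (simp only: image_comp[symmetric])
  then show ?thesis
    unfolding exp_family_equiv_def exp_family_def pdf[abs_def] by (simp add: o_def)
qed

text \<open>The isomorphism is \<open>\<theta> \<mapsto> a \<theta> - s\<close> in affine coordinates. Smoothness of the metric of the model is
  inherited from \<open>M\<close> by this change of variable.\<close>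

lemma dually_flat_isomorphic_model:
  fixes M :: "'m dually_flat"
  assumes M: "dually_flat_manifold M" and surj: "coord M ` dpts M = UNIV" and a: "a > 0" and c: "c > 0"
    and h: "\<And>x. hmet M (inv_into (dpts M) (coord M) x) = a\<^sup>2 / c / (cosh (a * x - s))\<^sup>2"
  shows "dually_flat_isomorphic M (model c)"
proof -
  interpret dually_flat_manifold M by (rule M)
  define h' where "h' x = hmet M (inv_into (dpts M) (coord M) x)" for x
  have lin: "bounded_linear (\<lambda>x. inverse a * x :: real)" "bounded_linear (\<lambda>x. a * x :: real)"
    by (rule bounded_linear_mult_right)+
  have affine: "smooth_on (\<lambda>x. k * x + d) (UNIV :: real set)" for k d :: real
    unfolding smooth_on_def
    by (intro allI Ck_on_add Ck_on_const Ck_on_bounded_linear bounded_linear_mult_right open_UNIV)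
  have "smooth_on h' UNIV"
    using hmet_smooth unfolding surj by (simp add: o_def h'_def[abs_def])
  then have "Ck_on k (\<lambda>x. inverse (a\<^sup>2) * h' (inverse a * x + s / a)) UNIV" for k
    unfolding smooth_on_def
    by (intro Ck_on_mult Ck_on_const Ck_on_affine_precompose[OF lin(1), where S=UNIV]) auto
  moreover have "inverse (a\<^sup>2) * h' (inverse a * x + s / a) = 1 / (c * (cosh x)\<^sup>2)" for x
  proof -
    have "a * (inverse a * x + s / a) - s = x" using a by (simp add: distrib_left)
    then show ?thesis unfolding h'_def h using a by simp
  qed
  ultimately have smooth: "smooth_on (\<lambda>x. 1 / (c * (cosh x)\<^sup>2)) UNIV"
    unfolding smooth_on_def by simp
  have inv_id: "inv_into UNIV (\<lambda>\<theta> :: real. \<theta>) x = x" for x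
    by (rule inv_into_f_f) auto
  have model: "dually_flat_manifold (model c)"
    by unfold_locales (use smooth c in \<open>auto simp: model_def o_def inv_id cosh_real_pos\<close>)
  have coord_inv: "coord M (inv_into (dpts M) (coord M) x) = x" for x
    by (rule f_inv_into_f) (simp add: surj)
  have in_M: "inv_into (dpts M) (coord M) x \<in> dpts M" for x
    by (rule inv_into_into) (simp add: surj)
  define f where "f p = a * coord M p + (- s)" for p
  have bij: "bij_betw f (dpts M) UNIV"
    unfolding bij_betw_def
  proof
    show "inj_on f (dpts M)"
      using inj_coord a by (auto simp: inj_on_def f_def)
    have "x = f (inv_into (dpts M) (coord M) ((x + s) / a))" for x
      using a by (simp add: f_def coord_inv)
    then show "f ` dpts M = UNIV" using in_M by blast
  qed
  have rep: "coord_rep M (model c) f = (\<lambda>x. a * x + (- s))"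
    by (rule ext) (simp add: coord_rep_def model_def f_def coord_inv)
  have rep': "coord_rep (model c) M (inv_into (dpts M) f) = (\<lambda>x. inverse a * x + s / a)"
  proof
    fix x
    have "f (inv_into (dpts M) f x) = x"
      by (rule f_inv_into_f) (use bij in \<open>auto simp: bij_betw_def\<close>)
    then have "a * coord M (inv_into (dpts M) f x) = x + s" by (simp add: f_def)
    then have "coord M (inv_into (dpts M) f x) = (x + s) / a" using a by (simp add: eq_divide_eq mult.commute)
    also have "(x + s) / a = inverse a * x + s / a" unfolding divide_inverse by algebra
    finally show "coord_rep (model c) M (inv_into (dpts M) f) x = inverse a * x + s / a"
      by (simp add: coord_rep_def model_def inv_id)
  qed
  have "dually_flat_iso M (model c) f"
    unfolding dually_flat_iso_def rep rep'
  proof (intro conjI ballI)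
    show "bij_betw f (dpts M) (dpts (model c))" using bij by (simp add: model_def)
    show "smooth_on (\<lambda>x. a * x + - s) (coord M ` dpts M)" unfolding surj by (rule affine)
    show "smooth_on (\<lambda>x. inverse a * x + s / a) (coord (model c) ` dpts (model c))" using affine by (simp add: model_def)
    show "\<exists>a' b'. \<forall>\<^sub>F x in nhds t. a * x + - s = a' * x + b'" for t :: real
      by (intro exI always_eventually allI) (rule refl)
    fix p assume p: "p \<in> dpts M"
    have "((\<lambda>x. a * x + - s) has_real_derivative a) (at (coord M p))"
      by (auto intro!: derivative_eq_intros)
    then have d: "deriv (\<lambda>x. a * x + - s) (coord M p) = a" by (rule DERIV_imp_deriv)
    have "hmet M p = a\<^sup>2 / c / (cosh (a * coord M p - s))\<^sup>2"
      using h[of "coord M p"] inv_into_f_f[OF inj_coord p] by simp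
    then show "hmet (model c) (f p) * (deriv (\<lambda>x. a * x + - s) (coord M p))\<^sup>2 = hmet M p"
      unfolding d by (simp add: model_def f_def)
  qed
  then show ?thesis
    unfolding dually_flat_isomorphic_def using M model by blast
qed

theorem theorem5p6:
  fixes \<Omega> :: "'x set" and C F :: "'x \<Rightarrow> real"
    and N :: "'a hermitian" and \<Phi> :: "real \<Rightarrow> 'a \<Rightarrow> 'a" and p :: nat
  assumes finite: "finite \<Omega>"
    and nonconst: "\<exists>x\<in>\<Omega>. \<exists>y\<in>\<Omega>. F x \<noteq> F y"
    and p: "p = red_dim \<Omega> F"
    and toric: "regular_torification (exp_manifold \<Omega> C F) N \<Phi>"
    and separates: "separates_points (pts N) (kahler_functions N)"
  shows "exp_family_equiv {0..p} (red_C \<Omega> C F) (red_F \<Omega> F) (binom_C p) real \<and>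
    dually_flat_isomorphic (exp_manifold \<Omega> C F) (model (1 / real p)) \<and>
    regular_torification (exp_manifold \<Omega> C F) (proj_line (1 / real p)) proj_action"
proof -
  interpret exponential_family \<Omega> C F
    using finite nonconst by unfold_locales
  let ?M = "exp_manifold \<Omega> C F"
  have tor: "torification ?M N \<Phi>" using toric by (simp add: regular_torification_def)
  then have M: "dually_flat_manifold ?M" unfolding torification_def by (rule conjunct1)
  have hpos: "deriv (deriv (log_partition \<Omega> C F)) \<theta> > 0" for \<theta>
    using dually_flat_manifold.hmet_pos[OF M, of "exp_pdf \<Omega> C F \<theta>"]
    by (simp add: hmet_exp_manifold dpts_exp_manifold)
  show ?thesis
  proof (rule torification_separating_imp_ode[OF tor coord_surj separates], unfold inv_coord hmet_exp_manifold)
    fix \<mu> r1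
    assume ode: "\<And>\<theta>. ((\<lambda>\<theta>. 1 / sqrt (deriv (deriv (log_partition \<Omega> C F)) \<theta>)) has_real_derivative r1 \<theta>) (at \<theta>)"
      "\<And>\<theta>. (r1 has_real_derivative \<mu> * (1 / sqrt (deriv (deriv (log_partition \<Omega> C F)) \<theta>))) (at \<theta>)"
    show ?thesis
    proof (rule binomial_if_constant_curvature[OF hpos ode], fold p)
      fix a w \<rho> \<alpha>\<^sub>0
      assume pos: "a > 0" "w > 0" "\<rho> > 0"
        and A: "F ` \<Omega> = (\<lambda>j. \<alpha>\<^sub>0 + 2 * a * real j) ` {0..p}"
        and W: "\<And>j. j \<le> p \<Longrightarrow> weight (\<alpha>\<^sub>0 + 2 * a * real j) = w * real (p choose j) * \<rho> ^ j"
        and h: "\<And>\<theta>. deriv (deriv (log_partition \<Omega> C F)) \<theta> = real p * a\<^sup>2 / (cosh (a * \<theta> + ln \<rho> / 2))\<^sup>2"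
      have c: "1 / real p > 0"
      proof -
        have "p \<noteq> 0"
        proof
          assume "p = 0"
          have "F x = \<alpha>\<^sub>0" if "x \<in> \<Omega>" for x
            using imageI[OF that, of F] unfolding A \<open>p = 0\<close> by simp
          with nonconst show False by force
        qed
        then show ?thesis by simp
      qed
      have hM: "hmet ?M (inv_into (dpts ?M) (coord ?M) \<theta>) = a\<^sup>2 / (1 / real p) / (cosh (a * \<theta> - (- ln \<rho> / 2)))\<^sup>2" for \<theta>
        unfolding inv_coord hmet_exp_manifold h by (simp add: mult.commute)
      show ?thesis
      proof (intro conjI)
        show "exp_family_equiv {0..p} (red_C \<Omega> C F) (red_F \<Omega> F) (binom_C p) real"
          by (rule binomial_family_equiv[OF pos p A W[unfolded weight_def]])
        show "dually_flat_isomorphic ?M (model (1 / real p))"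
          by (rule dually_flat_isomorphic_model[OF M coord_surj pos(1) c hM])
        show "regular_torification ?M (proj_line (1 / real p)) proj_action"
          by (rule regular_torification_proj_line[OF M coord_surj pos(1) c hM])
      qed
    qed
  qed
qed

end
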